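(* Let $\Phi^+$ be the set of positive roots of a semisimple complex linear algebraic group $G$. For a lower ideal $I\subset\Phi^+$ put $$P=\prod_{\alpha\in\Phi^+}\alpha,\qquad \beta_I=\prod_{\alpha\in\Phi^+\setminus I}\alpha,\qquad P_I=\partial_{\beta_I}(P).$$ Then $\mathrm{Ann}(P_I)=\mathfrak a(I)$ for any lower ideal $I$.
   Context: Let $W$ be the Weyl group, $T$ the maximal torus, $\mathfrak t$ the Lie algebra of the maximal compact torus of $T$, and identify $\mathfrak t^*=\hat T\otimes\mathbb R$ with $\hat T$ the character group of $T$, so that roots are linear functions on $\mathfrak t$. Put $\mathcal R=\mathrm{Sym}(\mathfrak t^* )$. With $\alpha_1,\dots,\alpha_n$ the simple roots, $\alpha\preceq\beta$ iff $\beta-\alpha\in\sum_i\mathbb Z_{\ge0}\alpha_i$; a lower ideal is $I\subset\Phi^+$ such that $\alpha\in\Phi^+$, $\beta\in I$, $\alpha\preceq\beta$ imply $\alpha\in I$. Differential operators: $\mathfrak t$ acts on $\mathcal R$ by derivations, and $\mathcal D=\mathrm{Sym}(\mathfrak t)$ acts on $\mathcal R$ as differential operators with constant coefficients. Fix a $W$-invariant inner product on $\mathfrak t$; it gives an isomorphism $\mathfrak t^*\cong\mathfrak t$ and hence a graded algebra isomorphism $\mathcal R\cong\mathcal D$, $f\mapsto\partial_f$. (In an orthonormal coordinate system $x_1,\dots,x_n$, $\partial_f=f(\partial/\partial x_1,\dots,\partial/\partial x_n)$.) For $g\in\mathcal R$, $\mathrm{Ann}(g)=\{f\in\mathcal R\mid\partial_f(g)=0\}$.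 The ideal $\mathfrak a(I)$: $\mathrm{Der}\,\mathcal R=\mathcal R\otimes\mathfrak t$, $\mathcal A_I=\{\ker\alpha\mid\alpha\in I\}$, $D(\mathcal A_I)=\{\theta\in\mathrm{Der}\,\mathcal R\mid\theta(\alpha)\in\mathcal R\alpha\ \forall\alpha\in I\}$, and $\mathfrak a(I)=\{\theta(Q)\mid\theta\in D(\mathcal A_I)\}$ for a fixed $W$-invariant non-degenerate quadratic form $Q\in\mathrm{Sym}^2(\mathfrak t^* )^W$ (the ideal is independent of the choice of $Q$). An empty product is 1. *)

theory Defs
  imports "HOL-Analysis.Analysis"
begin

text \<open>
  The Lie algebra \<open>\<tt>\<close> of the maximal compact torus is a type \<open>'a\<close> of class \<^class>\<open>real_inner\<close>, whose
  inner product plays the role of the fixed \<open>W\<close>-invariant inner product.  Finite dimension is not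
  built into the class (which therefore also admits \<open>\<tt> = 0\<close>); it follows from the assumption that
  the finitely many roots span.  A root is represented by the vector \<open>a\<close> that corresponds to
  it under \<open>\<tt>\<^sup>* \<cong> \<tt>\<close>; as a linear function it is \<open>\<lambda>x. a \<bullet> x\<close>.
  The root systems of semisimple complex linear algebraic groups are exactly the reduced
  crystallographic root systems, in a space spanned by the roots.
\<close>

subsection \<open>Root systems\<close>

definition reflection :: "'a::real_inner \<Rightarrow> 'a \<Rightarrow> 'a" where
  "reflection a x = x - (2 * (a \<bullet> x) / (a \<bullet> a)) *\<^sub>R a"

definition root_system :: "'a::real_inner set \<Rightarrow> bool" where
  "root_system \<Phi> \<longleftrightarrow>
     finite \<Phi> \<and> 0 \<notin> \<Phi> \<and> span \<Phi> = UNIV \<and>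
     (\<forall>a\<in>\<Phi>. \<forall>c. c *\<^sub>R a \<in> \<Phi> \<longrightarrow> c = 1 \<or> c = -1) \<and>
     (\<forall>a\<in>\<Phi>. reflection a ` \<Phi> = \<Phi>) \<and>
     (\<forall>a\<in>\<Phi>. \<forall>b\<in>\<Phi>. 2 * (a \<bullet> b) / (a \<bullet> a) \<in> \<int>)"

inductive_set weyl_group :: "'a::real_inner set \<Rightarrow> ('a \<Rightarrow> 'a) set" for \<Phi> where
  id: "id \<in> weyl_group \<Phi>"
| refl: "a \<in> \<Phi> \<Longrightarrow> w \<in> weyl_group \<Phi> \<Longrightarrow> reflection a \<circ> w \<in> weyl_group \<Phi>"

definition nonneg_combs :: "'a::real_vector set \<Rightarrow> 'a set" where
  "nonneg_combs \<Delta> = {v. \<exists>c::'a \<Rightarrow> nat. v = (\<Sum>d\<in>\<Delta>. of_nat (c d) *\<^sub>R d)}"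

definition simple_roots :: "'a::real_inner set \<Rightarrow> 'a set \<Rightarrow> bool" where
  "simple_roots \<Phi> \<Delta> \<longleftrightarrow>
     \<Delta> \<subseteq> \<Phi> \<and> independent \<Delta> \<and> (\<forall>a\<in>\<Phi>. a \<in> nonneg_combs \<Delta> \<or> - a \<in> nonneg_combs \<Delta>)"

definition positive_roots :: "'a::real_inner set \<Rightarrow> 'a set \<Rightarrow> 'a set" where
  "positive_roots \<Phi> \<Delta> = \<Phi> \<inter> nonneg_combs \<Delta>"

definition root_le :: "'a::real_inner set \<Rightarrow> 'a \<Rightarrow> 'a \<Rightarrow> bool" where
  "root_le \<Delta> a b \<longleftrightarrow> b - a \<in> nonneg_combs \<Delta>"

definition lower_ideal :: "'a::real_inner set \<Rightarrow> 'a set \<Rightarrow> 'a set \<Rightarrow> bool" where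
  "lower_ideal \<Phi> \<Delta> I \<longleftrightarrow>
     I \<subseteq> positive_roots \<Phi> \<Delta> \<and>
     (\<forall>a\<in>positive_roots \<Phi> \<Delta>. \<forall>b\<in>I. root_le \<Delta> a b \<longrightarrow> a \<in> I)"

lemma weyl_group_inner:
  assumes "w \<in> weyl_group \<Phi>"
  shows "w x \<bullet> w y = x \<bullet> y"
  using assms
proof (induction arbitrary: x y)
  case (refl a w)
  have "reflection a u \<bullet> reflection a v = u \<bullet> v" for u v
    by (cases "a = 0") (simp_all add: reflection_def inner_diff_left inner_diff_right field_simps inner_commute)
  then show ?case using refl by simp
qed simp


subsection \<open>Polynomials and constant coefficient differential operators\<close>

text \<open>
  Since the ground field is infinite, \<open>\<R> = Sym(\<tt>\<^sup>*)\<close> is the algebra of polynomial functions on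
  \<open>\<tt>\<close>, given by \<^const>\<open>real_polynomial_function\<close>.
\<close>

definition dir_deriv :: "'a::real_inner \<Rightarrow> ('a \<Rightarrow> real) \<Rightarrow> 'a \<Rightarrow> real" where
  "dir_deriv v g = (\<lambda>x. frechet_derivative g (at x) v)"

text \<open>
  \<open>const_coeff f D\<close>: the operator \<open>D\<close> is \<open>\<partial>\<^sub>f\<close>, where \<open>f \<mapsto> \<partial>\<^sub>f\<close> is the
  algebra homomorphism \<open>Sym(\<tt>\<^sup>*) \<cong> Sym(\<tt>)\<close> extending the isomorphism \<open>\<tt>\<^sup>* \<cong> \<tt>\<close> that
  takes \<open>\<lambda>x. v \<bullet> x\<close> to \<open>v\<close>, and \<open>v\<close> acts as the derivative in direction \<open>v\<close>.  The lemmas below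
  show that the value of \<open>D\<close> on polynomials depends on the function \<open>f\<close> only.
\<close>

inductive const_coeff :: "('a::real_inner \<Rightarrow> real) \<Rightarrow> (('a \<Rightarrow> real) \<Rightarrow> 'a \<Rightarrow> real) \<Rightarrow> bool" where
  const: "const_coeff (\<lambda>x. c) (\<lambda>g x. c * g x)"
| linear: "const_coeff (\<lambda>x. v \<bullet> x) (dir_deriv v)"
| add: "const_coeff f D \<Longrightarrow> const_coeff g E \<Longrightarrow> const_coeff (\<lambda>x. f x + g x) (\<lambda>h x. D h x + E h x)"
| mult: "const_coeff f D \<Longrightarrow> const_coeff g E \<Longrightarrow> const_coeff (\<lambda>x. f x * g x) (\<lambda>h. D (E h))"

definition diff_op :: "('a::real_inner \<Rightarrow> real) \<Rightarrow> ('a \<Rightarrow> real) \<Rightarrow> 'a \<Rightarrow> real" where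
  "diff_op f g = (THE h. \<exists>D. const_coeff f D \<and> h = D g)"

definition Ann :: "('a::real_inner \<Rightarrow> real) \<Rightarrow> ('a \<Rightarrow> real) set" where
  "Ann g = {f. real_polynomial_function f \<and> diff_op f g = (\<lambda>x. 0)}"

lemma const_coeff_poly: "const_coeff f D \<Longrightarrow> real_polynomial_function f"
  by (induction rule: const_coeff.induct) (auto intro: bounded_linear_inner_right)

lemma riesz_finite:
  fixes S :: "'a::real_inner set"
  assumes "finite S" "linear f"
  shows "\<exists>a\<in>span S. \<forall>x\<in>span S. f x = a \<bullet> x"
  using assms
proof (induction arbitrary: f)
  case empty
  then show ?case by (auto simp: linear_0)
next
  case (insert s S)
  interpret linear f by (rule insert)
  obtain a where a: "a \<in> span S" "\<forall>x\<in>span S. f x = a \<bullet> x"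
    using insert by blast
  have "linear (\<lambda>x. s \<bullet> x)"
    by (simp add: bounded_linear.linear bounded_linear_inner_right)
  then obtain p where p: "p \<in> span S" "\<forall>x\<in>span S. s \<bullet> x = p \<bullet> x"
    using insert by blast
  define q where "q = s - p"
  have q: "q \<bullet> x = 0" "x \<bullet> q = 0" if "x \<in> span S" for x
    using p that by (auto simp: q_def inner_diff_left inner_diff_right inner_commute)
  define b where "b = a + (f q / (q \<bullet> q)) *\<^sub>R q"
  have sub: "span S \<subseteq> span (insert s S)" by (rule span_mono) auto
  have "q \<in> span (insert s S)"
    unfolding q_def using p(1) sub by (meson insertI1 span_base span_diff subsetD)
  then have "b \<in> span (insert s S)"
    using a(1) sub by (auto simp: b_def intro!: span_add span_scale)
  moreover have "f x = b \<bullet> x" if x: "x \<in> span (insert s S)" for x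
  proof -
    obtain k where k: "x - k *\<^sub>R s \<in> span S"
      using x by (auto simp: span_insert)
    define y where "y = (x - k *\<^sub>R s) + k *\<^sub>R p"
    have y: "y \<in> span S" using k p(1) by (auto simp: y_def intro: span_add span_scale)
    have x_eq: "x = y + k *\<^sub>R q" by (simp add: y_def q_def algebra_simps)
    have "q = 0 \<or> q \<bullet> q \<noteq> 0" by simp
    then show ?thesis
      using a(2) y q[OF y] q[OF a(1)]
      by (auto simp: x_eq b_def add scale inner_add_left inner_add_right zero)
  qed
  ultimately show ?case by blast
qed

lemma poly_const_coeff:
  fixes S :: "'a::real_inner set" and f :: "'a \<Rightarrow> real"
  assumes "finite S" "span S = UNIV" "real_polynomial_function f"
  shows "\<exists>D. const_coeff f D"
  using assms(3)
proof (induction rule: real_polynomial_function.induct)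
  case (linear f)
  then obtain a where "\<forall>x. f x = a \<bullet> x"
    using riesz_finite[OF assms(1), of f] assms(2) by (auto simp: bounded_linear.linear)
  then have "f = (\<lambda>x. a \<bullet> x)" by auto
  then show ?case by (auto intro: const_coeff.linear)
qed (blast intro: const_coeff.intros)+

lemma poly_has_derivative:
  "real_polynomial_function g \<Longrightarrow> (g has_derivative frechet_derivative g (at x)) (at x)"
  using differentiable_at_real_polynomial_function frechet_derivative_works by blast

lemma dir_deriv_eq: "(\<And>x. (g has_derivative g' x) (at x)) \<Longrightarrow> dir_deriv v g = (\<lambda>x. g' x v)"
  by (metis dir_deriv_def frechet_derivative_at)

lemma dir_deriv_const: "dir_deriv v (\<lambda>x. c) = (\<lambda>x. 0)"
  by (simp add: dir_deriv_def)

lemma dir_deriv_bounded_linear: "bounded_linear f \<Longrightarrow> dir_deriv v f = (\<lambda>x. f v)"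
  by (rule dir_deriv_eq) (rule bounded_linear_imp_has_derivative)

lemma dir_deriv_inner: "dir_deriv v (\<lambda>x. a \<bullet> x) = (\<lambda>x. a \<bullet> v)"
  by (rule dir_deriv_bounded_linear) (rule bounded_linear_inner_right)

lemma dir_deriv_add:
  assumes "real_polynomial_function f" "real_polynomial_function g"
  shows "dir_deriv v (\<lambda>x. f x + g x) = (\<lambda>x. dir_deriv v f x + dir_deriv v g x)"
  unfolding dir_deriv_def[of v f] dir_deriv_def[of v g]
  by (rule dir_deriv_eq) (intro has_derivative_add poly_has_derivative assms)

lemma dir_deriv_mult:
  assumes "real_polynomial_function f" "real_polynomial_function g"
  shows "dir_deriv v (\<lambda>x. f x * g x) = (\<lambda>x. f x * dir_deriv v g x + dir_deriv v f x * g x)"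
  unfolding dir_deriv_def[of v f] dir_deriv_def[of v g]
  by (rule dir_deriv_eq) (intro has_derivative_mult poly_has_derivative assms)

lemma dir_deriv_poly:
  "real_polynomial_function g \<Longrightarrow> real_polynomial_function (dir_deriv v g)"
  by (induction rule: real_polynomial_function.induct)
     (auto simp: dir_deriv_bounded_linear dir_deriv_const dir_deriv_add dir_deriv_mult)

lemma const_coeff_apply_poly:
  "const_coeff f D \<Longrightarrow> real_polynomial_function g \<Longrightarrow> real_polynomial_function (D g)"
  by (induction arbitrary: g rule: const_coeff.induct) (auto simp: dir_deriv_poly)

lemma const_coeff_apply_add:
  "const_coeff f D \<Longrightarrow> real_polynomial_function g \<Longrightarrow> real_polynomial_function h \<Longrightarrow>
     D (\<lambda>x. g x + h x) = (\<lambda>x. D g x + D h x)"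
  by (induction arbitrary: g h rule: const_coeff.induct)
     (auto simp: dir_deriv_add const_coeff_apply_poly algebra_simps)

lemma const_coeff_apply_cmult:
  "const_coeff f D \<Longrightarrow> real_polynomial_function g \<Longrightarrow> D (\<lambda>x. c * g x) = (\<lambda>x. c * D g x)"
  by (induction arbitrary: g rule: const_coeff.induct)
     (simp_all add: dir_deriv_mult[OF real_polynomial_function.intros(2)] dir_deriv_const
       const_coeff_apply_poly algebra_simps)

lemma const_coeff_one_at_0: "const_coeff f D \<Longrightarrow> D (\<lambda>x. c) 0 = c * f 0"
proof -
  assume "const_coeff f D"
  then have "\<forall>c. D (\<lambda>x. c) = (\<lambda>x. c * f 0)"
    by (induction rule: const_coeff.induct) (auto simp: dir_deriv_const algebra_simps)
  then show ?thesis by simp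
qed

lemma const_coeff_commutator:
  assumes "const_coeff g E"
  shows "\<exists>E'. const_coeff (dir_deriv v g) E' \<and>
           (\<forall>h. real_polynomial_function h \<longrightarrow>
              E (\<lambda>x. (v \<bullet> x) * h x) = (\<lambda>x. (v \<bullet> x) * E h x + E' h x))"
  using assms
proof (induction rule: const_coeff.induct)
  case (const c)
  show ?case
    by (rule exI[of _ "\<lambda>g x. 0 * g x"])
       (use const_coeff.const[of 0] in \<open>auto simp: dir_deriv_const algebra_simps\<close>)
next
  case (linear a)
  have *: "real_polynomial_function (\<lambda>x. v \<bullet> x)"
    by (auto intro: bounded_linear_inner_right)
  show ?case
    by (rule exI[of _ "\<lambda>g x. (a \<bullet> v) * g x"])
       (use const_coeff.const[of "a \<bullet> v"] * in
        \<open>auto simp: dir_deriv_inner dir_deriv_mult inner_commute[of v a]\<close>)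
next
  case (add f D g E)
  then obtain D' E' where D': "const_coeff (dir_deriv v f) D'"
      "\<forall>h. real_polynomial_function h \<longrightarrow> D (\<lambda>x. (v \<bullet> x) * h x) = (\<lambda>x. (v \<bullet> x) * D h x + D' h x)"
    and E': "const_coeff (dir_deriv v g) E'"
      "\<forall>h. real_polynomial_function h \<longrightarrow> E (\<lambda>x. (v \<bullet> x) * h x) = (\<lambda>x. (v \<bullet> x) * E h x + E' h x)"
    by blast
  have "const_coeff (dir_deriv v (\<lambda>x. f x + g x)) (\<lambda>h x. D' h x + E' h x)"
    using const_coeff.add[OF D'(1) E'(1)] add.hyps by (simp add: dir_deriv_add const_coeff_poly)
  then show ?case
    using D'(2) E'(2) by (intro exI conjI) (auto simp: algebra_simps)
next
  case (mult f D g E)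
  then obtain D' E' where D': "const_coeff (dir_deriv v f) D'"
      "\<forall>h. real_polynomial_function h \<longrightarrow> D (\<lambda>x. (v \<bullet> x) * h x) = (\<lambda>x. (v \<bullet> x) * D h x + D' h x)"
    and E': "const_coeff (dir_deriv v g) E'"
      "\<forall>h. real_polynomial_function h \<longrightarrow> E (\<lambda>x. (v \<bullet> x) * h x) = (\<lambda>x. (v \<bullet> x) * E h x + E' h x)"
    by blast
  have *: "const_coeff (dir_deriv v (\<lambda>x. f x * g x)) (\<lambda>h x. D (E' h) x + D' (E h) x)"
    using const_coeff.add[OF const_coeff.mult[OF mult.hyps(1) E'(1)] const_coeff.mult[OF D'(1) mult.hyps(2)]]
      mult.hyps by (simp add: dir_deriv_mult const_coeff_poly)
  have v: "real_polynomial_function (\<lambda>x. v \<bullet> x)"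
    by (auto intro: bounded_linear_inner_right)
  have "D (E (\<lambda>x. (v \<bullet> x) * h x)) = (\<lambda>x. (v \<bullet> x) * D (E h) x + (D (E' h) x + D' (E h) x))"
    if h: "real_polynomial_function h" for h
  proof -
    note Eh = const_coeff_apply_poly[OF mult.hyps(2) h] const_coeff_apply_poly[OF E'(1) h]
    have "D (E (\<lambda>x. (v \<bullet> x) * h x)) = D (\<lambda>x. (v \<bullet> x) * E h x + E' h x)"
      using E'(2) h by simp
    also have "\<dots> = (\<lambda>x. D (\<lambda>x. (v \<bullet> x) * E h x) x + D (E' h) x)"
      by (rule const_coeff_apply_add[OF mult.hyps(1)]) (use Eh v in auto)
    also have "\<dots> = (\<lambda>x. (v \<bullet> x) * D (E h) x + (D (E' h) x + D' (E h) x))"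
      using D'(2) Eh by (simp add: algebra_simps)
    finally show ?thesis .
  qed
  with * show ?case by blast
qed

lemma const_coeff_adjoint:
  assumes "const_coeff f D" "const_coeff g E"
  shows "\<exists>E'. const_coeff (D g) E' \<and>
           (\<forall>h. real_polynomial_function h \<longrightarrow> E (\<lambda>x. f x * h x) 0 = E' h 0)"
  using assms
proof (induction arbitrary: g E rule: const_coeff.induct)
  case (const c)
  have "const_coeff (\<lambda>x. c * g x) (\<lambda>h x. c * E h x)"
    using const_coeff.mult[OF const_coeff.const const] by simp
  then show ?case using const_coeff_apply_cmult[OF const] by auto
next
  case (linear v)
  then show ?case using const_coeff_commutator[OF linear, of v] by force
next
  case (add f1 D1 f2 D2)
  obtain E1 where E1: "const_coeff (D1 g) E1"
      "\<forall>h. real_polynomial_function h \<longrightarrow> E (\<lambda>x. f1 x * h x) 0 = E1 h 0"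
    using add.IH(1)[OF add.prems] by blast
  obtain E2 where E2: "const_coeff (D2 g) E2"
      "\<forall>h. real_polynomial_function h \<longrightarrow> E (\<lambda>x. f2 x * h x) 0 = E2 h 0"
    using add.IH(2)[OF add.prems] by blast
  have "E (\<lambda>x. (f1 x + f2 x) * h x) 0 = E1 h 0 + E2 h 0" if h: "real_polynomial_function h" for h
  proof -
    have "E (\<lambda>x. f1 x * h x + f2 x * h x) = (\<lambda>x. E (\<lambda>x. f1 x * h x) x + E (\<lambda>x. f2 x * h x) x)"
      by (intro const_coeff_apply_add[OF add.prems] real_polynomial_function.intros(4) h)
         (fact const_coeff_poly[OF add.hyps(1)] const_coeff_poly[OF add.hyps(2)])+
    then show ?thesis using E1(2) E2(2) h by (simp add: distrib_right)
  qed
  then show ?case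
    by (intro exI[of _ "\<lambda>h x. E1 h x + E2 h x"] conjI allI impI const_coeff.add E1(1) E2(1))
next
  case (mult f1 D1 f2 D2)
  obtain E2 where E2: "const_coeff (D2 g) E2"
      "\<forall>h. real_polynomial_function h \<longrightarrow> E (\<lambda>x. f2 x * h x) 0 = E2 h 0"
    using mult.IH(2)[OF mult.prems] by blast
  obtain E1 where E1: "const_coeff (D1 (D2 g)) E1"
      "\<forall>h. real_polynomial_function h \<longrightarrow> E2 (\<lambda>x. f1 x * h x) 0 = E1 h 0"
    using mult.IH(1)[OF E2(1)] by blast
  have "E (\<lambda>x. f1 x * f2 x * h x) 0 = E1 h 0" if h: "real_polynomial_function h" for h
  proof -
    have "real_polynomial_function (\<lambda>x. f1 x * h x)"
      by (intro real_polynomial_function.intros(4) const_coeff_poly[OF mult.hyps(1)] h)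
    then have "E (\<lambda>x. f2 x * (f1 x * h x)) 0 = E1 h 0"
      using E1(2)[rule_format, OF h] E2(2)[rule_format, of "\<lambda>x. f1 x * h x"] by simp
    then show ?thesis by (simp add: ac_simps)
  qed
  then show ?case by (intro exI[of _ E1] conjI allI impI E1(1))
qed

lemma const_coeff_symmetric:
  assumes "const_coeff f D" "const_coeff g E"
  shows "D g 0 = E f 0"
proof -
  obtain E' where E': "const_coeff (D g) E'"
      "\<forall>h. real_polynomial_function h \<longrightarrow> E (\<lambda>x. f x * h x) 0 = E' h 0"
    using const_coeff_adjoint[OF assms] by blast
  have "E f 0 = E' (\<lambda>x. 1) 0" using E'(2)[rule_format, of "\<lambda>x. 1"] by auto
  then show ?thesis using const_coeff_one_at_0[OF E'(1)] by simp
qed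

lemma dir_deriv_shift:
  assumes "real_polynomial_function g"
  shows "dir_deriv v (\<lambda>x. g (y + x)) = (\<lambda>x. dir_deriv v g (y + x))"
proof (unfold dir_deriv_def[of v g], rule dir_deriv_eq)
  fix x
  have "((\<lambda>x. y + x) has_derivative (\<lambda>x. x)) (at x)"
    by (auto intro!: derivative_eq_intros)
  from has_derivative_compose[OF this poly_has_derivative[OF assms]]
  show "((\<lambda>x. g (y + x)) has_derivative frechet_derivative g (at (y + x))) (at x)" .
qed

lemma const_coeff_apply_shift:
  "const_coeff f D \<Longrightarrow> real_polynomial_function g \<Longrightarrow> D (\<lambda>x. g (y + x)) = (\<lambda>x. D g (y + x))"
  by (induction arbitrary: g rule: const_coeff.induct)
     (auto simp: dir_deriv_shift const_coeff_apply_poly)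

lemma const_coeff_unique:
  fixes S :: "'a::real_inner set" and g :: "'a \<Rightarrow> real"
  assumes "finite S" "span S = UNIV" "real_polynomial_function g"
    and "const_coeff f D" "const_coeff f E"
  shows "D g = E g"
proof
  fix y
  have shifted: "real_polynomial_function (\<lambda>x. g (y + x))"
    using assms(3)
    by (induction rule: real_polynomial_function.induct)
       (auto simp: linear_add bounded_linear.linear)
  obtain G where G: "const_coeff (\<lambda>x. g (y + x)) G"
    using poly_const_coeff[OF assms(1,2) shifted] by (rule exE)
  have "D (\<lambda>x. g (y + x)) 0 = E (\<lambda>x. g (y + x)) 0"
    using const_coeff_symmetric[OF assms(4) G] const_coeff_symmetric[OF assms(5) G] by simp
  then show "D g y = E g y"
    by (simp add: const_coeff_apply_shift[OF assms(4,3)] const_coeff_apply_shift[OF assms(5,3)])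
qed

lemma diff_op_eq:
  fixes S :: "'a::real_inner set" and g :: "'a \<Rightarrow> real"
  assumes "finite S" "span S = UNIV" "real_polynomial_function g" "const_coeff f D"
  shows "diff_op f g = D g"
  unfolding diff_op_def
proof (rule the_equality)
  show "\<exists>E. const_coeff f E \<and> D g = E g"
    by (rule exI[of _ D]) (simp add: assms(4))
  show "h = D g" if "\<exists>E. const_coeff f E \<and> h = E g" for h
    using that const_coeff_unique[OF assms(1-3) _ assms(4)] by auto
qed


subsection \<open>Logarithmic derivations and the ideal of a lower ideal\<close>

text \<open>
  \<open>Der \<R> = \<R> \<otimes> \<tt>\<close> consists of the polynomial vector fields \<open>\<theta> : \<tt> \<rightarrow> \<tt>\<close>, given by
  \<^const>\<open>polynomial_function\<close>.
\<close>

definition deriv_apply :: "('a::real_inner \<Rightarrow> 'a) \<Rightarrow> ('a \<Rightarrow> real) \<Rightarrow> 'a \<Rightarrow> real" where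
  "deriv_apply \<theta> f = (\<lambda>x. dir_deriv (\<theta> x) f x)"

definition log_derivations :: "'a::real_inner set \<Rightarrow> ('a \<Rightarrow> 'a) set" where
  "log_derivations I =
     {\<theta>. polynomial_function \<theta> \<and>
          (\<forall>a\<in>I. \<exists>h. real_polynomial_function h \<and>
             deriv_apply \<theta> (\<lambda>x. a \<bullet> x) = (\<lambda>x. h x * (a \<bullet> x)))}"

definition invariant_nondegenerate_quadratic_form ::
    "'a::real_inner set \<Rightarrow> ('a \<Rightarrow> real) \<Rightarrow> bool" where
  "invariant_nondegenerate_quadratic_form \<Phi> Q \<longleftrightarrow>
     (\<exists>B. bilinear B \<and> (\<forall>x y. B x y = B y x) \<and> (\<forall>x. Q x = B x x) \<and>
          (\<forall>x. (\<forall>y. B x y = 0) \<longrightarrow> x = 0)) \<and>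
     (\<forall>w\<in>weyl_group \<Phi>. \<forall>x. Q (w x) = Q x)"

definition ideal_of :: "('a::real_inner \<Rightarrow> real) \<Rightarrow> 'a set \<Rightarrow> ('a \<Rightarrow> real) set" where
  "ideal_of Q I = {deriv_apply \<theta> Q | \<theta>. \<theta> \<in> log_derivations I}"

definition root_product :: "'a::real_inner set \<Rightarrow> 'a \<Rightarrow> real" where
  "root_product A = (\<lambda>x. \<Prod>a\<in>A. a \<bullet> x)"

definition P_of :: "'a::real_inner set \<Rightarrow> 'a set \<Rightarrow> 'a set \<Rightarrow> 'a \<Rightarrow> real" where
  "P_of \<Phi> \<Delta> I =
     diff_op (root_product (positive_roots \<Phi> \<Delta> - I)) (root_product (positive_roots \<Phi> \<Delta>))"

end

theory Submission
  imports Defs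
begin

text \<open>Write \<open>D(I)\<close> for the module of polynomial vector fields tangent to the hyperplanes \<open>ker a\<close>, \<open>a \<in> I\<close>
  (\<open>logder I\<close> below) and \<open>radial \<theta>\<close> for the polynomial \<open>x \<mapsto> x \<bullet> \<theta>(x)\<close>, which is \<open>\<theta>(Q)\<close> for
  \<open>Q(x) = x \<bullet> x / 2\<close>.  An arbitrary invariant form \<open>Q\<close> is \<open>x \<mapsto> S x \<bullet> x\<close> for an invertible self-adjoint
  \<open>S\<close> that has all roots as eigenvectors; \<open>S\<close> preserves each \<open>D(I)\<close>, so the ideal \<open>\<aa>(I)\<close> is
  \<open>radial ` D(I)\<close> for every \<open>Q\<close> (\<open>ideal_of_radial\<close>).  Since \<open>p \<mapsto> \<partial>\<^sub>p\<close> is multiplicative, a polynomial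
  \<open>p\<close> annihilates \<open>P\<^sub>I\<close> if and only if \<open>p \<beta>\<^sub>I\<close> annihilates \<open>P\<close>.

  The ideal \<open>\<aa>(I)\<close> is contained in the annihilator because \<open>\<beta>\<^sub>I \<aa>(I) \<subseteq> \<aa>(\<Phi>\<^sup>+)\<close>, and \<open>\<aa>(\<Phi>\<^sup>+)\<close> is
  generated by Weyl group invariants of positive degree.  Such an invariant kills \<open>P\<close>: the result would be
  antisymmetric, hence divisible by \<open>P\<close>, but of smaller degree (\<open>ideal_kills_pos_prod\<close>).

  Conversely let \<open>p \<notin> \<aa>(I)\<close>.  The quotient of the polynomial ring by \<open>\<aa>(I)\<close> is Artinian, because
  \<open>\<aa>(\<Phi>\<^sup>+) \<subseteq> \<aa>(I)\<close> contains powers of all roots, and its socle is spanned by \<open>\<Prod>a\<in>I. a\<close>.  So \<open>p\<close> has a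
  multiple that is congruent modulo \<open>\<aa>(I)\<close> to \<open>c \<Prod>a\<in>I. a\<close> with a constant \<open>c \<noteq> 0\<close> (\<open>socle_multiple\<close>).  If
  \<open>p \<beta>\<^sub>I\<close> killed \<open>P\<close>, then so would \<open>c \<beta>\<^sub>I \<Prod>a\<in>I. a = c P\<close>.  But \<open>\<partial>\<^sub>P P\<close> is a positive number, since
  \<open>(f, g) \<mapsto> (\<partial>\<^sub>f g)(0)\<close> is a scalar product (\<open>pdiff_self_pos\<close>).

  The substance is the determination of the socle.  It rests on two facts about lower ideals \<open>I\<close>.

  First, \<open>D(I)\<close> is free, with a basis of as many homogeneous fields as the dimension \<open>n\<close>.  This is proved by
  adding the roots in the order of their heights.  If \<open>I\<close> and \<open>I \<union> {b}\<close> are lower ideals, then the restrictions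
  to \<open>ker b\<close> of all polynomials \<open>\<theta>(b)\<close>, \<open>\<theta> \<in> D(I)\<close>, are multiples of one polynomial of degree \<open>ht b - 1\<close>, a
  product over the planes spanned by \<open>b\<close> and another root (\<open>add_poly_dvd\<close>); its degree comes from a formula
  which adds up the heights of \<open>b\<close> in the rank two subsystems containing it (\<open>sum_flats\<close>).  A field
  \<open>\<phi> \<in> D(I)\<close> of degree \<open>ht b - 1\<close> that is not tangent to \<open>ker b\<close> can be exchanged for a member of the basis of
  \<open>D(I)\<close>, and replacing it by \<open>b \<phi>\<close> gives a basis of \<open>D(I \<union> {b})\<close> (\<open>exchange\<close>).  That \<open>\<phi>\<close> exists
  (\<open>adding_derivation_exists\<close>) is due to a property of root systems: the intersection of the hyperplanes of
  all roots of one height does not lie in the hyperplane of a root of smaller height (\<open>no_low_root_in_span\<close>).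

  Secondly, the \<open>n\<close> generators \<open>radial \<theta>\<^sub>i\<close> of \<open>\<aa>(I)\<close>, where \<open>\<theta>\<^sub>1, \<dots>, \<theta>\<^sub>n\<close> is such a basis, form a regular
  sequence.  What is used of this is the exactness of the Koszul complex in degree one, in a form that does not
  refer to a basis: each \<open>\<theta> \<in> D(I)\<close> with \<open>radial \<theta> = 0\<close> is a combination of the fields
  \<open>radial a \<cdot> b - radial b \<cdot> a\<close> with \<open>a, b \<in> D(I)\<close>.  For \<open>I = \<Phi>\<^sup>+\<close> the basis can be chosen Weyl
  group invariant, and then exactness follows from the linear independence of the gradients of the invariants
  \<open>radial \<theta>\<^sub>i\<close> (\<open>exact_invariant\<close>).  It passes from \<open>I \<union> {b}\<close> to \<open>I\<close>, where one generator \<open>b \<cdot> radial \<phi>\<close>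
  is replaced by \<open>radial \<phi>\<close>: if a product is part of a regular sequence, so are its factors (locale
  \<open>koszul_step\<close>).  The same computation shows that the socle for \<open>I \<union> {b}\<close> is \<open>b\<close> times the socle for
  \<open>I\<close>, and the induction for the socle begins with \<open>I = {}\<close>, where the quotient is the ground field.\<close>

section \<open>The ring of polynomial functions\<close>

text \<open>Polynomial functions are made into a type of their own so that divisibility and the lemmas on integral
  domains and modules apply to them.\<close>

typedef (overloaded) 'a rpoly = "{f :: 'a::real_inner \<Rightarrow> real. real_polynomial_function f}"
  morphisms ev Rpoly
  by (rule exI[of _ "\<lambda>_. 0"]) auto

setup_lifting type_definition_rpoly

lemma rpoly_eqI: "(\<And>x. ev p x = ev q x) \<Longrightarrow> p = q"
  by (simp add: ev_inject[symmetric] fun_eq_iff)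

lemma rpf_ev [simp]: "real_polynomial_function (ev p)"
  using ev by auto

lemma ev_Rpoly: "real_polynomial_function f \<Longrightarrow> ev (Rpoly f) = f"
  by (simp add: Rpoly_inverse)

instantiation rpoly :: (real_inner) comm_ring_1
begin

lift_definition zero_rpoly :: "'a rpoly" is "\<lambda>x. 0" by auto
lift_definition one_rpoly :: "'a rpoly" is "\<lambda>x. 1" by auto
lift_definition plus_rpoly :: "'a rpoly \<Rightarrow> 'a rpoly \<Rightarrow> 'a rpoly" is "\<lambda>f g x. f x + g x" by auto
lift_definition minus_rpoly :: "'a rpoly \<Rightarrow> 'a rpoly \<Rightarrow> 'a rpoly" is "\<lambda>f g x. f x - g x" by auto
lift_definition uminus_rpoly :: "'a rpoly \<Rightarrow> 'a rpoly" is "\<lambda>f x. - f x" by auto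
lift_definition times_rpoly :: "'a rpoly \<Rightarrow> 'a rpoly \<Rightarrow> 'a rpoly" is "\<lambda>f g x. f x * g x" by auto

instance
  by standard (transfer, simp add: fun_eq_iff algebra_simps)+

end

lift_definition cst :: "real \<Rightarrow> 'a::real_inner rpoly" is "\<lambda>c x. c" by auto
lift_definition lin :: "'a::real_inner \<Rightarrow> 'a rpoly" is "\<lambda>a x. a \<bullet> x"
  by (auto intro: bounded_linear_inner_right)

lemma ev_simps [simp]:
  "ev 0 x = 0" "ev 1 x = 1" "ev (p + q) x = ev p x + ev q x" "ev (p - q) x = ev p x - ev q x"
  "ev (- p) x = - ev p x" "ev (p * q) x = ev p x * ev q x" "ev (cst c) x = c" "ev (lin a) x = a \<bullet> x"
  by (transfer; simp)+

lemma ev_sum [simp]: "ev (\<Sum>i\<in>A. f i) x = (\<Sum>i\<in>A. ev (f i) x)"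
  by (induction A rule: infinite_finite_induct) auto

lemma ev_prod [simp]: "ev (\<Prod>i\<in>A. f i) x = (\<Prod>i\<in>A. ev (f i) x)"
  by (induction A rule: infinite_finite_induct) auto

lemma ev_power [simp]: "ev (p ^ n) x = ev p x ^ n"
  by (induction n) auto

lemma ev_of_nat [simp]: "ev (of_nat n) x = of_nat n"
  by (induction n) auto

lemma cst_simps: "cst 0 = 0" "cst 1 = 1" "cst (a + b) = cst a + cst b" "cst (a * b) = cst a * cst b"
    "cst (- a) = - cst a" "cst (a - b) = cst a - cst b"
  by (rule rpoly_eqI; simp)+

lemma cst_inverse: "c \<noteq> 0 \<Longrightarrow> cst c * cst (1 / c) = 1" "c \<noteq> 0 \<Longrightarrow> cst (1 / c) * cst c = 1"
  by (rule rpoly_eqI; simp)+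

lemma lin_simps: "lin 0 = 0" "lin (- a) = - lin a" "lin (a + b) = lin a + lin b" "lin (a - b) = lin a - lin b"
  "lin (c *\<^sub>R a) = cst c * lin a"
  by (rule rpoly_eqI; simp add: inner_add_left inner_diff_left)+

lemma lin_eq_0_iff [simp]: "lin a = 0 \<longleftrightarrow> a = 0"
proof
  assume "lin a = 0"
  then have "ev (lin a) a = 0" by simp
  then show "a = 0" by simp
qed (simp add: lin_simps)

text \<open>Restricting a polynomial function to a line gives a univariate polynomial, and questions such as the
  absence of zero divisors reduce to that case.\<close>

lemma rpf_line:
  assumes "real_polynomial_function f"
  shows "\<exists>p. \<forall>t. poly p t = f (x + t *\<^sub>R y)"
  using assms
proof (induction rule: real_polynomial_function.induct)
  case (linear f)
  then interpret bounded_linear f .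
  show ?case by (rule exI[of _ "[:f x, f y:]"]) (simp add: add scale)
next
  case (const c)
  show ?case by (rule exI[of _ "[:c:]"]) simp
next
  case (add f g)
  then show ?case by (metis poly_add)
next
  case (mult f g)
  then show ?case by (metis poly_mult)
qed

instance rpoly :: (real_inner) idom
proof
  fix p q :: "'a rpoly"
  assume "p \<noteq> 0" "q \<noteq> 0"
  then obtain x y where xy: "ev p x \<noteq> 0" "ev q y \<noteq> 0"
    by (metis ev_simps(1) rpoly_eqI)
  obtain P where P: "\<And>t. poly P t = ev p (x + t *\<^sub>R (y - x))"
    using rpf_line[of "ev p" x "y - x"] by auto
  obtain Q where Q: "\<And>t. poly Q t = ev q (x + t *\<^sub>R (y - x))"
    using rpf_line[of "ev q" x "y - x"] by auto
  \<comment> \<open>The line runs from a point where \<open>p\<close> is nonzero to one where \<open>q\<close> is nonzero.\<close>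
  have "poly P 0 \<noteq> 0" "poly Q 1 \<noteq> 0" using xy P[of 0] Q[of 1] by simp_all
  then have "P * Q \<noteq> 0" by auto
  then obtain t where "poly (P * Q) t \<noteq> 0" by (metis poly_all_0_iff_0)
  then have "ev (p * q) (x + t *\<^sub>R (y - x)) \<noteq> 0" using P Q by simp
  then show "p * q \<noteq> 0" by (metis ev_simps(1))
qed

subsection \<open>Substitution of a linear map\<close>

definition pull :: "('a::real_inner \<Rightarrow> 'a) \<Rightarrow> 'a rpoly \<Rightarrow> 'a rpoly" where
  "pull L p = Rpoly (\<lambda>x. ev p (L x))"

lemma rpf_compose:
  assumes "bounded_linear L" "real_polynomial_function f"
  shows "real_polynomial_function (\<lambda>x. f (L x))"
  using assms(2)
proof (induction rule: real_polynomial_function.induct)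
  case (linear f)
  then show ?case using bounded_linear_compose[OF linear assms(1)] by auto
qed auto

lemma ev_pull [simp]: "bounded_linear L \<Longrightarrow> ev (pull L p) x = ev p (L x)"
  by (simp add: pull_def ev_Rpoly rpf_compose)

lemma pull_simps:
  assumes "bounded_linear L"
  shows "pull L 0 = 0" "pull L 1 = 1" "pull L (p + q) = pull L p + pull L q"
    "pull L (p - q) = pull L p - pull L q" "pull L (- p) = - pull L p"
    "pull L (p * q) = pull L p * pull L q" "pull L (cst c) = cst c"
  using assms by (auto intro!: rpoly_eqI)

lemma pull_sum: "bounded_linear L \<Longrightarrow> pull L (\<Sum>i\<in>A. f i) = (\<Sum>i\<in>A. pull L (f i))"
  by (rule rpoly_eqI) simp

lemma pull_prod: "bounded_linear L \<Longrightarrow> pull L (\<Prod>i\<in>A. f i) = (\<Prod>i\<in>A. pull L (f i))"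
  by (rule rpoly_eqI) simp

lemma pull_power: "bounded_linear L \<Longrightarrow> pull L (p ^ n) = pull L p ^ n"
  by (rule rpoly_eqI) simp

subsection \<open>Restriction to a hyperplane\<close>

definition hproj :: "'a::real_inner \<Rightarrow> 'a \<Rightarrow> 'a" where
  "hproj a x = x - ((a \<bullet> x) / (a \<bullet> a)) *\<^sub>R a"

lemma bounded_linear_hproj: "bounded_linear (hproj a)"
proof -
  have "bounded_linear (\<lambda>x. ((a \<bullet> x) / (a \<bullet> a)) *\<^sub>R a)"
    using bounded_linear_compose[OF bounded_linear_scaleR_left[of a]
        bounded_linear_const_mult[OF bounded_linear_inner_right[of a], of "1 / (a \<bullet> a)"]]
    by (simp add: ac_simps)
  then show ?thesis
    unfolding hproj_def by (intro bounded_linear_sub bounded_linear_ident)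
qed

lemma bounded_linear_reflection: "bounded_linear (reflection a)"
proof -
  have "reflection a = (\<lambda>x. hproj a x + hproj a x - x)"
    by (auto simp: reflection_def hproj_def fun_eq_iff algebra_simps scaleR_left_distrib[symmetric] simp del: scaleR_left_distrib)
  then show ?thesis
    by (simp add: bounded_linear_sub bounded_linear_add bounded_linear_hproj bounded_linear_ident)
qed

lemma inner_hproj: "a \<bullet> hproj a x = 0" "b \<bullet> hproj a x = hproj a b \<bullet> x"
  by (cases "a = 0"; simp add: hproj_def inner_diff_right inner_diff_left inner_commute)+

lemma hproj_id: "a \<bullet> x = 0 \<Longrightarrow> hproj a x = x"
  by (simp add: hproj_def)

definition res :: "'a::real_inner \<Rightarrow> 'a rpoly \<Rightarrow> 'a rpoly" where
  "res a = pull (hproj a)"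

lemma ev_res [simp]: "ev (res a p) x = ev p (hproj a x)"
  by (simp add: res_def bounded_linear_hproj)

lemmas res_simps = pull_simps[OF bounded_linear_hproj, folded res_def]
lemmas res_sum = pull_sum[OF bounded_linear_hproj, folded res_def]
lemmas res_prod = pull_prod[OF bounded_linear_hproj, folded res_def]
lemmas res_power = pull_power[OF bounded_linear_hproj, folded res_def]

lemma res_lin: "res a (lin b) = lin (hproj a b)"
  by (rule rpoly_eqI) (simp add: inner_hproj)

lemma hproj_self [simp]: "hproj a a = 0"
  by (cases "a = 0") (simp_all add: hproj_def)

text \<open>The factor theorem: going from \<open>x\<close> to its projection changes a polynomial by a multiple of
  \<open>a \<bullet> x\<close>, as one sees by following the construction of the polynomial.\<close>

lemma lin_dvd_diff_res: "lin a dvd p - res a p"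
proof -
  have "\<exists>h. real_polynomial_function h \<and> (\<forall>x. f x - f (hproj a x) = (a \<bullet> x) * h x)"
    if "real_polynomial_function f" for f
    using that
  proof (induction rule: real_polynomial_function.induct)
    case (linear f)
    then interpret bounded_linear f .
    show ?case
      by (rule exI[of _ "\<lambda>x. f a / (a \<bullet> a)"]) (auto simp: hproj_def diff scale)
  next
    case (const c)
    show ?case by (rule exI[of _ "\<lambda>x. 0"]) auto
  next
    case (add f g)
    then obtain h k where
      "real_polynomial_function h" "\<And>x. f x - f (hproj a x) = (a \<bullet> x) * h x"
      "real_polynomial_function k" "\<And>x. g x - g (hproj a x) = (a \<bullet> x) * k x" by blast
    then show ?case
      by (intro exI[of _ "\<lambda>x. h x + k x"]) (auto simp: distrib_left simp flip: \<open>\<And>x. f x - _ x = _\<close>)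
  next
    case (mult f g)
    then obtain h k where hk:
      "real_polynomial_function h" "\<And>x. f x - f (hproj a x) = (a \<bullet> x) * h x"
      "real_polynomial_function k" "\<And>x. g x - g (hproj a x) = (a \<bullet> x) * k x" by blast
    have "f x * g x - f (hproj a x) * g (hproj a x) = (a \<bullet> x) * (h x * g x + f (hproj a x) * k x)" for x
    proof -
      have "f x * g x - f (hproj a x) * g (hproj a x)
          = (f x - f (hproj a x)) * g x + f (hproj a x) * (g x - g (hproj a x))"
        by (simp add: algebra_simps)
      then show ?thesis by (simp add: hk algebra_simps)
    qed
    moreover have "real_polynomial_function (\<lambda>x. h x * g x + f (hproj a x) * k x)"
      using hk mult.hyps rpf_compose[OF bounded_linear_hproj[of a] mult.hyps(1)] by auto
    ultimately show ?case by blast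
  qed
  from this[OF rpf_ev[of p]] obtain h where
    h: "real_polynomial_function h" "\<And>x. ev p x - ev p (hproj a x) = (a \<bullet> x) * h x" by blast
  have "p - res a p = lin a * Rpoly h"
    by (rule rpoly_eqI) (simp add: h ev_Rpoly)
  then show ?thesis by simp
qed

lemma lin_dvd_iff: "lin a dvd p \<longleftrightarrow> res a p = 0"
proof
  assume "lin a dvd p"
  then show "res a p = 0" by (auto simp: res_simps res_lin lin_simps elim!: dvdE)
next
  assume "res a p = 0"
  then show "lin a dvd p" using lin_dvd_diff_res[of a p] by simp
qed

lemma lin_dvdI: "(\<And>x. a \<bullet> x = 0 \<Longrightarrow> ev p x = 0) \<Longrightarrow> lin a dvd p"
  unfolding lin_dvd_iff by (rule rpoly_eqI) (simp add: inner_hproj)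

lemma lin_dvdD: "lin a dvd p \<Longrightarrow> a \<bullet> x = 0 \<Longrightarrow> ev p x = 0"
  by (auto elim!: dvdE)

text \<open>Linear forms are prime: restriction to a hyperplane is a ring homomorphism into an integral domain, and
  its kernel consists of the multiples of the form.\<close>

lemma lin_dvd_mult_iff: "lin a dvd p * q \<longleftrightarrow> lin a dvd p \<or> lin a dvd q"
  by (simp add: lin_dvd_iff res_simps)

lemma lin_dvd_lin: "lin a dvd lin b \<Longrightarrow> \<exists>c. b = c *\<^sub>R a"
proof -
  assume "lin a dvd lin b"
  then have "hproj a b = 0" by (simp add: lin_dvd_iff res_lin)
  then show ?thesis unfolding hproj_def by (metis eq_iff_diff_eq_0)
qed

lemma lin_dvd_prod: "finite A \<Longrightarrow> lin a dvd (\<Prod>i\<in>A. f i) \<Longrightarrow> a \<noteq> 0 \<Longrightarrow> \<exists>i\<in>A. lin a dvd f i"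
  by (induction A rule: finite_induct)
     (auto simp: lin_dvd_mult_iff lin_dvd_iff res_simps)

lemma lin_power_dvd_mult:
  assumes "lin a ^ m dvd p * q" "\<not> lin a dvd q"
  shows "lin a ^ m dvd p"
  using assms(1)
proof (induction m arbitrary: p)
  case (Suc m)
  have "lin a dvd p * q" using Suc.prems dvd_trans[of "lin a" "lin a ^ Suc m"] by simp
  then obtain p' where p': "p = lin a * p'" using assms(2) by (auto simp: lin_dvd_mult_iff elim: dvdE)
  show ?case
  proof (cases "lin a = 0")
    case False
    have "lin a ^ m dvd p' * q"
      using Suc.prems False dvd_mult_cancel_left[of "lin a" "lin a ^ m" "p' * q"]
      unfolding p' power_Suc mult.assoc by blast
    then have "lin a ^ m dvd p'" by (rule Suc.IH)
    then show ?thesis unfolding p' power_Suc by (rule mult_dvd_mono[OF dvd_refl])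
  qed (use p' in simp)
qed simp

text \<open>Non-proportional linear forms are distinct primes; so their powers are coprime and can be divided out one
  after the other.\<close>

lemma prod_lin_power_dvd:
  assumes "finite A" "\<And>i. i \<in> A \<Longrightarrow> lin (f i) ^ m i dvd p"
    and "\<And>i. i \<in> A \<Longrightarrow> f i \<noteq> 0" "\<And>i j. i \<in> A \<Longrightarrow> j \<in> A \<Longrightarrow> i \<noteq> j \<Longrightarrow> \<not> lin (f i) dvd lin (f j)"
  shows "(\<Prod>i\<in>A. lin (f i) ^ m i) dvd p"
  using assms
proof (induction A rule: finite_induct)
  case (insert i A)
  then have "(\<Prod>i\<in>A. lin (f i) ^ m i) dvd p" by auto
  then obtain k where k: "p = k * (\<Prod>i\<in>A. lin (f i) ^ m i)" by (metis dvdE mult.commute)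
  have "\<not> lin (f i) dvd (\<Prod>i\<in>A. lin (f i) ^ m i)"
  proof
    assume "lin (f i) dvd (\<Prod>i\<in>A. lin (f i) ^ m i)"
    then obtain j where j: "j \<in> A" "lin (f i) dvd lin (f j) ^ m j"
      using lin_dvd_prod[OF insert.hyps(1), of "f i"] insert.prems(2)[of i] by auto
    then have "lin (f i) dvd lin (f j)"
      using insert.prems(2)[of i] by (simp add: lin_dvd_iff res_power res_simps)
    then show False using insert.prems(3)[of i j] insert.hyps j by auto
  qed
  then have "lin (f i) ^ m i dvd k" using insert.prems(1)[of i] lin_power_dvd_mult k by auto
  then show ?case using insert.hyps k by (simp add: mult_dvd_mono)
qed simp

subsection \<open>Homogeneous components\<close>

text \<open>The coefficients of the univariate polynomial \<open>t \<mapsto> f (t y)\<close> are, as functions of \<open>y\<close>, the homogeneous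
  components of \<open>f\<close>.\<close>

definition ray :: "('a::real_inner \<Rightarrow> real) \<Rightarrow> 'a \<Rightarrow> real poly" where
  "ray f y = (THE p. \<forall>t. poly p t = f (t *\<^sub>R y))"

lemma ray_eqI: "(\<And>t. poly p t = f (t *\<^sub>R y)) \<Longrightarrow> ray f y = p"
  unfolding ray_def by (rule the_equality) (auto simp: poly_eq_poly_eq_iff[symmetric] fun_eq_iff)

lemma poly_ray: "real_polynomial_function f \<Longrightarrow> poly (ray f y) t = f (t *\<^sub>R y)"
  using rpf_line[of f 0 y] ray_eqI[of _ f y] by force

lemma ray_add: "real_polynomial_function f \<Longrightarrow> real_polynomial_function g \<Longrightarrow>
    ray (\<lambda>x. f x + g x) y = ray f y + ray g y"
  by (rule ray_eqI) (simp add: poly_ray)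

lemma ray_mult: "real_polynomial_function f \<Longrightarrow> real_polynomial_function g \<Longrightarrow>
    ray (\<lambda>x. f x * g x) y = ray f y * ray g y"
  by (rule ray_eqI) (simp add: poly_ray)

lemma ray_const: "ray (\<lambda>x. c) y = [:c:]"
  by (rule ray_eqI) simp

lemma ray_linear: "linear f \<Longrightarrow> ray f y = [:0, f y:]"
  by (rule ray_eqI) (simp add: linear_scale)

lemma rpf_coeff_ray: "real_polynomial_function f \<Longrightarrow> real_polynomial_function (\<lambda>y. coeff (ray f y) d)"
proof (induction arbitrary: d rule: real_polynomial_function.induct)
  case (linear f)
  then have "(\<lambda>y. coeff (ray f y) d) = (\<lambda>y. (if d = 1 then 1 else 0) * f y)"
    by (auto simp: ray_linear bounded_linear.linear coeff_pCons fun_eq_iff split: nat.splits)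
  then show ?case using linear by (simp only:) auto
qed (auto simp: ray_const ray_add ray_mult coeff_mult intro!: real_polynomial_function_sum)

lemma ray_degree_bounded: "real_polynomial_function f \<Longrightarrow> \<exists>N. \<forall>y. degree (ray f y) \<le> N"
proof (induction rule: real_polynomial_function.induct)
  case (linear f)
  then show ?case by (intro exI[of _ 1]) (simp add: ray_linear bounded_linear.linear)
next
  case (add f g)
  then obtain N M where "\<forall>y. degree (ray f y) \<le> N" "\<forall>y. degree (ray g y) \<le> M" by auto
  then show ?case using add.hyps
    by (intro exI[of _ "max N M"])
      (auto simp: ray_add intro!: order.trans[OF degree_add_le_max] max.mono)
next
  case (mult f g)
  then obtain N M where "\<forall>y. degree (ray f y) \<le> N" "\<forall>y. degree (ray g y) \<le> M" by auto
  then show ?case using mult.hyps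
    by (intro exI[of _ "N + M"]) (auto simp: ray_mult intro!: order.trans[OF degree_mult_le] add_mono)
qed (auto simp: ray_const)

lift_definition hcomp :: "nat \<Rightarrow> 'a::real_inner rpoly \<Rightarrow> 'a rpoly" is "\<lambda>d f y. coeff (ray f y) d"
  by (auto intro: rpf_coeff_ray)

lemma ev_hcomp: "ev (hcomp d p) y = coeff (ray (ev p) y) d"
  by transfer simp

definition homog :: "nat \<Rightarrow> 'a::real_inner rpoly \<Rightarrow> bool" where
  "homog d p \<longleftrightarrow> (\<forall>t x. ev p (t *\<^sub>R x) = t ^ d * ev p x)"

lemma homog_ray: "homog d p \<Longrightarrow> ray (ev p) y = monom (ev p y) d"
  by (rule ray_eqI) (simp add: homog_def poly_monom)

lemma homog_hcomp [simp]: "homog d (hcomp d p)"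
proof -
  have "ray (ev p) (t *\<^sub>R x) = pcompose (ray (ev p) x) [:0, t:]" for t x
    by (rule ray_eqI) (simp add: poly_pcompose poly_ray ac_simps)
  then show ?thesis by (simp add: homog_def ev_hcomp coeff_pcompose_linear)
qed

lemma hcomp_homog: "homog d p \<Longrightarrow> hcomp e p = (if e = d then p else 0)"
  by (auto intro!: rpoly_eqI simp: ev_hcomp homog_ray)

lemma hcomp_add [simp]: "hcomp d (p + q) = hcomp d p + hcomp d q"
  by (rule rpoly_eqI) (simp add: ev_hcomp ray_add plus_rpoly.rep_eq)

lemma hcomp_0 [simp]: "hcomp d 0 = 0"
  by (rule rpoly_eqI) (simp add: ev_hcomp zero_rpoly.rep_eq ray_const)

lemma hcomp_sum [simp]: "hcomp d (\<Sum>i\<in>A. f i) = (\<Sum>i\<in>A. hcomp d (f i))"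
  by (induction A rule: infinite_finite_induct) auto

lemma hcomp_uminus [simp]: "hcomp d (- p) = - hcomp d p"
  using hcomp_add[of d p "- p"] by (simp add: add_eq_0_iff)

lemma hcomp_diff [simp]: "hcomp d (p - q) = hcomp d p - hcomp d q"
  using hcomp_add[of d p "- q"] by simp

lemma hcomp_mult_homog: "homog e q \<Longrightarrow> hcomp d (q * p) = (if d < e then 0 else q * hcomp (d - e) p)"
  by (rule rpoly_eqI) (auto simp: ev_hcomp times_rpoly.rep_eq ray_mult homog_ray coeff_monom_mult)

lemma hcomp_decomp: "\<exists>N. \<forall>M\<ge>N. p = (\<Sum>d\<le>M. hcomp d p)"
proof -
  obtain N where N: "\<And>y. degree (ray (ev p) y) \<le> N" using ray_degree_bounded[of "ev p"] by auto
  have "p = (\<Sum>d\<le>M. hcomp d p)" if "M \<ge> N" for M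
  proof (rule rpoly_eqI)
    fix y
    have "ev p y = poly (ray (ev p) y) 1" by (simp add: poly_ray)
    also have "\<dots> = (\<Sum>d\<le>M. coeff (ray (ev p) y) d)"
      using N[of y] that
      by (auto simp: poly_altdef intro!: sum.mono_neutral_left le_degree)
    finally show "ev p y = ev (\<Sum>d\<le>M. hcomp d p) y" by (simp add: ev_hcomp)
  qed
  then show ?thesis by blast
qed

lemma hcomp_ext: "(\<And>d. hcomp d p = hcomp d q) \<Longrightarrow> p = q"
  by (metis (no_types, lifting) hcomp_decomp linorder_le_cases sum.cong)

lemma homog_simps [simp]: "homog d 0" "homog 0 (cst c)" "homog 0 1" "homog 1 (lin a)" "homog (Suc 0) (lin a)"
  by (auto simp: homog_def)

lemma homog_mult: "homog d p \<Longrightarrow> homog e q \<Longrightarrow> homog (d + e) (p * q)"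
  by (simp add: homog_def power_add)

lemma homog_add: "homog d p \<Longrightarrow> homog d q \<Longrightarrow> homog d (p + q)"
  by (simp add: homog_def distrib_left)

lemma homog_diff: "homog d p \<Longrightarrow> homog d q \<Longrightarrow> homog d (p - q)"
  by (simp add: homog_def right_diff_distrib)

lemma homog_cst_mult: "homog d p \<Longrightarrow> homog d (cst c * p)"
  by (simp add: homog_def)

lemma homog_sum: "(\<And>i. i \<in> A \<Longrightarrow> homog d (f i)) \<Longrightarrow> homog d (\<Sum>i\<in>A. f i)"
  by (induction A rule: infinite_finite_induct) (auto intro: homog_add)

lemma homog_prod: "(\<And>i. i \<in> A \<Longrightarrow> homog (d i) (f i)) \<Longrightarrow> homog (\<Sum>i\<in>A. d i) (\<Prod>i\<in>A. f i)"
  by (induction A rule: infinite_finite_induct) (auto intro: homog_mult)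

lemma homog_power: "homog d p \<Longrightarrow> homog (n * d) (p ^ n)"
  by (induction n) (auto intro: homog_mult)

lemma homog_0_iff: "homog 0 p \<longleftrightarrow> p = cst (ev p 0)"
proof
  assume "homog 0 p"
  then have "ev p x = ev p 0" for x unfolding homog_def by (metis scale_zero_left mult_1 power_0)
  then show "p = cst (ev p 0)" by (intro rpoly_eqI) simp
next
  assume "p = cst (ev p 0)"
  then show "homog 0 p" by (metis homog_simps(2))
qed

lemma homog_ev_0: "homog d p \<Longrightarrow> d > 0 \<Longrightarrow> ev p 0 = 0"
  unfolding homog_def by (metis mult_zero_left power_0_left scale_zero_left less_not_refl)

lemma hcomp_zero_eq: "hcomp 0 p = cst (ev p 0)"
proof -
  have "ev (hcomp 0 p) x = ev p 0" for x
    using poly_ray[of "ev p" x 0] by (simp add: ev_hcomp poly_0_coeff_0)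
  then show ?thesis by (intro rpoly_eqI) simp
qed

lemma homog_pull: "bounded_linear L \<Longrightarrow> homog d p \<Longrightarrow> homog d (pull L p)"
  by (simp add: homog_def linear_scale bounded_linear.linear)

lemma homog_res: "homog d p \<Longrightarrow> homog d (res a p)"
  by (simp add: res_def homog_pull bounded_linear_hproj)

lemma hcomp_pull: "bounded_linear L \<Longrightarrow> hcomp d (pull L p) = pull L (hcomp d p)"
proof -
  assume L: "bounded_linear L"
  have "ray (ev (pull L p)) y = ray (ev p) (L y)" for y
    by (rule ray_eqI) (simp add: L poly_ray linear_scale bounded_linear.linear)
  then show ?thesis by (intro rpoly_eqI) (simp add: L ev_hcomp)
qed

lemma hcomp_res: "hcomp d (res a p) = res a (hcomp d p)"
  by (simp add: res_def hcomp_pull bounded_linear_hproj)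

lemma lin_dvd_hcomp: "lin a dvd p \<Longrightarrow> lin a dvd hcomp d p"
  by (simp add: lin_dvd_iff hcomp_res[symmetric])

section \<open>Polynomial vector fields\<close>

typedef (overloaded) 'a vf = "{\<theta> :: 'a::real_inner \<Rightarrow> 'a. polynomial_function \<theta>}"
  morphisms vev Vf
  by (rule exI[of _ "\<lambda>_. 0"]) auto

setup_lifting type_definition_vf

lemma vf_eqI: "(\<And>x. vev p x = vev q x) \<Longrightarrow> p = q"
  by (simp add: vev_inject[symmetric] fun_eq_iff)

lemma vev_Vf: "polynomial_function f \<Longrightarrow> vev (Vf f) = f"
  by (simp add: Vf_inverse)

instantiation vf :: (real_inner) ab_group_add
begin

lift_definition zero_vf :: "'a vf" is "\<lambda>x. 0" by auto
lift_definition plus_vf :: "'a vf \<Rightarrow> 'a vf \<Rightarrow> 'a vf" is "\<lambda>f g x. f x + g x" by auto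
lift_definition minus_vf :: "'a vf \<Rightarrow> 'a vf \<Rightarrow> 'a vf" is "\<lambda>f g x. f x - g x" by auto
lift_definition uminus_vf :: "'a vf \<Rightarrow> 'a vf" is "\<lambda>f x. - f x" by auto

instance
  by standard (transfer, simp add: fun_eq_iff algebra_simps)+

end

lift_definition smul :: "'a::real_inner rpoly \<Rightarrow> 'a vf \<Rightarrow> 'a vf" (infixr "\<odot>" 75)
  is "\<lambda>f \<theta> x. f x *\<^sub>R \<theta> x"
  by (auto simp: real_polynomial_function_eq)

lift_definition coord :: "'a::real_inner \<Rightarrow> 'a vf \<Rightarrow> 'a rpoly" is "\<lambda>v \<theta> x. v \<bullet> \<theta> x"
  by (auto simp: polynomial_function_def o_def bounded_linear_inner_right)

lift_definition const_vf :: "'a::real_inner \<Rightarrow> 'a vf" is "\<lambda>v x. v" by auto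

lemma vev_simps [simp]:
  "vev 0 x = 0" "vev (a + b) x = vev a x + vev b x" "vev (a - b) x = vev a x - vev b x"
  "vev (- a) x = - vev a x" "vev (p \<odot> a) x = ev p x *\<^sub>R vev a x" "vev (const_vf v) x = v"
  by (transfer; simp)+

lemma vev_sum [simp]: "vev (\<Sum>i\<in>A. f i) x = (\<Sum>i\<in>A. vev (f i) x)"
  by (induction A rule: infinite_finite_induct) auto

lemma ev_coord [simp]: "ev (coord v a) x = v \<bullet> vev a x"
  by transfer simp

interpretation vf: module "smul :: 'a::real_inner rpoly \<Rightarrow> 'a vf \<Rightarrow> 'a vf"
  by standard (auto intro!: vf_eqI simp: algebra_simps)

lemma coord_simps [simp]:
  "coord v 0 = 0" "coord v (a + b) = coord v a + coord v b" "coord v (a - b) = coord v a - coord v b"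
  "coord v (- a) = - coord v a" "coord v (p \<odot> a) = p * coord v a" "coord v (const_vf w) = cst (v \<bullet> w)"
  by (auto intro!: rpoly_eqI simp: inner_add_right inner_diff_right)

lemma coord_sum [simp]: "coord v (\<Sum>i\<in>A. f i) = (\<Sum>i\<in>A. coord v (f i))"
  by (induction A rule: infinite_finite_induct) auto

lemma coord_left_simps: "coord 0 a = 0" "coord (- v) a = - coord v a" "coord (c *\<^sub>R v) a = cst c * coord v a"
  by (auto intro!: rpoly_eqI)

text \<open>The degree of a vector field is that of its coefficients, so that constant fields have degree 0.\<close>

definition homogv :: "nat \<Rightarrow> 'a::real_inner vf \<Rightarrow> bool" where
  "homogv d a \<longleftrightarrow> (\<forall>v. homog d (coord v a))"

lemma homogv_simps [simp]: "homogv d 0" "homogv 0 (const_vf v)"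
  by (auto simp: homogv_def)

lemma homogv_diff: "homogv d a \<Longrightarrow> homogv d b \<Longrightarrow> homogv d (a - b)"
  by (simp add: homogv_def homog_diff)

lemma homogv_smul: "homog d p \<Longrightarrow> homogv e a \<Longrightarrow> homogv (d + e) (p \<odot> a)"
  by (simp add: homogv_def homog_mult)

lemma homogv_sum: "(\<And>i. i \<in> A \<Longrightarrow> homogv d (f i)) \<Longrightarrow> homogv d (\<Sum>i\<in>A. f i)"
  by (simp add: homogv_def homog_sum)

lemma homogv_coord: "homogv d a \<Longrightarrow> homog d (coord v a)"
  by (simp add: homogv_def)

text \<open>The module \<open>D(I)\<close> of the arrangement \<open>{ker a | a \<in> I}\<close>: as \<open>\<theta>(a)\<close> is the polynomial
  \<open>x \<mapsto> a \<bullet> \<theta>(x)\<close>, the fields are those that are tangent to the hyperplanes.\<close>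

definition logder :: "'a::real_inner set \<Rightarrow> 'a vf set" where
  "logder I = {\<theta>. \<forall>a\<in>I. lin a dvd coord a \<theta>}"

lemma logder_dvd: "\<theta> \<in> logder I \<Longrightarrow> a \<in> I \<Longrightarrow> lin a dvd coord a \<theta>"
  by (simp add: logder_def)

lemma subspace_logder: "vf.subspace (logder I)"
  by (auto simp: vf.subspace_def logder_def)

lemma logder_mono: "I \<subseteq> J \<Longrightarrow> logder J \<subseteq> logder I"
  by (auto simp: logder_def)

subsection \<open>Directional derivatives\<close>

lift_definition dderiv :: "'a::real_inner \<Rightarrow> 'a rpoly \<Rightarrow> 'a rpoly" is dir_deriv
  by (rule dir_deriv_poly)

lemma dderiv_simps:
  "dderiv v 0 = 0" "dderiv v (p + q) = dderiv v p + dderiv v q" "dderiv v (p * q) = p * dderiv v q + dderiv v p * q"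
  "dderiv v (cst c) = 0" "dderiv v (lin a) = cst (a \<bullet> v)"
  by (transfer; simp add: dir_deriv_const dir_deriv_add dir_deriv_mult dir_deriv_inner)+

lemma dderiv_sum: "dderiv v (\<Sum>i\<in>A. f i) = (\<Sum>i\<in>A. dderiv v (f i))"
  by (induction A rule: infinite_finite_induct) (auto simp: dderiv_simps)

lemma ev_dderiv: "ev (dderiv v p) x = frechet_derivative (ev p) (at x) v"
  by (simp add: dderiv.rep_eq dir_deriv_def)

lemma linear_ev_dderiv: "linear (\<lambda>v. ev (dderiv v p) x)"
  unfolding ev_dderiv using poly_has_derivative[OF rpf_ev[of p], of x]
  by (simp add: has_derivative_linear)

lemma ev_has_derivative: "(ev p has_derivative (\<lambda>v. ev (dderiv v p) x)) (at x)"
  unfolding ev_dderiv using poly_has_derivative[OF rpf_ev[of p], of x] by simp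

lemma ev_dderiv_euler:
  assumes "homog d p"
  shows "ev (dderiv x p) x = of_nat d * ev p x"
proof -
  have "((\<lambda>t. ev p (t *\<^sub>R x)) has_derivative (\<lambda>t. ev (dderiv (t *\<^sub>R x) p) (1 *\<^sub>R x))) (at 1)"
    by (rule has_derivative_compose[OF _ ev_has_derivative]) (auto intro!: derivative_eq_intros)
  moreover have "((\<lambda>t. t ^ d * ev p x) has_derivative (\<lambda>t. of_nat d * t * ev p x)) (at 1)"
    by (auto intro!: derivative_eq_intros)
  ultimately have "(\<lambda>t. ev (dderiv (t *\<^sub>R x) p) (1 *\<^sub>R x)) = (\<lambda>t. of_nat d * t * ev p x)"
    using assms unfolding homog_def by (auto intro: has_derivative_unique)
  from fun_cong[OF this, of 1] show ?thesis by simp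
qed

lemma dderiv_pull:
  assumes "bounded_linear L"
  shows "dderiv v (pull L p) = pull L (dderiv (L v) p)"
proof (rule rpoly_eqI)
  fix x
  have "((\<lambda>y. ev p (L y)) has_derivative (\<lambda>v. ev (dderiv (L v) p) (L x))) (at x)"
    by (rule has_derivative_compose[OF bounded_linear_imp_has_derivative[OF assms] ev_has_derivative])
  moreover have "(\<lambda>y. ev p (L y)) = ev (pull L p)" using assms by auto
  ultimately show "ev (dderiv v (pull L p)) x = ev (pull L (dderiv (L v) p)) x"
    using has_derivative_unique[OF ev_has_derivative[of "pull L p" x]] assms by (metis ev_pull)
qed

lemma homog_dderiv:
  assumes "homog d p"
  shows "homog (d - 1) (dderiv v p)"
proof (cases d)
  case 0
  then have "p = cst (ev p 0)" using assms homog_0_iff by auto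
  then have "dderiv v p = 0" by (metis dderiv_simps(4))
  then show ?thesis by simp
next
  case (Suc n)
  have scale: "bounded_linear (\<lambda>x::'a. t *\<^sub>R x)" for t by (rule bounded_linear_scaleR_right)
  have "t * ev (dderiv v p) (t *\<^sub>R x) = t ^ d * ev (dderiv v p) x" for t x
  proof -
    have "pull (\<lambda>x. t *\<^sub>R x) p = cst (t ^ d) * p"
      using assms by (intro rpoly_eqI) (simp add: scale homog_def)
    then have "dderiv v (cst (t ^ d) * p) = pull (\<lambda>x. t *\<^sub>R x) (dderiv (t *\<^sub>R v) p)"
      using dderiv_pull[OF scale[of t], of v p] by simp
    then have "t ^ d * ev (dderiv v p) x = ev (dderiv (t *\<^sub>R v) p) (t *\<^sub>R x)"
      by (metis (no_types, lifting) dderiv_simps(3,4) ev_pull ev_simps(6,7) mult_zero_left scale add_0_right)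
    also have "\<dots> = t * ev (dderiv v p) (t *\<^sub>R x)"
      using linear_scale[OF linear_ev_dderiv] by simp
    finally show ?thesis by simp
  qed
  \<comment> \<open>Comparing polynomials in \<open>t\<close> allows the cancellation of the factor \<open>t\<close> also at \<open>t = 0\<close>.\<close>
  then have "poly (pCons 0 (ray (ev (dderiv v p)) x)) t = poly (pCons 0 (monom (ev (dderiv v p) x) n)) t" for t x
    using Suc by (simp add: poly_ray poly_monom algebra_simps)
  then have "pCons 0 (ray (ev (dderiv v p)) x) = pCons 0 (monom (ev (dderiv v p) x) n)" for x
    by (metis poly_eq_poly_eq_iff ext)
  then have *: "ray (ev (dderiv v p)) x = monom (ev (dderiv v p) x) n" for x by simp
  have "ev (dderiv v p) (t *\<^sub>R x) = t ^ n * ev (dderiv v p) x" for t x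
    using poly_ray[OF rpf_ev, of "dderiv v p" x t] unfolding * by (simp add: poly_monom mult.commute)
  then show ?thesis using Suc by (simp add: homog_def)
qed

subsection \<open>Orthonormal frames\<close>

text \<open>The type class of \<open>'a\<close> does not bound the dimension; a finite orthonormal basis \<open>E\<close> does, and it also serves
  as the index set of all families that have as many members as the dimension.\<close>

locale frame =
  fixes E :: "'a::real_inner set"
  assumes fin_E: "finite E" and span_E: "span E = UNIV"
    and orth_E: "\<And>e f. e \<in> E \<Longrightarrow> f \<in> E \<Longrightarrow> e \<bullet> f = (if e = f then 1 else 0)"

lemma orthonormal_spanning_set:
  fixes S :: "'a::real_inner set"
  assumes "finite S"
  shows "\<exists>E. finite E \<and> span E = span S \<and> (\<forall>e\<in>E. \<forall>f\<in>E. e \<bullet> f = (if e = f then 1 else 0))"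
  using assms
proof (induction rule: finite_induct)
  case (insert s S)
  then obtain E where E: "finite E" "span E = span S"
    "\<And>e f. e \<in> E \<Longrightarrow> f \<in> E \<Longrightarrow> e \<bullet> f = (if e = f then 1 else 0)" by blast
  define q where "q = s - (\<Sum>e\<in>E. (e \<bullet> s) *\<^sub>R e)"
  have pE: "(\<Sum>e\<in>E. (e \<bullet> s) *\<^sub>R e) \<in> span E" by (intro span_sum span_scale span_base)
  have qe: "f \<bullet> q = 0" if "f \<in> E" for f
  proof -
    have "f \<bullet> (\<Sum>e\<in>E. (e \<bullet> s) *\<^sub>R e) = (\<Sum>e\<in>E. (e \<bullet> s) * (if f = e then 1 else 0))"
      using that by (auto simp: inner_sum_right E(3) intro!: sum.cong)
    also have "\<dots> = f \<bullet> s" using that E(1) by (simp add: mult_delta_right)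
    finally show ?thesis by (simp add: q_def inner_diff_right)
  qed
  have span_sq: "span (insert s S) = span (insert q E)"
  proof -
    have "span (insert s S) = span (insert s E)"
      unfolding span_insert E(2) ..
    also have "\<dots> = span (insert q E)"
    proof (rule span_eq[THEN iffD2], intro conjI subsetI)
      fix x assume x: "x \<in> insert s E"
      have "s = q + (\<Sum>e\<in>E. (e \<bullet> s) *\<^sub>R e)" by (simp add: q_def)
      moreover have "q \<in> span (insert q E)" "(\<Sum>e\<in>E. (e \<bullet> s) *\<^sub>R e) \<in> span (insert q E)"
        using pE span_mono[of E "insert q E"] by (auto intro: span_base)
      ultimately have "s \<in> span (insert q E)" by (metis span_add)
      then show "x \<in> span (insert q E)" using x by (auto intro: span_base)
    next
      fix x assume "x \<in> insert q E"
      then show "x \<in> span (insert s E)"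
        using pE span_mono[of E "insert s E"] by (auto simp: q_def intro: span_base span_diff)
    qed
    finally show ?thesis .
  qed
  show ?case
  proof (cases "q = 0")
    case True
    then have "span (insert s S) = span E"
      using span_sq by (simp add: span_insert_0)
    then show ?thesis using E by blast
  next
    case False
    define u where "u = (1 / norm q) *\<^sub>R q"
    have "span (insert u E) = span (insert q E)"
    proof (rule span_eq[THEN iffD2], intro conjI subsetI)
      fix x assume "x \<in> insert u E"
      then show "x \<in> span (insert q E)" by (auto simp: u_def intro: span_base span_scale)
    next
      fix x assume "x \<in> insert q E"
      moreover have "q = norm q *\<^sub>R u" using False by (simp add: u_def)
      ultimately show "x \<in> span (insert u E)" by (metis insert_iff span_base span_scale)
    qed
    moreover have "u \<bullet> u = 1" using False by (simp add: u_def power2_norm_eq_inner[symmetric] power2_eq_square)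
    moreover have "f \<bullet> u = 0" "u \<bullet> f = 0" if "f \<in> E" for f using qe[OF that] by (simp_all add: u_def inner_commute)
    moreover have "u \<notin> E" using \<open>u \<bullet> u = 1\<close> \<open>\<And>f. f \<in> E \<Longrightarrow> u \<bullet> f = 0\<close> by force
    ultimately show ?thesis using E span_sq
      by (intro exI[of _ "insert u E"]) auto
  qed
qed (intro exI[of _ "{}"], simp)

context frame
begin

lemma expand: "x = (\<Sum>e\<in>E. (e \<bullet> x) *\<^sub>R e)"
proof -
  have "x \<in> span E" by (simp add: span_E)
  then obtain u where u: "x = (\<Sum>e\<in>E. u e *\<^sub>R e)" using fin_E by (auto simp: span_finite)
  have "e \<bullet> x = u e" if "e \<in> E" for e
  proof -
    have "e \<bullet> x = (\<Sum>f\<in>E. u f * (if e = f then 1 else 0))"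
      using that by (auto simp: u inner_sum_right orth_E intro!: sum.cong)
    also have "\<dots> = u e" using that fin_E by (simp add: mult_delta_right)
    finally show ?thesis .
  qed
  then show ?thesis using u by simp
qed

lemma parseval: "x \<bullet> y = (\<Sum>e\<in>E. (e \<bullet> x) * (e \<bullet> y))"
proof -
  have "x \<bullet> y = (\<Sum>e\<in>E. (e \<bullet> x) *\<^sub>R e) \<bullet> y" using expand[of x] by simp
  also have "\<dots> = (\<Sum>e\<in>E. (e \<bullet> x) * (e \<bullet> y))" by (simp only: inner_sum_left inner_scaleR_left)
  finally show ?thesis .
qed

lemma indep_E: "independent E"
proof (rule independent_if_scalars_zero[OF fin_E])
  fix f x assume *: "(\<Sum>x\<in>E. f x *\<^sub>R x) = 0" "x \<in> E"
  have "0 = x \<bullet> (\<Sum>y\<in>E. f y *\<^sub>R y)" using * by simp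
  also have "\<dots> = (\<Sum>y\<in>E. f y * (if x = y then 1 else 0))"
    using \<open>x \<in> E\<close> by (auto simp: inner_sum_right orth_E intro!: sum.cong)
  also have "\<dots> = f x" using \<open>x \<in> E\<close> fin_E by (simp add: mult_delta_right)
  finally show "f x = 0" by simp
qed

lemma linear_bounded: 
  fixes f :: "'a \<Rightarrow> 'b::real_normed_vector"
  assumes "linear f"
  shows "bounded_linear f"
proof -
  have "f x = (\<Sum>e\<in>E. (e \<bullet> x) *\<^sub>R f e)" for x
  proof -
    have "f x = f (\<Sum>e\<in>E. (e \<bullet> x) *\<^sub>R e)" using expand[of x] by simp
    also have "\<dots> = (\<Sum>e\<in>E. (e \<bullet> x) *\<^sub>R f e)"
      by (simp add: linear_sum[OF assms] linear_scale[OF assms])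
    finally show ?thesis .
  qed
  then have "f = (\<lambda>x. \<Sum>e\<in>E. (e \<bullet> x) *\<^sub>R f e)" by (rule ext)
  moreover have "bounded_linear (\<lambda>x. \<Sum>e\<in>E. (e \<bullet> x) *\<^sub>R f e)"
    by (intro bounded_linear_sum)
      (rule bounded_linear_compose[OF bounded_linear_scaleR_left bounded_linear_inner_right])
  ultimately show ?thesis by metis
qed

lemma coord_expand: "coord v a = (\<Sum>e\<in>E. cst (e \<bullet> v) * coord e a)"
  by (rule rpoly_eqI) (simp add: parseval[of v])

lemma vf_coord_eqI: "(\<And>e. e \<in> E \<Longrightarrow> coord e a = coord e b) \<Longrightarrow> a = b"
proof (rule vf_eqI)
  fix x assume *: "\<And>e. e \<in> E \<Longrightarrow> coord e a = coord e b"
  have eq: "e \<bullet> vev a x = e \<bullet> vev b x" if "e \<in> E" for e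
    using arg_cong[OF *[OF that], of "\<lambda>p. ev p x"] by simp
  have "vev a x = (\<Sum>e\<in>E. (e \<bullet> vev a x) *\<^sub>R e)" by (rule expand)
  also have "\<dots> = (\<Sum>e\<in>E. (e \<bullet> vev b x) *\<^sub>R e)" by (simp add: eq)
  also have "\<dots> = vev b x" by (rule expand[symmetric])
  finally show "vev a x = vev b x" .
qed

lemma vf_expand: "a = (\<Sum>e\<in>E. coord e a \<odot> const_vf e)"
  by (rule vf_eqI) (simp add: expand[symmetric])

lemma smul_dividesI: "(\<And>e. e \<in> E \<Longrightarrow> p dvd coord e a) \<Longrightarrow> \<exists>b. a = p \<odot> b"
proof -
  assume "\<And>e. e \<in> E \<Longrightarrow> p dvd coord e a"
  then have "\<forall>e\<in>E. \<exists>k. coord e a = p * k" by (auto simp: dvd_def)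
  then obtain h where h: "\<forall>e\<in>E. coord e a = p * h e" by (rule bchoice[THEN exE])
  have "a = (\<Sum>e\<in>E. coord e a \<odot> const_vf e)" by (rule vf_expand)
  also have "\<dots> = p \<odot> (\<Sum>e\<in>E. h e \<odot> const_vf e)"
    by (simp add: h vf.scale_sum_right)
  finally have "a = p \<odot> (\<Sum>e\<in>E. h e \<odot> const_vf e)" .
  then show ?thesis by blast
qed

text \<open>The value \<open>\<theta>(Q)\<close> for \<open>Q x = x \<bullet> x / 2\<close>.\<close>

definition radial :: "'a vf \<Rightarrow> 'a rpoly" where
  "radial a = (\<Sum>e\<in>E. lin e * coord e a)"

lemma ev_radial [simp]: "ev (radial a) x = x \<bullet> vev a x"
  by (simp add: radial_def parseval[of x])

lemma radial_simps [simp]: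
  "radial 0 = 0" "radial (a + b) = radial a + radial b" "radial (a - b) = radial a - radial b" "radial (- a) = - radial a"
  "radial (p \<odot> a) = p * radial a" "radial (const_vf v) = lin v"
  by (auto intro!: rpoly_eqI simp: inner_add_right inner_diff_right inner_commute)

lemma radial_sum [simp]: "radial (\<Sum>i\<in>A. f i) = (\<Sum>i\<in>A. radial (f i))"
  by (induction A rule: infinite_finite_induct) auto

lemma homog_radial: "homogv d a \<Longrightarrow> homog (Suc d) (radial a)"
  unfolding radial_def
  by (intro homog_sum, subst Suc_eq_plus1_left, rule homog_mult) (simp_all add: homogv_coord)

definition grad :: "'a rpoly \<Rightarrow> 'a vf" where
  "grad p = (\<Sum>e\<in>E. dderiv e p \<odot> const_vf e)"

lemma coord_grad: "coord v (grad p) = dderiv v p"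
proof (rule rpoly_eqI)
  fix x
  have "ev (dderiv v p) x = ev (dderiv (\<Sum>e\<in>E. (e \<bullet> v) *\<^sub>R e) p) x" using expand[of v] by simp
  also have "\<dots> = (\<Sum>e\<in>E. (e \<bullet> v) * ev (dderiv e p) x)"
    by (simp add: linear_sum[OF linear_ev_dderiv] linear_scale[OF linear_ev_dderiv])
  finally show "ev (coord v (grad p)) x = ev (dderiv v p) x"
    by (simp add: grad_def inner_sum_right inner_commute mult.commute)
qed

lemma grad_simps:
  "grad 0 = 0" "grad (p + q) = grad p + grad q" "grad (p * q) = p \<odot> grad q + q \<odot> grad p"
  "grad (cst c) = 0"
  by (rule vf_coord_eqI; simp add: coord_grad dderiv_simps mult.commute)+

lemma grad_sum: "grad (\<Sum>i\<in>A. f i) = (\<Sum>i\<in>A. grad (f i))"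
  by (induction A rule: infinite_finite_induct) (auto simp: grad_simps)

lemma homogv_grad: "homog d p \<Longrightarrow> homogv (d - 1) (grad p)"
  unfolding homogv_def coord_grad using homog_dderiv by blast

lemma euler: "homog d p \<Longrightarrow> radial (grad p) = of_nat d * p"
proof (rule rpoly_eqI)
  fix x assume *: "homog d p"
  have "ev (radial (grad p)) x = ev (coord x (grad p)) x" by simp
  then show "ev (radial (grad p)) x = ev (of_nat d * p) x"
    by (simp only: coord_grad ev_dderiv_euler[OF *] ev_simps ev_of_nat)
qed

definition vcomp :: "nat \<Rightarrow> 'a vf \<Rightarrow> 'a vf" where
  "vcomp d a = (\<Sum>e\<in>E. hcomp d (coord e a) \<odot> const_vf e)"

lemma coord_vcomp [simp]: "coord v (vcomp d a) = hcomp d (coord v a)"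
proof -
  have "hcomp d (coord v a) = (\<Sum>e\<in>E. cst (e \<bullet> v) * hcomp d (coord e a))"
    by (subst coord_expand) (simp add: hcomp_mult_homog[where e = 0])
  then show ?thesis by (simp add: vcomp_def inner_commute mult.commute)
qed

lemma homogv_vcomp [simp]: "homogv d (vcomp d a)"
  by (simp add: homogv_def)

lemma vcomp_homogv: "homogv d a \<Longrightarrow> vcomp e a = (if e = d then a else 0)"
  by (rule vf_coord_eqI) (simp add: hcomp_homog[where d = d] homogv_coord)

lemma vcomp_add [simp]: "vcomp d (a + b) = vcomp d a + vcomp d b"
  by (rule vf_coord_eqI) simp

lemma vcomp_0 [simp]: "vcomp d 0 = 0"
  by (rule vf_coord_eqI) simp

lemma vcomp_sum [simp]: "vcomp d (\<Sum>i\<in>A. f i) = (\<Sum>i\<in>A. vcomp d (f i))"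
  by (induction A rule: infinite_finite_induct) auto

lemma vcomp_smul_homog: "homog e p \<Longrightarrow> vcomp d (p \<odot> a) = (if d < e then 0 else p \<odot> vcomp (d - e) a)"
  by (rule vf_coord_eqI) (simp add: hcomp_mult_homog)

lemma vcomp_smul_homogv: "homogv e a \<Longrightarrow> vcomp d (p \<odot> a) = (if d < e then 0 else hcomp (d - e) p \<odot> a)"
  by (rule vf_coord_eqI) (simp add: hcomp_mult_homog[of e "coord _ a"] homogv_coord mult.commute[of p] mult.commute[of "hcomp _ p"])

lemma vcomp_decomp: "\<exists>N. a = (\<Sum>d\<le>N. vcomp d a)"
proof -
  have "\<forall>e. \<exists>N. \<forall>M\<ge>N. coord e a = (\<Sum>d\<le>M. hcomp d (coord e a))" using hcomp_decomp by blast
  then obtain N where N: "\<And>e M. M \<ge> N e \<Longrightarrow> coord e a = (\<Sum>d\<le>M. hcomp d (coord e a))" by metis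
  define M where "M = (\<Sum>e\<in>E. N e)"
  have "N e \<le> M" if "e \<in> E" for e unfolding M_def using that fin_E by (simp add: member_le_sum)
  then have "a = (\<Sum>d\<le>M. vcomp d a)"
    by (intro vf_coord_eqI) (use N in auto)
  then show ?thesis by blast
qed

lemma radial_vcomp: "radial (vcomp d a) = hcomp (Suc d) (radial a)"
proof -
  have "hcomp (Suc d) (lin e * coord e a) = lin e * hcomp d (coord e a)" for e
    using hcomp_mult_homog[of 1 "lin e" "Suc d"] by simp
  then show ?thesis by (simp add: radial_def)
qed

lemma vcomp_logder: "a \<in> logder I \<Longrightarrow> vcomp d a \<in> logder I"
  by (simp add: logder_def lin_dvd_hcomp)

lemma vcomp_span:
  assumes "\<forall>g\<in>G. \<exists>d. homogv d g" "a \<in> vf.span G"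
  shows "vcomp d a \<in> vf.span G"
  using assms(2)
proof (induction rule: vf.span_induct_alt)
  case (step c x y)
  then obtain e where "homogv e x" using assms(1) by blast
  then show ?case using step by (auto simp: vcomp_smul_homogv intro: vf.span_add vf.span_scale vf.span_base)
qed (simp add: vf.span_zero)

text \<open>By Euler's formula a homogeneous polynomial of positive degree is, up to a factor, the radial part of its
  gradient.  So the ideal of the empty arrangement is the maximal ideal of the origin.\<close>

lemma homog_pos_in_radial:
  assumes "ev p 0 = 0"
  shows "\<exists>a. p = radial a"
proof -
  obtain N where N: "p = (\<Sum>d\<le>N. hcomp d p)" using hcomp_decomp by blast
  have "\<exists>a. hcomp d p = radial a" for d
  proof (cases "d = 0")
    case True
    then have "hcomp d p = radial 0" using assms by (simp add: hcomp_zero_eq cst_simps)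
    then show ?thesis by blast
  next
    case False
    have "radial (cst (1 / d) \<odot> grad (hcomp d p)) = hcomp d p"
      using False by (intro rpoly_eqI) (simp add: euler[OF homog_hcomp])
    then show ?thesis by metis
  qed
  then obtain a where "\<And>d. hcomp d p = radial (a d)" by metis
  then have "p = radial (\<Sum>d\<le>N. a d)" using N by simp
  then show ?thesis by blast
qed

section \<open>Koszul exactness\<close>

text \<open>If \<open>N\<close> has a basis \<open>v\<close>, then \<open>radial\<close> is, in the coordinates for this basis, the map
  \<open>r \<mapsto> \<Sum>e. r e * radial (v e)\<close>, and the fields \<open>koszul a b\<close> are its trivial syzygies.  Exactness is the
  vanishing of the first Koszul homology of the sequence of the \<open>radial (v e)\<close>.\<close>

definition koszul :: "'a vf \<Rightarrow> 'a vf \<Rightarrow> 'a vf" where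
  "koszul a b = radial a \<odot> b - radial b \<odot> a"

definition koszul_span :: "'a vf set \<Rightarrow> 'a vf set" where
  "koszul_span N = vf.span {koszul a b | a b. a \<in> N \<and> b \<in> N}"

definition koszul_exact :: "'a vf set \<Rightarrow> bool" where
  "koszul_exact N \<longleftrightarrow> (\<forall>a\<in>N. radial a = 0 \<longrightarrow> a \<in> koszul_span N)"

lemma koszul_simps:
  "koszul (a + b) c = koszul a c + koszul b c" "koszul (p \<odot> a) c = p \<odot> koszul a c"
  "koszul c (a + b) = koszul c a + koszul c b" "koszul c (p \<odot> a) = p \<odot> koszul c a" "koszul 0 c = 0" "koszul c 0 = 0"
  by (auto simp: koszul_def algebra_simps)

lemma koszul_in_koszul_span: "a \<in> N \<Longrightarrow> b \<in> N \<Longrightarrow> koszul a b \<in> koszul_span N"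
  unfolding koszul_span_def by (rule vf.span_base) blast

lemma subspace_koszul_span: "vf.subspace (koszul_span N)"
  by (simp add: koszul_span_def)

lemma koszul_span_mono: "M \<subseteq> N \<Longrightarrow> koszul_span M \<subseteq> koszul_span N"
  unfolding koszul_span_def by (rule vf.span_mono) blast

lemma koszul_in_span:
  assumes "a \<in> vf.span A" "b \<in> vf.span B"
  shows "koszul a b \<in> vf.span {koszul a b | a b. a \<in> A \<and> b \<in> B}" (is "_ \<in> vf.span ?G")
  using assms(1)
proof (induction rule: vf.span_induct_alt)
  case (step c x y)
  have "koszul x b \<in> vf.span ?G"
    using assms(2)
  proof (induction rule: vf.span_induct_alt)
    case (step d u v)
    have "koszul x u \<in> ?G" using step \<open>x \<in> A\<close> by blast
    then show ?case using step by (simp add: koszul_simps vf.span_add vf.span_scale vf.span_base)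
  qed (simp add: koszul_simps vf.span_zero)
  then show ?case using step by (simp add: koszul_simps vf.span_add vf.span_scale)
qed (simp add: koszul_simps vf.span_zero)

lemma koszul_span_span: "koszul_span (vf.span B) = vf.span {koszul a b | a b. a \<in> B \<and> b \<in> B}"
proof (rule antisym)
  show "koszul_span (vf.span B) \<subseteq> vf.span {koszul a b | a b. a \<in> B \<and> b \<in> B}"
    unfolding koszul_span_def by (rule vf.span_minimal) (auto intro: koszul_in_span)
  show "vf.span {koszul a b | a b. a \<in> B \<and> b \<in> B} \<subseteq> koszul_span (vf.span B)"
    unfolding koszul_span_def by (rule vf.span_mono) (auto intro: vf.span_base)
qed

lemma homogv_koszul:
  assumes "homogv d a" "homogv e b"
  shows "homogv (Suc (d + e)) (koszul a b)"
  unfolding koszul_def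
  using homogv_smul[OF homog_radial[OF assms(1)] assms(2)] homogv_smul[OF homog_radial[OF assms(2)] assms(1)]
  by (intro homogv_diff) (simp_all add: add.commute)

lemma vcomp_koszul_span:
  assumes "\<forall>g\<in>B. \<exists>d. homogv d g" "a \<in> koszul_span (vf.span B)"
  shows "vcomp d a \<in> koszul_span (vf.span B)"
  using assms(2) unfolding koszul_span_span
  by (rule vcomp_span[rotated]) (use assms(1) homogv_koszul in blast)

end

text \<open>One root \<open>b\<close> is removed from an arrangement: the module changes from \<open>span B + R (b \<phi>)\<close> to
  \<open>span B + R \<phi>\<close>, where \<open>R\<close> is the polynomial ring, so the generator \<open>b * radial \<phi>\<close> of the ideal is replaced
  by its factor \<open>radial \<phi>\<close>.\<close>

locale koszul_step = frame E for E :: "'a::real_inner set" +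
  fixes B :: "'a vf set" and b :: 'a and \<phi> :: "'a vf" and k :: nat
  assumes hom_B: "\<forall>g\<in>B. \<exists>d. homogv d g" and hom_\<phi>: "homogv k \<phi>" and b0: "b \<noteq> 0"
    and direct: "\<And>r. r \<odot> \<phi> \<in> vf.span B \<Longrightarrow> r = 0"
    and exact: "koszul_exact (vf.span (insert (lin b \<odot> \<phi>) B))"
begin

text \<open>For \<open>u = u' + r b \<phi>\<close> and \<open>v = v' + s b \<phi>\<close> with \<open>u', v'\<close> in the span of \<open>B\<close>, the field \<open>koszul u v\<close>
  is \<open>koszul u' v' + koszul (b \<phi>) (r v' - s u')\<close>; this sorts the Koszul relations by their \<open>\<phi>\<close>-part.\<close>

lemma koszul_span_rep:
  assumes "a \<in> koszul_span (vf.span (insert (lin b \<odot> \<phi>) B))"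
  shows "\<exists>\<tau>\<in>koszul_span (vf.span B). \<exists>\<psi>\<in>vf.span B.
           a = \<tau> + (lin b * radial \<phi>) \<odot> \<psi> - (lin b * radial \<psi>) \<odot> \<phi>" (is "?R a")
  using assms unfolding koszul_span_def[of "vf.span (insert _ _)"]
proof (induction rule: vf.span_induct_alt)
  case base
  show ?case
    by (rule bexI[of _ 0], rule bexI[of _ 0]) (auto simp: vf.span_zero vf.subspace_0[OF subspace_koszul_span])
next
  case (step c x y)
  then obtain u v where x: "x = koszul u v" and uv: "u \<in> vf.span (insert (lin b \<odot> \<phi>) B)"
    "v \<in> vf.span (insert (lin b \<odot> \<phi>) B)" by blast
  obtain r where r: "u - r \<odot> (lin b \<odot> \<phi>) \<in> vf.span B" using uv(1) by (auto simp: vf.span_insert)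
  obtain s where s: "v - s \<odot> (lin b \<odot> \<phi>) \<in> vf.span B" using uv(2) by (auto simp: vf.span_insert)
  define u' where "u' = u - r \<odot> (lin b \<odot> \<phi>)"
  define v' where "v' = v - s \<odot> (lin b \<odot> \<phi>)"
  have u: "u = u' + r \<odot> (lin b \<odot> \<phi>)" and v: "v = v' + s \<odot> (lin b \<odot> \<phi>)"
    by (simp_all add: u'_def v'_def)
  obtain \<tau> \<psi> where y: "\<tau> \<in> koszul_span (vf.span B)" "\<psi> \<in> vf.span B"
    "y = \<tau> + (lin b * radial \<phi>) \<odot> \<psi> - (lin b * radial \<psi>) \<odot> \<phi>" using step by blast
  have x_eq: "x = koszul u' v' + (lin b * radial \<phi>) \<odot> (r \<odot> v' - s \<odot> u') - (lin b * radial (r \<odot> v' - s \<odot> u')) \<odot> \<phi>"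
    unfolding x u v by (rule vf_eqI) (simp add: koszul_def algebra_simps)
  have "c \<odot> x + y = (c \<odot> koszul u' v' + \<tau>) + (lin b * radial \<phi>) \<odot> (c \<odot> (r \<odot> v' - s \<odot> u') + \<psi>)
      - (lin b * radial (c \<odot> (r \<odot> v' - s \<odot> u') + \<psi>)) \<odot> \<phi>"
    unfolding y(3) x_eq by (intro vf_eqI) (simp add: algebra_simps)
  moreover have "c \<odot> koszul u' v' + \<tau> \<in> koszul_span (vf.span B)"
    using y(1) koszul_in_koszul_span[of u' "vf.span B" v'] r s
    by (auto simp: u'_def v'_def intro: vf.subspace_add[OF subspace_koszul_span] vf.subspace_scale[OF subspace_koszul_span])
  moreover have "c \<odot> (r \<odot> v' - s \<odot> u') + \<psi> \<in> vf.span B"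
    using y(2) r s by (auto simp: u'_def v'_def intro!: vf.span_add vf.span_scale vf.span_diff)
  ultimately show ?case by blast
qed

lemma direct_unique: "\<psi> + r \<odot> \<phi> = \<psi>' + r' \<odot> \<phi> \<Longrightarrow> \<psi> \<in> vf.span B \<Longrightarrow> \<psi>' \<in> vf.span B \<Longrightarrow> r = r' \<and> \<psi> = \<psi>'"
proof -
  assume *: "\<psi> + r \<odot> \<phi> = \<psi>' + r' \<odot> \<phi>" "\<psi> \<in> vf.span B" "\<psi>' \<in> vf.span B"
  then have "(r - r') \<odot> \<phi> = \<psi>' - \<psi>" by (simp add: algebra_simps)
  then have "r - r' = 0" using direct *(2,3) vf.span_diff by metis
  then show ?thesis using * by simp
qed

text \<open>Exactness says that modulo the ideal of \<open>B\<close> the last generator \<open>b * radial \<phi>\<close> is not a zero divisor.  The sum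
  being direct, one may compare the coefficients of \<open>\<phi>\<close> in the representation just obtained.\<close>

lemma syzygy:
  assumes \<psi>: "\<psi> \<in> vf.span B" and rel: "radial \<psi> + s * (lin b * radial \<phi>) = 0"
  shows "\<exists>\<psi>'\<in>vf.span B. s = - radial \<psi>' \<and> \<psi> - (lin b * radial \<phi>) \<odot> \<psi>' \<in> koszul_span (vf.span B)"
proof -
  let ?N = "vf.span (insert (lin b \<odot> \<phi>) B)"
  have "\<psi> \<in> ?N" using \<psi> vf.span_mono[of B "insert (lin b \<odot> \<phi>) B"] by auto
  then have "\<psi> + s \<odot> (lin b \<odot> \<phi>) \<in> ?N" by (intro vf.span_add vf.span_scale[OF vf.span_base]) auto
  moreover have "radial (\<psi> + s \<odot> (lin b \<odot> \<phi>)) = 0" using rel by (simp add: mult.assoc)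
  ultimately have "\<psi> + s \<odot> (lin b \<odot> \<phi>) \<in> koszul_span ?N" using exact by (auto simp: koszul_exact_def)
  from koszul_span_rep[OF this] obtain \<tau> \<psi>' where *: "\<tau> \<in> koszul_span (vf.span B)" "\<psi>' \<in> vf.span B"
    "\<psi> + s \<odot> (lin b \<odot> \<phi>) = \<tau> + (lin b * radial \<phi>) \<odot> \<psi>' - (lin b * radial \<psi>') \<odot> \<phi>" by blast
  have "koszul_span (vf.span B) \<subseteq> vf.span B"
    unfolding koszul_span_def by (rule vf.span_minimal) (auto simp: koszul_def intro: vf.span_diff vf.span_scale)
  then have "\<tau> + (lin b * radial \<phi>) \<odot> \<psi>' \<in> vf.span B" using *(1,2) by (intro vf.span_add vf.span_scale) auto
  moreover have "\<psi> + (lin b * s) \<odot> \<phi> = (\<tau> + (lin b * radial \<phi>) \<odot> \<psi>') + (- (lin b * radial \<psi>')) \<odot> \<phi>"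
    using *(3) by (simp add: mult.commute)
  ultimately have "lin b * s = - (lin b * radial \<psi>')" and \<psi>_eq: "\<psi> = \<tau> + (lin b * radial \<phi>) \<odot> \<psi>'"
    using direct_unique \<psi> by blast+
  then have "lin b * s = lin b * (- radial \<psi>')" by simp
  \<comment> \<open>Both coefficients carry the factor \<open>b\<close> of the generator \<open>b \<phi>\<close>, which is cancelled.\<close>
  then have "s = - radial \<psi>'" using b0 by (simp only: mult_cancel_left lin_eq_0_iff) simp
  moreover have "\<psi> - (lin b * radial \<phi>) \<odot> \<psi>' \<in> koszul_span (vf.span B)" using *(1) by (simp add: \<psi>_eq)
  ultimately show ?thesis using *(2) by blast
qed

text \<open>Omitting the last element of a regular sequence: by \<open>syzygy\<close> with \<open>s = 0\<close> the field \<open>\<psi>\<close> agrees modulo Koszul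
  relations with \<open>b * radial \<phi>\<close> times a field of smaller degree which also has radial part 0.  This is Nakayama's
  lemma in the graded setting.\<close>

lemma exact_B_homog: "\<psi> \<in> vf.span B \<Longrightarrow> radial \<psi> = 0 \<Longrightarrow> homogv d \<psi> \<Longrightarrow> \<psi> \<in> koszul_span (vf.span B)"
proof (induction d arbitrary: \<psi> rule: less_induct)
  case (less d)
  obtain \<psi>' where \<psi>': "\<psi>' \<in> vf.span B" "0 = - radial \<psi>'" "\<psi> - (lin b * radial \<phi>) \<odot> \<psi>' \<in> koszul_span (vf.span B)"
    using syzygy[of \<psi> 0] less.prems by auto
  define \<tau> where "\<tau> = \<psi> - (lin b * radial \<phi>) \<odot> \<psi>'"
  have hom: "homog (Suc (Suc k)) (lin b * radial \<phi>)"
    using homog_mult[of 1 "lin b" "Suc k" "radial \<phi>"] homog_radial[OF hom_\<phi>] by simp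
  have "\<psi> = vcomp d \<psi>" using less.prems(3) by (simp add: vcomp_homogv)
  also have "\<dots> = vcomp d (\<tau> + (lin b * radial \<phi>) \<odot> \<psi>')" by (simp add: \<tau>_def)
  finally have eq: "\<psi> = vcomp d \<tau> + (if d < Suc (Suc k) then 0 else (lin b * radial \<phi>) \<odot> vcomp (d - Suc (Suc k)) \<psi>')"
    by (simp add: vcomp_smul_homog[OF hom])
  have "vcomp d \<tau> \<in> koszul_span (vf.span B)" using vcomp_koszul_span[OF hom_B] \<psi>'(3) by (simp add: \<tau>_def)
  moreover have "vcomp (d - Suc (Suc k)) \<psi>' \<in> koszul_span (vf.span B)" if "\<not> d < Suc (Suc k)"
    using that less.IH[of "d - Suc (Suc k)"] \<psi>'(2) by (simp add: vcomp_span[OF hom_B \<psi>'(1)] radial_vcomp)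
  ultimately show ?case
    by (subst eq) (auto intro: vf.subspace_add[OF subspace_koszul_span] vf.subspace_scale[OF subspace_koszul_span])
qed

lemma exact_B: "\<psi> \<in> vf.span B \<Longrightarrow> radial \<psi> = 0 \<Longrightarrow> \<psi> \<in> koszul_span (vf.span B)"
proof -
  assume *: "\<psi> \<in> vf.span B" "radial \<psi> = 0"
  obtain N where "\<psi> = (\<Sum>d\<le>N. vcomp d \<psi>)" using vcomp_decomp by blast
  moreover have "vcomp d \<psi> \<in> koszul_span (vf.span B)" for d
    by (rule exact_B_homog[where d = d]) (auto simp: vcomp_span[OF hom_B *(1)] radial_vcomp *)
  ultimately show ?thesis by (metis (no_types, lifting) vf.subspace_sum[OF subspace_koszul_span])
qed

text \<open>Multiplying a relation for \<open>insert \<phi> B\<close> by \<open>b\<close> turns it into one to which \<open>syzygy\<close> applies; the coefficient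
  of \<open>\<phi>\<close> is then the one of a Koszul relation, and what remains is a relation for \<open>B\<close> alone.\<close>

lemma exact_removed: "koszul_exact (vf.span (insert \<phi> B))"
  unfolding koszul_exact_def
proof (intro ballI impI)
  fix a assume a: "a \<in> vf.span (insert \<phi> B)" "radial a = 0"
  obtain h where h: "a - h \<odot> \<phi> \<in> vf.span B" using a(1) by (auto simp: vf.span_insert)
  define \<psi> where "\<psi> = a - h \<odot> \<phi>"
  have a_eq: "a = \<psi> + h \<odot> \<phi>" and \<psi>: "\<psi> \<in> vf.span B" using h by (auto simp: \<psi>_def)
  have "radial (lin b \<odot> \<psi>) + h * (lin b * radial \<phi>) = lin b * radial a" by (simp add: a_eq algebra_simps)
  then obtain \<psi>' where \<psi>': "\<psi>' \<in> vf.span B" "h = - radial \<psi>'"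
    using syzygy[of "lin b \<odot> \<psi>" h] vf.span_scale[OF \<psi>] a(2) by auto
  have "\<psi> - radial \<phi> \<odot> \<psi>' \<in> koszul_span (vf.span B)"
  proof (rule exact_B)
    show "\<psi> - radial \<phi> \<odot> \<psi>' \<in> vf.span B" using \<psi> \<psi>'(1) by (auto intro: vf.span_diff vf.span_scale)
    show "radial (\<psi> - radial \<phi> \<odot> \<psi>') = 0" using a(2) by (simp add: a_eq \<psi>'(2) mult.commute)
  qed
  moreover have "koszul_span (vf.span B) \<subseteq> koszul_span (vf.span (insert \<phi> B))"
    by (intro koszul_span_mono vf.span_mono) auto
  moreover have "koszul \<phi> \<psi>' \<in> koszul_span (vf.span (insert \<phi> B))"
    using \<psi>'(1) vf.span_mono[of B "insert \<phi> B"] by (intro koszul_in_koszul_span) (auto intro: vf.span_base)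
  moreover have "a = (\<psi> - radial \<phi> \<odot> \<psi>') + koszul \<phi> \<psi>'"
    by (simp add: a_eq \<psi>'(2) koszul_def)
  ultimately show "a \<in> koszul_span (vf.span (insert \<phi> B))"
    by (metis subsetD vf.subspace_add[OF subspace_koszul_span])
qed

text \<open>Both factors of the non-zero-divisor \<open>b * radial \<phi>\<close> are non-zero-divisors modulo the ideal of \<open>B\<close>.\<close>

lemma colon_b: "lin b * z = radial \<psi> \<Longrightarrow> \<psi> \<in> vf.span B \<Longrightarrow> \<exists>\<psi>'\<in>vf.span B. z = radial \<psi>'"
proof -
  assume z: "lin b * z = radial \<psi>" "\<psi> \<in> vf.span B"
  have "radial (radial \<phi> \<odot> \<psi>) + (- z) * (lin b * radial \<phi>) = 0" by (simp add: z(1)[symmetric])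
  from syzygy[OF vf.span_scale[OF z(2)] this] show ?thesis by auto
qed

lemma colon_\<phi>: "radial \<phi> * z = radial \<psi> \<Longrightarrow> \<psi> \<in> vf.span B \<Longrightarrow> \<exists>\<psi>'\<in>vf.span B. z = radial \<psi>'"
proof -
  assume z: "radial \<phi> * z = radial \<psi>" "\<psi> \<in> vf.span B"
  have "radial (lin b \<odot> \<psi>) + (- z) * (lin b * radial \<phi>) = 0" by (simp add: z(1)[symmetric])
  from syzygy[OF vf.span_scale[OF z(2)] this] show ?thesis by auto
qed

text \<open>The socle of the quotient by the smaller ideal is \<open>b\<close> times the socle for the larger one.  A socle element \<open>h\<close> is
  annihilated by \<open>radial \<phi>\<close>, which has no constant term; so \<open>radial \<phi> * h\<close> is a multiple of \<open>b * radial \<phi>\<close>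
  modulo the ideal of \<open>B\<close>, and \<open>radial \<phi>\<close> may be cancelled.\<close>

lemma socle_step:
  assumes h: "\<And>v. \<exists>a\<in>vf.span (insert (lin b \<odot> \<phi>) B). lin v * h = radial a"
  shows "\<exists>r. \<exists>a\<in>vf.span (insert (lin b \<odot> \<phi>) B). h = lin b * r + radial a \<and>
           (\<forall>v. \<exists>a\<in>vf.span (insert \<phi> B). lin v * r = radial a)"
proof -
  have rep: "\<exists>\<psi>\<in>vf.span B. \<exists>s. lin v * h = radial \<psi> + s * (lin b * radial \<phi>)" for v
  proof -
    obtain a where a: "a \<in> vf.span (insert (lin b \<odot> \<phi>) B)" "lin v * h = radial a" using h by blast
    obtain s where s: "a - s \<odot> (lin b \<odot> \<phi>) \<in> vf.span B" using a(1) by (auto simp: vf.span_insert)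
    have "lin v * h = radial (a - s \<odot> (lin b \<odot> \<phi>)) + s * (lin b * radial \<phi>)" using a by simp
    then show ?thesis using s by blast
  qed
  have "\<exists>\<psi>\<in>vf.span B. \<exists>s. radial \<phi> * h = radial \<psi> + s * (lin b * radial \<phi>)"
  proof -
    obtain \<psi> s where *: "\<And>v. \<psi> v \<in> vf.span B" "\<And>v. lin v * h = radial (\<psi> v) + s v * (lin b * radial \<phi>)"
      using rep by metis
    \<comment> \<open>The linear forms in \<open>radial \<phi>\<close> are spent on \<open>h\<close>.\<close>
    have "radial \<phi> * h = (\<Sum>e\<in>E. coord e \<phi> * (lin e * h))"
      unfolding radial_def sum_distrib_right by (simp add: ac_simps)
    also have "\<dots> = (\<Sum>e\<in>E. coord e \<phi> * radial (\<psi> e) + coord e \<phi> * s e * (lin b * radial \<phi>))"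
      unfolding *(2) by (simp only: distrib_left mult.assoc)
    also have "\<dots> = radial (\<Sum>e\<in>E. coord e \<phi> \<odot> \<psi> e) + (\<Sum>e\<in>E. coord e \<phi> * s e) * (lin b * radial \<phi>)"
      by (simp only: sum.distrib sum_distrib_right[symmetric] radial_sum radial_simps)
    finally show ?thesis using *(1) by (blast intro: vf.span_sum vf.span_scale)
  qed
  then obtain \<psi> s where \<psi>: "\<psi> \<in> vf.span B" "radial \<phi> * (h - s * lin b) = radial \<psi>"
    by (auto simp: algebra_simps)
  obtain \<psi>' where \<psi>': "\<psi>' \<in> vf.span B" "h - s * lin b = radial \<psi>'" using colon_\<phi>[OF \<psi>(2,1)] by blast
  have h_eq: "h = lin b * s + radial \<psi>'" using \<psi>'(2) by (simp add: algebra_simps)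
  have "\<exists>a\<in>vf.span (insert \<phi> B). lin v * s = radial a" for v
  proof -
    obtain \<psi>1 s1 where 1: "\<psi>1 \<in> vf.span B" "lin v * h = radial \<psi>1 + s1 * (lin b * radial \<phi>)" using rep by blast
    \<comment> \<open>The cofactor of \<open>b\<close> is again a socle element, since \<open>b\<close> may be cancelled.\<close>
    have "lin b * (lin v * s - s1 * radial \<phi>) = radial (\<psi>1 - lin v \<odot> \<psi>')"
      using 1(2) unfolding h_eq by (simp add: algebra_simps)
    then obtain \<psi>2 where 2: "\<psi>2 \<in> vf.span B" "lin v * s - s1 * radial \<phi> = radial \<psi>2"
      using colon_b 1(1) \<psi>'(1) vf.span_diff vf.span_scale by metis
    have "lin v * s = radial (\<psi>2 + s1 \<odot> \<phi>)" using 2(2) by (simp add: algebra_simps)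
    moreover have "\<psi>2 + s1 \<odot> \<phi> \<in> vf.span (insert \<phi> B)"
      using 2(1) vf.span_mono[of B "insert \<phi> B"] by (intro vf.span_add vf.span_scale) (auto intro: vf.span_base)
    ultimately show ?thesis by blast
  qed
  moreover have "\<psi>' \<in> vf.span (insert (lin b \<odot> \<phi>) B)" using \<psi>'(1) vf.span_mono[of B "insert (lin b \<odot> \<phi>) B"] by auto
  ultimately show ?thesis using h_eq by blast
qed

end

section \<open>Root systems\<close>

text \<open>Root systems that need not span the space, so that the notion is inherited by subsystems.\<close>

definition crystallographic :: "'a::real_inner set \<Rightarrow> bool" where
  "crystallographic \<Psi> \<longleftrightarrow> finite \<Psi> \<and> 0 \<notin> \<Psi> \<and>
     (\<forall>a\<in>\<Psi>. \<forall>c. c *\<^sub>R a \<in> \<Psi> \<longrightarrow> c = 1 \<or> c = -1) \<and>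
     (\<forall>a\<in>\<Psi>. \<forall>b\<in>\<Psi>. reflection a b \<in> \<Psi>) \<and>
     (\<forall>a\<in>\<Psi>. \<forall>b\<in>\<Psi>. 2 * (a \<bullet> b) / (a \<bullet> a) \<in> \<int>)"

lemma root_system_crystallographic: "root_system \<Phi> \<Longrightarrow> crystallographic \<Phi>"
  unfolding root_system_def crystallographic_def by (intro conjI; blast)

lemma reflection_self: "a \<noteq> 0 \<Longrightarrow> reflection a a = - a"
  by (simp add: reflection_def scaleR_2)

lemma reflection_reflection: "reflection a (reflection a x) = x"
  by (cases "a = 0") (simp_all add: reflection_def inner_diff_right algebra_simps)

lemma inner_reflection: "reflection a x \<bullet> reflection a y = x \<bullet> y"
  by (cases "a = 0") (simp_all add: reflection_def inner_diff_left inner_diff_right field_simps inner_commute)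

lemma inner_reflection_swap: "x \<bullet> reflection a y = reflection a x \<bullet> y"
  using inner_reflection[of a x "reflection a y"] by (simp add: reflection_reflection)

lemma inner_self_reflection: "a \<bullet> reflection a x = - (a \<bullet> x)"
  by (cases "a = 0") (simp_all add: reflection_def inner_diff_right)

lemma crystallographicD:
  assumes "crystallographic \<Psi>"
  shows "finite \<Psi>" "0 \<notin> \<Psi>" "a \<in> \<Psi> \<Longrightarrow> b \<in> \<Psi> \<Longrightarrow> reflection a b \<in> \<Psi>"
    "a \<in> \<Psi> \<Longrightarrow> c *\<^sub>R a \<in> \<Psi> \<Longrightarrow> c = 1 \<or> c = -1"
    "a \<in> \<Psi> \<Longrightarrow> b \<in> \<Psi> \<Longrightarrow> 2 * (a \<bullet> b) / (a \<bullet> a) \<in> \<int>"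
  using assms unfolding crystallographic_def by blast+

lemma crystallographic_neg: "crystallographic \<Psi> \<Longrightarrow> a \<in> \<Psi> \<Longrightarrow> - a \<in> \<Psi>"
  using crystallographicD(3)[of \<Psi> a a] crystallographicD(2)[of \<Psi>] reflection_self[of a] by force

lemma crystallographic_Int:
  assumes "crystallographic \<Phi>" "\<And>x y n. x \<in> U \<Longrightarrow> y \<in> U \<Longrightarrow> x - of_int n *\<^sub>R y \<in> U"
  shows "crystallographic (\<Phi> \<inter> U)"
proof -
  have "reflection a b \<in> U" if "a \<in> \<Phi> \<inter> U" "b \<in> \<Phi> \<inter> U" for a b
  proof -
    have "2 * (a \<bullet> b) / (a \<bullet> a) \<in> \<int>" using crystallographicD(5)[OF assms(1)] that by blast
    then obtain n :: int where n: "2 * (a \<bullet> b) / (a \<bullet> a) = of_int n" by (rule Ints_cases)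
    show ?thesis unfolding reflection_def n using assms(2)[of b a n] that by blast
  qed
  then show ?thesis using assms(1) unfolding crystallographic_def by auto
qed

lemma crystallographic_Int_subspace: "crystallographic \<Phi> \<Longrightarrow> subspace U \<Longrightarrow> crystallographic (\<Phi> \<inter> U)"
  by (rule crystallographic_Int) (auto intro: subspace_diff subspace_scale)

text \<open>Two roots with an acute angle have positive Cartan integers.  If neither of them is 1, both are at least 2, and
  then \<open>\<bar>a - b\<bar>\<^sup>2 \<le> 0\<close>; if one of them is 1, a reflection takes one root to \<open>\<plusminus>(a - b)\<close>.\<close>

lemma crystallographic_diff:
  assumes "crystallographic \<Psi>" "a \<in> \<Psi>" "b \<in> \<Psi>" "a \<noteq> b" "a \<bullet> b > 0"
  shows "a - b \<in> \<Psi>"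
proof -
  have pos: "a \<bullet> a > 0" "b \<bullet> b > 0" using assms crystallographicD(2) by auto
  obtain n :: int where n: "2 * (b \<bullet> a) / (b \<bullet> b) = of_int n"
    using crystallographicD(5)[OF assms(1,3,2)] by (rule Ints_cases)
  obtain m :: int where m: "2 * (a \<bullet> b) / (a \<bullet> a) = of_int m"
    using crystallographicD(5)[OF assms(1,2,3)] by (rule Ints_cases)
  have "of_int n > (0::real)" "of_int m > (0::real)"
    unfolding n[symmetric] m[symmetric] using pos assms(5) by (simp_all add: inner_commute)
  then have nm: "n \<ge> 1" "m \<ge> 1" by simp_all
  consider "n = 1" | "m = 1" | "n \<ge> 2 \<and> m \<ge> 2" using nm by linarith
  then show ?thesis
  proof cases
    case 1
    have "reflection b a = a - b" unfolding reflection_def n 1 by simp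
    then show ?thesis using crystallographicD(3)[OF assms(1,3,2)] by simp
  next
    case 2
    have "reflection a b = b - a" unfolding reflection_def m 2 by simp
    then show ?thesis using crystallographic_neg[OF assms(1) crystallographicD(3)[OF assms(1,2,3)]] by simp
  next
    case 3
    then have "2 * (b \<bullet> a) / (b \<bullet> b) \<ge> 2" "2 * (a \<bullet> b) / (a \<bullet> a) \<ge> 2" unfolding n m by simp_all
    then have ge: "a \<bullet> b \<ge> b \<bullet> b" "a \<bullet> b \<ge> a \<bullet> a" using pos by (simp_all add: field_simps inner_commute)
    have "(a - b) \<bullet> (a - b) = (a \<bullet> a - a \<bullet> b) + (b \<bullet> b - a \<bullet> b)"
      by (simp add: inner_diff_left inner_diff_right inner_commute)
    then have "(a - b) \<bullet> (a - b) \<le> 0" using ge by linarith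
    then have "a = b" by (metis eq_iff_diff_eq_0 inner_ge_zero inner_eq_zero_iff order_antisym)
    then show ?thesis using assms(4) by blast
  qed
qed

text \<open>If the positive and the negative terms of a linear relation are separated, they represent the same vector \<open>v\<close>, and
  \<open>v \<bullet> v \<le> 0\<close> by the assumption on the angles.  The functional \<open>h\<close> shows that \<open>v = 0\<close> leaves no
  positive terms.\<close>

lemma obtuse_independent:
  assumes "finite S" "\<And>a b. a \<in> S \<Longrightarrow> b \<in> S \<Longrightarrow> a \<noteq> b \<Longrightarrow> a \<bullet> b \<le> 0"
    and "linear h" "\<And>a. a \<in> S \<Longrightarrow> h a > (0::real)"
  shows "independent S"
proof (rule independent_if_scalars_zero[OF assms(1)])
  fix f x assume f: "(\<Sum>x\<in>S. f x *\<^sub>R x) = 0" and x: "x \<in> S"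
  have part: "\<forall>x\<in>S. g x \<le> 0" if g: "(\<Sum>x\<in>S. g x *\<^sub>R x) = 0" for g
  proof -
    define P where "P = {x\<in>S. g x > 0}"
    define N where "N = {x\<in>S. g x \<le> 0}"
    have PN: "S = P \<union> N" "P \<inter> N = {}" "finite P" "finite N" using assms(1) by (auto simp: P_def N_def)
    define v where "v = (\<Sum>x\<in>P. g x *\<^sub>R x)"
    have v2: "v = (\<Sum>x\<in>N. (- g x) *\<^sub>R x)"
      using g unfolding PN(1) sum.union_disjoint[OF PN(3,4,2)] v_def
      by (simp add: sum_negf eq_neg_iff_add_eq_0)
    have "v \<bullet> v = (\<Sum>x\<in>P. g x *\<^sub>R x) \<bullet> (\<Sum>y\<in>N. (- g y) *\<^sub>R y)"
      using v2 v_def by simp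
    also have "\<dots> = (\<Sum>x\<in>P. \<Sum>y\<in>N. g x * (- g y) * (x \<bullet> y))"
      by (simp add: inner_sum_left inner_sum_right sum_distrib_left sum_negf)
        (subst sum.swap, simp add: ac_simps)
    also have "\<dots> \<le> 0"
      using PN assms(2) by (intro sum_nonpos mult_nonneg_nonpos) (auto simp: P_def N_def mult_le_0_iff)
    finally have "v = 0" by (metis inner_ge_zero inner_eq_zero_iff order_antisym)
    then have "0 = h (\<Sum>x\<in>P. g x *\<^sub>R x)" using assms(3) by (simp add: v_def linear_0)
    also have "\<dots> = (\<Sum>x\<in>P. g x * h x)" by (simp add: linear_sum[OF assms(3)] linear_scale[OF assms(3)])
    finally have "(\<Sum>x\<in>P. g x * h x) = 0" by simp
    then have "\<forall>x\<in>P. g x * h x = 0"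
      using PN(3) assms(4) by (subst (asm) sum_nonneg_eq_0_iff) (auto simp: P_def less_imp_le)
    then have "P = {}" using assms(4) by (force simp: P_def)
    then show ?thesis using PN(1) by (auto simp: N_def)
  qed
  have "f x \<le> 0" using part[OF f] x by blast
  moreover have "(\<Sum>x\<in>S. (- f x) *\<^sub>R x) = 0" using f by (simp add: sum_negf)
  then have "- f x \<le> 0" using part[of "\<lambda>x. - f x"] x by blast
  ultimately show "f x = 0" by simp
qed

lemma nonneg_combs_0: "0 \<in> nonneg_combs S"
  by (auto simp: nonneg_combs_def intro!: exI[of _ "\<lambda>_. 0"])

lemma nonneg_combs_add: "x \<in> nonneg_combs S \<Longrightarrow> y \<in> nonneg_combs S \<Longrightarrow> x + y \<in> nonneg_combs S"
proof -
  assume "x \<in> nonneg_combs S" "y \<in> nonneg_combs S"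
  then obtain c d :: "'a \<Rightarrow> nat" where
    "x = (\<Sum>a\<in>S. of_nat (c a) *\<^sub>R a)" "y = (\<Sum>a\<in>S. of_nat (d a) *\<^sub>R a)"
    by (auto simp: nonneg_combs_def)
  then have "x + y = (\<Sum>a\<in>S. of_nat (c a + d a) *\<^sub>R a)"
    by (simp add: sum.distrib scaleR_add_left)
  then show ?thesis unfolding nonneg_combs_def by (intro CollectI exI[of _ "\<lambda>a. c a + d a"])
qed

lemma nonneg_combs_base: "finite S \<Longrightarrow> a \<in> S \<Longrightarrow> a \<in> nonneg_combs S"
proof -
  assume *: "finite S" "a \<in> S"
  then have "(\<Sum>d\<in>S. of_nat (if d = a then 1 else 0) *\<^sub>R d) = (\<Sum>d\<in>S. if d = a then d else 0)"
    by (intro sum.cong) auto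
  also have "\<dots> = a" using * by simp
  finally show ?thesis unfolding nonneg_combs_def by (intro CollectI exI[of _ "\<lambda>d. if d = a then 1 else 0"]) simp
qed

lemma nonneg_combs_scale: "x \<in> nonneg_combs S \<Longrightarrow> of_nat n *\<^sub>R x \<in> nonneg_combs S"
  by (induction n) (auto simp: nonneg_combs_0 scaleR_add_left intro: nonneg_combs_add)

lemma nonneg_combs_sum: "(\<And>i. i \<in> A \<Longrightarrow> f i \<in> nonneg_combs S) \<Longrightarrow> (\<Sum>i\<in>A. f i) \<in> nonneg_combs S"
  by (induction A rule: infinite_finite_induct) (auto intro: nonneg_combs_0 nonneg_combs_add)

lemma nonneg_combs_mono: "S \<subseteq> nonneg_combs T \<Longrightarrow> nonneg_combs S \<subseteq> nonneg_combs T"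
  unfolding nonneg_combs_def[of S] by (auto intro!: nonneg_combs_sum nonneg_combs_scale)

lemma nonneg_combs_linear_nonneg:
  assumes "linear h" "\<And>a. a \<in> S \<Longrightarrow> h a \<ge> (0::real)" "x \<in> nonneg_combs S"
  shows "h x \<ge> 0"
proof -
  obtain c :: "'a \<Rightarrow> nat" where "x = (\<Sum>a\<in>S. of_nat (c a) *\<^sub>R a)"
    using assms(3) by (auto simp: nonneg_combs_def)
  then have "h x = (\<Sum>a\<in>S. of_nat (c a) * h a)"
    by (simp add: linear_sum[OF assms(1)] linear_scale[OF assms(1)])
  then show ?thesis using assms(2) by (simp add: sum_nonneg)
qed

text \<open>Every subsystem has a base for the positivity inherited from a linear functional, namely its
  indecomposable positive roots: they form obtuse angles, because the difference of two roots with an acute angle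
  is a root and would decompose one of them.\<close>

lemma base_exists:
  fixes \<Psi> :: "'a::real_inner set"
  assumes "crystallographic \<Psi>" "linear h" "\<And>a. a \<in> \<Psi> \<Longrightarrow> h a \<noteq> (0::real)"
  defines "S \<equiv> {a\<in>\<Psi>. h a > 0 \<and> \<not> (\<exists>b\<in>\<Psi>. \<exists>c\<in>\<Psi>. h b > 0 \<and> h c > 0 \<and> a = b + c)}"
  shows "simple_roots \<Psi> S" "positive_roots \<Psi> S = {a\<in>\<Psi>. h a > 0}"
proof -
  have fin: "finite \<Psi>" "finite S" using crystallographicD(1)[OF assms(1)] by (auto simp: S_def)
  have lt: "card {x\<in>\<Psi>. h x < h y} < card {x\<in>\<Psi>. h x < h z}" if "y \<in> \<Psi>" "h y < h z" for y z
  proof (rule psubset_card_mono)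
    show "finite {x\<in>\<Psi>. h x < h z}" using fin by simp
    have "y \<notin> {x\<in>\<Psi>. h x < h y}" "y \<in> {x\<in>\<Psi>. h x < h z}" using that by simp_all
    moreover have "{x\<in>\<Psi>. h x < h y} \<subseteq> {x\<in>\<Psi>. h x < h z}" using that(2) by auto
    ultimately show "{x\<in>\<Psi>. h x < h y} \<subset> {x\<in>\<Psi>. h x < h z}" by blast
  qed
  have pos: "a \<in> nonneg_combs S" if "a \<in> \<Psi>" "h a > 0" for a
    using that
  proof (induction "card {b\<in>\<Psi>. h b < h a}" arbitrary: a rule: less_induct)
    case less
    show ?case
    proof (cases "a \<in> S")
      case True
      then show ?thesis using nonneg_combs_base fin by blast
    next
      case False
      then obtain b c where bc: "b \<in> \<Psi>" "c \<in> \<Psi>" "h b > 0" "h c > 0" "a = b + c"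
        using less.prems by (auto simp: S_def)
      have ha: "h a = h b + h c" using bc assms(2) by (simp add: linear_add)
      have "b \<in> nonneg_combs S" "c \<in> nonneg_combs S"
        using lt[of b a] lt[of c a] bc ha by (auto intro: less.hyps)
      then show ?thesis unfolding bc(5) by (rule nonneg_combs_add)
    qed
  qed
  have obt: "a \<bullet> b \<le> 0" if "a \<in> S" "b \<in> S" "a \<noteq> b" for a b
  proof (rule ccontr)
    assume "\<not> a \<bullet> b \<le> 0"
    then have ab: "a - b \<in> \<Psi>" using crystallographic_diff[OF assms(1)] that by (auto simp: S_def)
    then have ba: "b - a \<in> \<Psi>" using crystallographic_neg[OF assms(1)] by force
    have hab: "h (a - b) \<noteq> 0" "h (b - a) = - h (a - b)"
      using assms(3)[OF ab] by (simp_all add: linear_diff[OF assms(2)])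
    have dec: "y + z \<notin> S" if "y \<in> \<Psi>" "z \<in> \<Psi>" "h y > 0" "h z > 0" for y z
      using that unfolding S_def by blast
    have S: "a \<in> \<Psi>" "b \<in> \<Psi>" "h a > 0" "h b > 0" using that by (auto simp: S_def)
    have "h (a - b) > 0 \<Longrightarrow> a \<notin> S" using dec[of b "a - b"] S ab by simp
    moreover have "h (b - a) > 0 \<Longrightarrow> b \<notin> S" using dec[of a "b - a"] S ba by simp
    ultimately show False using that(1,2) hab by linarith
  qed
  have "independent S"
    by (rule obtuse_independent[OF fin(2) obt assms(2)]) (auto simp: S_def)
  moreover have "a \<in> nonneg_combs S \<or> - a \<in> nonneg_combs S" if "a \<in> \<Psi>" for a
  proof -
    have "h (- a) = - h a" using assms(2) by (simp add: linear_neg)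
    then show ?thesis using pos[of a] pos[of "- a"] that crystallographic_neg[OF assms(1) that] assms(3)[OF that] by argo
  qed
  ultimately show "simple_roots \<Psi> S" by (auto simp: simple_roots_def S_def)
  have "h a > 0" if "a \<in> \<Psi>" "a \<in> nonneg_combs S" for a
    using nonneg_combs_linear_nonneg[OF assms(2) _ that(2)] assms(3)[OF that(1)]
    by (force simp: S_def less_imp_le)
  then show "positive_roots \<Psi> S = {a\<in>\<Psi>. h a > 0}"
    using pos by (auto simp: positive_roots_def)
qed

text \<open>For the positive roots this is the sum \<open>2 \<rho>\<^sup>\<or>\<close> of the positive coroots.\<close>

definition coroot_sum :: "'a::real_inner set \<Rightarrow> 'a" where
  "coroot_sum A = (\<Sum>g\<in>A. (2 / (g \<bullet> g)) *\<^sub>R g)"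

locale based =
  fixes \<Psi> S :: "'a::real_inner set"
  assumes crystallographic: "crystallographic \<Psi>" and base: "simple_roots \<Psi> S"
begin

abbreviation pos :: "'a set" where "pos \<equiv> positive_roots \<Psi> S"

lemma S_sub: "S \<subseteq> \<Psi>" and indep: "independent S" and fin_S: "finite S" and fin_\<Psi>: "finite \<Psi>"
  using base crystallographicD(1)[OF crystallographic] finite_subset by (auto simp: simple_roots_def)

lemma pos_or_neg: "a \<in> \<Psi> \<Longrightarrow> a \<in> pos \<or> - a \<in> pos"
  using base crystallographic_neg[OF crystallographic] by (auto simp: simple_roots_def positive_roots_def)

lemma pos_sub: "pos \<subseteq> \<Psi>" and fin_pos: "finite pos"
  using fin_\<Psi> by (auto simp: positive_roots_def)

lemma S_pos: "S \<subseteq> pos"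
  using S_sub nonneg_combs_base[OF fin_S] by (auto simp: positive_roots_def)

text \<open>The sum of the coefficients with respect to the base, extended linearly (and arbitrarily outside of the span).\<close>

definition ht :: "'a \<Rightarrow> real" where
  "ht = (SOME h. linear h \<and> (\<forall>a\<in>S. h a = 1))"

lemma linear_ht: "linear ht" and ht_S: "a \<in> S \<Longrightarrow> ht a = 1"
proof -
  have "\<exists>h. linear h \<and> (\<forall>a\<in>S. h a = (1::real))"
    using linear_independent_extend[OF indep, of "\<lambda>_. 1"] by blast
  from someI_ex[OF this] show "linear ht" "a \<in> S \<Longrightarrow> ht a = 1" by (auto simp: ht_def)
qed

lemma ht_combs: "x \<in> nonneg_combs S \<Longrightarrow> \<exists>n. ht x = of_nat n"
proof -
  assume "x \<in> nonneg_combs S"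
  then obtain c :: "'a \<Rightarrow> nat" where c: "x = (\<Sum>a\<in>S. of_nat (c a) *\<^sub>R a)" by (auto simp: nonneg_combs_def)
  have "ht x = (\<Sum>a\<in>S. of_nat (c a))"
    by (simp add: c linear_sum[OF linear_ht] linear_scale[OF linear_ht] ht_S)
  then show ?thesis by (metis of_nat_sum)
qed

lemma combs_ht_0: "x \<in> nonneg_combs S \<Longrightarrow> ht x = 0 \<Longrightarrow> x = 0"
proof -
  assume "x \<in> nonneg_combs S" and 0: "ht x = 0"
  then obtain c :: "'a \<Rightarrow> nat" where c: "x = (\<Sum>a\<in>S. of_nat (c a) *\<^sub>R a)" by (auto simp: nonneg_combs_def)
  have "ht x = (\<Sum>a\<in>S. of_nat (c a))"
    by (simp add: c linear_sum[OF linear_ht] linear_scale[OF linear_ht] ht_S)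
  then have "\<forall>a\<in>S. c a = 0" using 0 fin_S by (simp add: sum_nonneg_eq_0_iff)
  then show ?thesis by (simp add: c)
qed

lemma ht_pos: "a \<in> pos \<Longrightarrow> \<exists>n. ht a = of_nat n \<and> n \<ge> 1"
proof -
  assume a: "a \<in> pos"
  then obtain n where n: "ht a = of_nat n" using ht_combs by (auto simp: positive_roots_def)
  moreover have "n \<noteq> 0"
  proof
    assume "n = 0"
    then have "a = 0" using n a combs_ht_0 by (auto simp: positive_roots_def)
    then show False using a crystallographicD(2)[OF crystallographic] by (auto simp: positive_roots_def)
  qed
  ultimately show ?thesis by (intro exI[of _ n]) auto
qed

lemma ht_ge_1: "a \<in> pos \<Longrightarrow> ht a \<ge> 1"
  using ht_pos by force

lemma ht_nonzero: "a \<in> \<Psi> \<Longrightarrow> ht a \<noteq> 0"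
  using pos_or_neg[of a] ht_ge_1[of a] ht_ge_1[of "- a"] by (auto simp: linear_neg[OF linear_ht])

lemma pos_iff_ht: "pos = {a\<in>\<Psi>. ht a > 0}"
proof (intro set_eqI iffI)
  fix a assume "a \<in> pos" then show "a \<in> {a\<in>\<Psi>. ht a > 0}" using ht_ge_1[of a] pos_sub by force
next
  fix a assume "a \<in> {a\<in>\<Psi>. ht a > 0}"
  then show "a \<in> pos" using pos_or_neg[of a] ht_ge_1[of "- a"] by (auto simp: linear_neg[OF linear_ht])
qed

text \<open>A positive root other than \<open>d\<close> has a positive coefficient at a simple root \<open>e \<noteq> d\<close>, and the reflection in
  \<open>d\<close> changes only the coefficient at \<open>d\<close>.\<close>

lemma reflection_pos:
  assumes "d \<in> S" "g \<in> pos" "g \<noteq> d"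
  shows "reflection d g \<in> pos" "reflection d g \<noteq> d"
proof -
  obtain c :: "'a \<Rightarrow> nat" where c: "g = (\<Sum>a\<in>S. of_nat (c a) *\<^sub>R a)"
    using assms(2) by (auto simp: positive_roots_def nonneg_combs_def)
  have "\<exists>e\<in>S. e \<noteq> d \<and> c e > 0"
  proof (rule ccontr)
    assume "\<not> (\<exists>e\<in>S. e \<noteq> d \<and> c e > 0)"
    then have "g = (\<Sum>a\<in>S. if a = d then of_nat (c d) *\<^sub>R d else 0)" unfolding c by (intro sum.cong) auto
    then have g: "g = of_nat (c d) *\<^sub>R d" using assms(1) fin_S by simp
    then have "of_nat (c d) = (1::real) \<or> of_nat (c d) = (-1::real)"
      using crystallographicD(4)[OF crystallographic, of d "of_nat (c d)"] assms S_sub pos_sub by auto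
    moreover have "(of_nat (c d) :: real) \<ge> 0" by simp
    ultimately have "(of_nat (c d) :: real) = 1" by linarith
    then show False using g assms(3) by simp
  qed
  then obtain e where e: "e \<in> S" "e \<noteq> d" "c e > 0" by blast
  obtain \<xi> :: "'a \<Rightarrow> real" where \<xi>: "linear \<xi>" "\<And>a. a \<in> S \<Longrightarrow> \<xi> a = (if a = e then 1 else 0)"
    using linear_independent_extend[OF indep, of "\<lambda>a. if a = e then 1 else 0"] by blast
  have "\<xi> g = (\<Sum>a\<in>S. if a = e then of_nat (c e) else 0)"
    unfolding c by (simp add: linear_sum[OF \<xi>(1)] linear_scale[OF \<xi>(1)] \<xi>(2)) (intro sum.cong, auto)
  then have "\<xi> g = of_nat (c e)" using e fin_S by simp
  then have "\<xi> g > 0" using e by simp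
  then have \<xi>r: "\<xi> (reflection d g) > 0"
    using \<xi>(2)[OF assms(1)] e by (simp add: reflection_def linear_diff[OF \<xi>(1)] linear_scale[OF \<xi>(1)])
  have "reflection d g \<in> \<Psi>" using crystallographicD(3)[OF crystallographic] assms S_sub pos_sub by blast
  moreover have "- reflection d g \<notin> pos"
  proof
    assume "- reflection d g \<in> pos"
    then have "- reflection d g \<in> nonneg_combs S" by (simp add: positive_roots_def)
    then have "\<xi> (- reflection d g) \<ge> 0"
      by (rule nonneg_combs_linear_nonneg[OF \<xi>(1), rotated]) (simp add: \<xi>(2))
    then show False using \<xi>r by (simp add: linear_neg[OF \<xi>(1)])
  qed
  ultimately show "reflection d g \<in> pos" using pos_or_neg by blast
  show "reflection d g \<noteq> d" using \<xi>r \<xi>(2)[OF assms(1)] e by auto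
qed

text \<open>The reflection in the simple root \<open>d\<close> permutes the other positive roots and changes the sign of their product with
  \<open>d\<close>; so only the coroot of \<open>d\<close> itself contributes.\<close>

lemma coroot_sum_S: "d \<in> S \<Longrightarrow> d \<bullet> coroot_sum pos = 2"
proof -
  assume d: "d \<in> S"
  define f where "f g = (2 / (g \<bullet> g)) * (d \<bullet> g)" for g
  have dpos: "d \<in> pos" "d \<noteq> 0" using d S_pos S_sub crystallographicD(2)[OF crystallographic] by auto
  have "sum f (pos - {d}) = (\<Sum>g\<in>pos - {d}. f (reflection d g))"
    by (rule sum.reindex_bij_witness[of _ "reflection d" "reflection d"])
      (use reflection_pos[OF d] in \<open>auto simp: reflection_reflection\<close>)
  also have "\<dots> = (\<Sum>g\<in>pos - {d}. - f g)"
    by (simp add: f_def inner_reflection inner_self_reflection)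
  finally have "sum f (pos - {d}) = 0" by (simp add: sum_negf)
  then have "sum f pos = f d" using dpos fin_pos by (simp add: sum.remove[of pos d])
  moreover have "d \<bullet> coroot_sum pos = sum f pos" by (simp add: coroot_sum_def f_def inner_sum_right)
  ultimately show ?thesis using dpos by (simp add: f_def)
qed

lemma coroot_sum_ht: "x \<in> span S \<Longrightarrow> x \<bullet> coroot_sum pos = 2 * ht x"
proof (induction rule: span_induct_alt)
  case base then show ?case by (simp add: linear_0[OF linear_ht])
next
  case (step c x y)
  then show ?case
    by (simp add: inner_add_left coroot_sum_S linear_add[OF linear_ht] linear_scale[OF linear_ht] ht_S)
qed

lemma combs_span: "nonneg_combs S \<subseteq> span S"
proof
  fix x assume "x \<in> nonneg_combs S"
  then obtain c :: "'a \<Rightarrow> nat" where c: "x = (\<Sum>a\<in>S. of_nat (c a) *\<^sub>R a)" by (auto simp: nonneg_combs_def)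
  show "x \<in> span S" unfolding c by (intro span_sum span_scale span_base)
qed

text \<open>Since \<open>b \<bullet> b > 0\<close>, some simple root in the expansion of \<open>b\<close> has a positive product with \<open>b\<close> and can be
  subtracted.\<close>

lemma descend:
  assumes "b \<in> pos" "b \<notin> S"
  shows "\<exists>d\<in>S. b - d \<in> pos"
proof -
  obtain c :: "'a \<Rightarrow> nat" where c: "b = (\<Sum>a\<in>S. of_nat (c a) *\<^sub>R a)"
    using assms(1) by (auto simp: positive_roots_def nonneg_combs_def)
  have "b \<bullet> b > 0" using assms(1) pos_sub crystallographicD(2)[OF crystallographic] by auto
  moreover have "b \<bullet> b = (\<Sum>a\<in>S. of_nat (c a) * (a \<bullet> b))" by (subst (1) c) (simp add: inner_sum_left)
  ultimately have "\<exists>d\<in>S. of_nat (c d) * (d \<bullet> b) > 0" by (metis (no_types, lifting) not_le sum_nonpos)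
  then obtain d where d: "d \<in> S" "c d > 0" "d \<bullet> b > 0" by (auto simp: zero_less_mult_iff)
  have "b - d \<in> \<Psi>"
    using crystallographic_diff[OF crystallographic, of b d] d assms S_sub pos_sub by (auto simp: inner_commute)
  moreover have "b - d = (\<Sum>a\<in>S. of_nat (if a = d then c a - 1 else c a) *\<^sub>R a)"
  proof -
    have "(\<Sum>a\<in>S. of_nat (if a = d then c a - 1 else c a) *\<^sub>R a)
        = (\<Sum>a\<in>S. of_nat (c a) *\<^sub>R a - (if a = d then d else 0))"
      using d(2) by (intro sum.cong) (auto simp: of_nat_diff algebra_simps)
    also have "\<dots> = b - d" using d(1) fin_S by (simp add: sum_subtractf c[symmetric])
    finally show ?thesis by simp
  qed
  ultimately have "b - d \<in> pos"
    unfolding positive_roots_def nonneg_combs_def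
    by (intro IntI CollectI exI[of _ "\<lambda>a. if a = d then c a - 1 else c a"])
  then show ?thesis using d(1) by blast
qed

text \<open>Subtracting simple roots one at a time gives a chain with one root of each height.  At height 1 of the chain of a
  non-simple root there are two roots: the last step is the decomposition of a root of height 2.\<close>

lemma card_below:
  assumes "b \<in> pos"
  shows "real (card {g\<in>pos. root_le S g b}) \<ge> ht b + (if b \<in> S then 0 else 1)"
proof -
  obtain n where "ht b = of_nat n" using ht_pos assms by blast
  then show ?thesis using assms
  proof (induction n arbitrary: b)
    case 0 then show ?case using ht_ge_1 by fastforce
  next
    case (Suc n)
    have fin: "finite {g\<in>pos. root_le S g b}" using fin_pos by auto
    have bb: "b \<in> {g\<in>pos. root_le S g b}" using Suc by (auto simp: root_le_def nonneg_combs_0)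
    show ?case
    proof (cases "b \<in> S")
      case True
      have "card {g\<in>pos. root_le S g b} > 0" using bb fin by (auto simp: card_gt_0_iff)
      then show ?thesis using True ht_S by simp
    next
      case False
      then obtain d where d: "d \<in> S" "b - d \<in> pos" using descend Suc.prems by blast
      have hd: "ht (b - d) = of_nat n" using Suc.prems(1) d by (simp add: linear_diff[OF linear_ht] ht_S)
      have IH: "real (card {g\<in>pos. root_le S g (b - d)}) \<ge> ht (b - d) + (if b - d \<in> S then 0 else 1)"
        using Suc.IH[OF hd d(2)] .
      have dn: "d \<in> nonneg_combs S" using d(1) nonneg_combs_base fin_S by blast
      have sub: "{g\<in>pos. root_le S g (b - d)} \<subseteq> {g\<in>pos. root_le S g b} - {b}"
      proof
        fix g assume g: "g \<in> {g\<in>pos. root_le S g (b - d)}"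
        then have "b - d - g \<in> nonneg_combs S" by (auto simp: root_le_def)
        then have "b - g \<in> nonneg_combs S" using nonneg_combs_add[OF _ dn] by fastforce
        moreover have "g \<noteq> b"
        proof
          assume "g = b"
          then have "- d \<in> nonneg_combs S" using g by (auto simp: root_le_def)
          then have "ht (- d) \<ge> 0" using ht_combs by fastforce
          then show False using d(1) ht_S by (simp add: linear_neg[OF linear_ht])
        qed
        ultimately show "g \<in> {g\<in>pos. root_le S g b} - {b}" using g by (auto simp: root_le_def)
      qed
      show ?thesis
      proof (cases "b - d \<in> S")
        case False
        have "card {g\<in>pos. root_le S g (b - d)} \<le> card ({g\<in>pos. root_le S g b} - {b})"
          using fin sub by (intro card_mono) auto
        also have "\<dots> < card {g\<in>pos. root_le S g b}" using fin bb by (intro card_Diff1_less) auto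
        finally show ?thesis using IH hd Suc.prems(1) False \<open>b \<notin> S\<close> by simp
      next
        case True
        have "d \<noteq> b - d"
        proof
          assume "d = b - d"
          then have "b = 2 *\<^sub>R d" by (simp add: scaleR_2 algebra_simps)
          then show False using crystallographicD(4)[OF crystallographic, of d 2] d(1) S_sub pos_sub Suc.prems(2) by auto
        qed
        have "b - (b - d) \<in> nonneg_combs S" using dn by simp
        moreover have "b - d \<in> nonneg_combs S" using d(2) by (simp add: positive_roots_def)
        ultimately have "{d, b - d, b} \<subseteq> {g\<in>pos. root_le S g b}"
          using bb d S_pos by (auto simp: root_le_def)
        then have "card {d, b - d, b} \<le> card {g\<in>pos. root_le S g b}" using fin card_mono by blast
        moreover have "d \<noteq> 0" using d(1) S_sub crystallographicD(2)[OF crystallographic] by blast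
        then have "b - d \<noteq> b" by simp
        moreover have "d \<noteq> b" using d(1) \<open>b \<notin> S\<close> by blast
        ultimately have "3 \<le> card {g\<in>pos. root_le S g b}" using \<open>d \<noteq> b - d\<close> by simp
        moreover have "ht b = 2" using hd ht_S[OF True] Suc.prems(1) by simp
        ultimately show ?thesis using \<open>b \<notin> S\<close> by simp
      qed
    qed
  qed
qed

end

text \<open>The roots in \<open>B\<close> have a common height \<open>c\<close>, so they form obtuse angles and are independent, and they are a
  base of the subsystem of the roots in their integral span.  The element \<open>2 \<rho>\<^sup>\<or>\<close> of the subsystem pairs integrally with every root
  \<open>a \<in> span B\<close>, and the pairing is \<open>2 h a / c\<close>.  So a root of height between 0 and \<open>c\<close> has height \<open>c / 2\<close>.

  Let \<open>H\<close> be the set of these roots, and \<open>D\<close> the set of elements of \<open>B\<close> that are sums of two of them.  The set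
  \<open>H \<union> (B - D)\<close> is obtuse, hence independent, and this gives \<open>|H| \<le> |D|\<close>.  On the other hand the sum \<open>w\<close> of the
  normalised elements of \<open>H\<close> is nonzero if \<open>H\<close> is nonempty, and \<open>w \<bullet> w \<le> |H| - |D|\<close>, because two elements of
  \<open>H\<close> whose sum is a root form an angle of at least 120 degrees.\<close>

lemma no_low_root_in_span:
  assumes cr: "crystallographic \<Phi>" and lin_h: "linear h" and h0: "\<And>a. a \<in> \<Phi> \<Longrightarrow> h a \<noteq> (0::real)"
    and B: "B \<subseteq> \<Phi>" "\<And>b. b \<in> B \<Longrightarrow> h b = c" and "c > 0"
    and \<alpha>: "\<alpha> \<in> \<Phi>" "\<alpha> \<in> span B" "0 < h \<alpha>" "h \<alpha> < c"
  shows False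
proof -
  have fin: "finite \<Phi>" "finite B" using crystallographicD(1)[OF cr] B(1) finite_subset by auto
  have obtuse: "a \<bullet> b \<le> 0" if "a \<in> \<Phi>" "b \<in> \<Phi>" "a \<noteq> b" "h a = h b" for a b
  proof (rule ccontr)
    assume "\<not> a \<bullet> b \<le> 0"
    then have "a - b \<in> \<Phi>" using crystallographic_diff[OF cr that(1,2,3)] by simp
    from h0[OF this] show False using that(4) by (simp add: linear_diff[OF lin_h])
  qed
  have indB: "independent B"
  proof (rule obtuse_independent[OF fin(2) _ lin_h])
    show "a \<bullet> b \<le> 0" if "a \<in> B" "b \<in> B" "a \<noteq> b" for a b
      using obtuse[of a b] that B by auto
  qed (use B \<open>c > 0\<close> in auto)
  \<comment> \<open>The subsystem of the roots in the integral span \<open>U\<close> of \<open>B\<close>: heights in \<open>U\<close> are multiples of \<open>c\<close>,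
    so the elements of \<open>B\<close> are indecomposable.\<close>
  define U where "U = range (\<lambda>n::'a \<Rightarrow> int. \<Sum>b\<in>B. of_int (n b) *\<^sub>R b)"
  have U_closed: "x - of_int k *\<^sub>R y \<in> U" if xy: "x \<in> U" "y \<in> U" for x y k
  proof -
    obtain n m :: "'a \<Rightarrow> int" where nm: "x = (\<Sum>b\<in>B. of_int (n b) *\<^sub>R b)" "y = (\<Sum>b\<in>B. of_int (m b) *\<^sub>R b)"
      using xy by (auto simp: U_def)
    have "x - of_int k *\<^sub>R y = (\<Sum>b\<in>B. of_int (n b - k * m b) *\<^sub>R b)"
      unfolding nm scaleR_sum_right sum_subtractf[symmetric] by (simp add: algebra_simps)
    then show ?thesis unfolding U_def by (rule range_eqI[where x = "\<lambda>b. n b - k * m b"])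
  qed
  have U_h: "\<exists>k::int. h x = c * of_int k" if x: "x \<in> U" for x
  proof -
    obtain n :: "'a \<Rightarrow> int" where n: "x = (\<Sum>b\<in>B. of_int (n b) *\<^sub>R b)" using x by (auto simp: U_def)
    have "h x = (\<Sum>b\<in>B. of_int (n b) * h b)"
      unfolding n by (simp add: linear_sum[OF lin_h] linear_scale[OF lin_h])
    also have "\<dots> = c * of_int (\<Sum>b\<in>B. n b)" using B(2) by (simp add: sum_distrib_left mult.commute)
    finally show ?thesis by blast
  qed
  have U_B: "B \<subseteq> U"
  proof
    fix b assume b: "b \<in> B"
    have "(\<Sum>d\<in>B. of_int (if d = b then 1 else 0) *\<^sub>R d) = (\<Sum>d\<in>B. if d = b then d else 0)"
      by (intro sum.cong) auto
    also have "\<dots> = b" using b fin by simp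
    finally have "b = (\<Sum>d\<in>B. of_int (if d = b then 1 else 0) *\<^sub>R d)" ..
    then show "b \<in> U" unfolding U_def by (rule range_eqI[where x = "\<lambda>d. if d = b then 1 else 0"])
  qed
  have U_span: "U \<subseteq> span B"
    unfolding U_def by (intro image_subsetI span_sum span_scale span_base)
  define \<Psi> where "\<Psi> = \<Phi> \<inter> U"
  have cr\<Psi>: "crystallographic \<Psi>" unfolding \<Psi>_def by (rule crystallographic_Int[OF cr U_closed])
  define S where "S = {a\<in>\<Psi>. h a > 0 \<and> \<not> (\<exists>b\<in>\<Psi>. \<exists>c\<in>\<Psi>. h b > 0 \<and> h c > 0 \<and> a = b + c)}"
  have S: "simple_roots \<Psi> S"
    unfolding S_def by (rule base_exists(1)[OF cr\<Psi> lin_h]) (use h0 \<Psi>_def in auto)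
  have "B \<subseteq> S"
  proof
    fix b assume b: "b \<in> B"
    have "\<not> (\<exists>x\<in>\<Psi>. \<exists>y\<in>\<Psi>. h x > 0 \<and> h y > 0 \<and> b = x + y)"
    proof safe
      fix x y assume xy: "x \<in> \<Psi>" "y \<in> \<Psi>" "h x > 0" "h y > 0" "b = x + y"
      obtain k l :: int where kl: "h x = c * of_int k" "h y = c * of_int l"
        using U_h xy(1,2) unfolding \<Psi>_def by blast
      then have "k > 0" "l > 0" using xy(3,4) \<open>c > 0\<close> by (simp_all add: zero_less_mult_iff)
      have "c * of_int (k + l) = c * 1" using B(2)[OF b] kl xy(5) by (simp add: linear_add[OF lin_h] distrib_left)
      then have "real_of_int (k + l) = 1" using \<open>c > 0\<close> by (metis mult_cancel_left less_irrefl)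
      then show False using \<open>k > 0\<close> \<open>l > 0\<close> by linarith
    qed
    then show "b \<in> S" using b B \<open>c > 0\<close> U_B by (auto simp: S_def \<Psi>_def)
  qed
  moreover have "S \<subseteq> B"
  proof
    fix s assume s: "s \<in> S"
    show "s \<in> B"
    proof (rule ccontr)
      assume "s \<notin> B"
      then have "span B \<subseteq> span (S - {s})" using \<open>B \<subseteq> S\<close> by (intro span_mono) auto
      moreover have "s \<in> span B" using s U_span by (auto simp: S_def \<Psi>_def)
      ultimately have "dependent S" using s unfolding dependent_def by blast
      then show False using S by (simp add: simple_roots_def)
    qed
  qed
  ultimately have base: "simple_roots \<Psi> B" using S by simp
  interpret based \<Psi> B by standard (fact cr\<Psi> base)+
  have h_ht: "h x = c * ht x" if "x \<in> span B" for x
    using that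
  proof (induction rule: span_induct_alt)
    case base show ?case by (simp add: linear_0[OF lin_h] linear_0[OF linear_ht])
  next
    case (step k x y)
    then show ?case
      by (simp add: linear_add[OF lin_h] linear_scale[OF lin_h] linear_add[OF linear_ht] linear_scale[OF linear_ht]
          B(2) ht_S distrib_left)
  qed
  have half: "h a = c / 2" if a: "a \<in> \<Phi>" "a \<in> span B" "0 < h a" "h a < c" for a
  proof -
    have "a \<bullet> coroot_sum pos = (\<Sum>g\<in>pos. 2 * (g \<bullet> a) / (g \<bullet> g))"
      by (simp add: coroot_sum_def inner_sum_right inner_commute)
    also have "\<dots> \<in> \<int>"
      using crystallographicD(5)[OF cr _ a(1)] pos_sub by (intro Ints_sum) (auto simp: \<Psi>_def)
    finally have "2 * ht a \<in> \<int>" using coroot_sum_ht[OF a(2)] by simp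
    then obtain k :: int where k: "2 * ht a = of_int k" by (rule Ints_cases)
    have "2 * h a = c * of_int k" using h_ht[OF a(2)] k by simp
    moreover have "k = 1"
    proof -
      have "0 < c * of_int k" "c * of_int k < c * 2" using calculation a(3,4) by linarith+
      then have "0 < real_of_int k" "real_of_int k < 2" using \<open>c > 0\<close> by (simp_all add: zero_less_mult_iff)
      then show ?thesis by linarith
    qed
    ultimately show ?thesis by simp
  qed
  define H where "H = {a\<in>\<Phi>. a \<in> span B \<and> h a = c / 2}"
  have finH: "finite H" using fin by (simp add: H_def)
  \<comment> \<open>An acute angle between \<open>a \<in> H\<close> and \<open>b \<in> B\<close> makes \<open>b - a\<close> an element of \<open>H\<close>, so that \<open>b \<in> D\<close>.\<close>
  define D where "D = {b\<in>B. \<exists>a\<in>H. \<exists>a'\<in>H. b = a + a'}"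
  have HB0: "x \<notin> B" if "x \<in> H" for x
  proof
    assume "x \<in> B"
    then have "c / 2 = c" using B(2)[of x] that by (simp add: H_def)
    then show False using \<open>c > 0\<close> by simp
  qed
  then have HD: "H \<inter> (B - D) = {}" by blast
  have HB: "a \<bullet> b \<le> 0" if "a \<in> H" "b \<in> B - D" for a b
  proof (rule ccontr)
    assume "\<not> a \<bullet> b \<le> 0"
    moreover have "a \<noteq> b" using that HB0 by blast
    ultimately have "b - a \<in> \<Phi>"
      using crystallographic_diff[OF cr, of b a] that B(1) by (auto simp: H_def inner_commute)
    moreover have "b - a \<in> span B" using that by (auto simp: H_def intro: span_diff span_base)
    moreover have "h (b - a) = c / 2" using that B(2)[of b] by (simp add: H_def linear_diff[OF lin_h])
    ultimately have "b - a \<in> H" by (simp add: H_def)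
    moreover have "b = a + (b - a)" by simp
    ultimately show False using that unfolding D_def by blast
  qed
  have "independent (H \<union> (B - D))"
  proof (rule obtuse_independent[OF _ _ lin_h])
    show "finite (H \<union> (B - D))" using finH fin by simp
    show "h a > 0" if "a \<in> H \<union> (B - D)" for a using that \<open>c > 0\<close> B(2)[of a] by (auto simp: H_def)
    show "a \<bullet> b \<le> 0" if ab: "a \<in> H \<union> (B - D)" "b \<in> H \<union> (B - D)" "a \<noteq> b" for a b
    proof -
      consider "a \<in> H" "b \<in> H" | "a \<in> H" "b \<in> B - D" | "a \<in> B - D" "b \<in> H" | "a \<in> B" "b \<in> B"
        using ab(1,2) by blast
      then show ?thesis
      proof cases
        case 1 then show ?thesis using obtuse[of a b] ab(3) by (simp add: H_def)
      next
        case 2 then show ?thesis by (rule HB)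
      next
        case 3 then show ?thesis using HB[of b a] by (simp add: inner_commute)
      next
        case 4 then show ?thesis using obtuse[of a b] ab(3) B(1) B(2)[of a] B(2)[of b] by auto
      qed
    qed
  qed
  moreover have "H \<union> (B - D) \<subseteq> span B" by (auto simp: H_def intro: span_base)
  ultimately have "card (H \<union> (B - D)) \<le> card B" using independent_span_bound[OF fin(2)] by blast
  then have "card H + card (B - D) \<le> card B"
    using card_Un_disjoint[OF finH _ HD] fin by simp
  moreover have "card B = card D + card (B - D)"
    using fin by (metis (no_types, lifting) D_def card_Diff_subset card_mono le_add_diff_inverse mem_Collect_eq rev_finite_subset subsetI)
  ultimately have HleD: "card H \<le> card D" by simp
  \<comment> \<open>Ordered pairs with sum in \<open>D\<close>.  Orthogonality is excluded since it would make the difference of the pair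
    a root of height 0.\<close>
  define P where "P = {p\<in>H \<times> H. fst p + snd p \<in> D}"
  have finP: "finite P" using finH by (simp add: P_def)
  have pairs: "a \<noteq> a' \<and> a \<bullet> a' \<le> - (norm a * norm a') / 2" if aa: "(a, a') \<in> P" for a a'
  proof -
    have a: "a \<in> \<Phi>" "a' \<in> \<Phi>" "h a = c / 2" "h a' = c / 2" "a + a' \<in> \<Phi>"
      using aa B(1) by (auto simp: P_def H_def D_def)
    have "a \<noteq> 0" "a' \<noteq> 0" using a crystallographicD(2)[OF cr] by auto
    have ne: "a \<noteq> a'"
    proof
      assume "a = a'"
      then have "2 *\<^sub>R a \<in> \<Phi>" using a(5) by (simp add: scaleR_2)
      then show False using crystallographicD(4)[OF cr a(1), of 2] by auto
    qed
    have "a \<bullet> a' \<noteq> 0"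
    proof
      assume 0: "a \<bullet> a' = 0"
      have "reflection a (a + a') = a' - a"
        using 0 \<open>a \<noteq> 0\<close> by (simp add: reflection_def inner_add_right scaleR_2)
      then have "a' - a \<in> \<Phi>" using crystallographicD(3)[OF cr a(1,5)] by simp
      from h0[OF this] show False using a by (simp add: linear_diff[OF lin_h])
    qed
    then have neg: "a \<bullet> a' < 0" using obtuse[OF a(1,2) ne] a by simp
    have aux: "2 * (u \<bullet> v) \<le> - (u \<bullet> u)" if uv: "u \<in> \<Phi>" "v \<in> \<Phi>" "u \<bullet> v < 0" for u v
    proof -
      have uu: "u \<bullet> u > 0" using uv(1) crystallographicD(2)[OF cr] by auto
      obtain k :: int where k: "2 * (u \<bullet> v) / (u \<bullet> u) = of_int k"
        using crystallographicD(5)[OF cr uv(1,2)] by (rule Ints_cases)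
      have "2 * (u \<bullet> v) / (u \<bullet> u) < 0" using uv(3) uu by (simp add: divide_neg_pos)
      then have "k \<le> -1" using k by simp
      then have "2 * (u \<bullet> v) / (u \<bullet> u) \<le> -1" unfolding k by simp
      then show ?thesis using uu by (simp add: field_simps)
    qed
    have "2 * (a \<bullet> a') \<le> - (norm a)\<^sup>2" "2 * (a \<bullet> a') \<le> - (norm a')\<^sup>2"
      using aux[OF a(1,2) neg] aux[OF a(2,1)] neg by (simp_all add: power2_norm_eq_inner inner_commute)
    moreover have "2 * (norm a * norm a') \<le> (norm a)\<^sup>2 + (norm a')\<^sup>2"
      using sum_squares_bound[of "norm a" "norm a'"] by simp
    ultimately have "4 * (a \<bullet> a') \<le> - (2 * (norm a * norm a'))" by linarith
    then have "a \<bullet> a' \<le> - (norm a * norm a') / 2" by linarith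
    then show ?thesis using ne by blast
  qed
  have "2 * card D \<le> card P"
  proof -
    define F where "F b = {p\<in>H \<times> H. fst p + snd p = b}" for b
    have P_UN: "P = (\<Union>b\<in>D. F b)" by (auto simp: P_def F_def)
    have finF: "finite (F b)" for b using finH by (simp add: F_def)
    have "2 \<le> card (F b)" if b: "b \<in> D" for b
    proof -
      obtain a a' where aa: "a \<in> H" "a' \<in> H" "b = a + a'" using b by (auto simp: D_def)
      then have "{(a, a'), (a', a)} \<subseteq> F b" by (auto simp: F_def)
      then have "card {(a, a'), (a', a)} \<le> card (F b)" using finF card_mono by blast
      moreover have "a \<noteq> a'" using pairs[of a a'] aa b by (auto simp: P_def)
      ultimately show ?thesis by simp
    qed
    then have "(\<Sum>b\<in>D. 2) \<le> (\<Sum>b\<in>D. card (F b))" by (rule sum_mono)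
    also have "\<dots> = card P"
      unfolding P_UN by (subst card_UN_disjoint) (use fin finF in \<open>auto simp: F_def D_def\<close>)
    finally show ?thesis by (simp add: mult.commute)
  qed
  define w where "w = (\<Sum>a\<in>H. (1 / norm a) *\<^sub>R a)"
  have "\<alpha> \<in> H" using half \<alpha> by (simp add: H_def)
  have nz: "norm a > 0" if "a \<in> H" for a using that crystallographicD(2)[OF cr] by (auto simp: H_def)
  have "h w = (\<Sum>a\<in>H. (1 / norm a) * (c / 2))"
    unfolding w_def linear_sum[OF lin_h] linear_scale[OF lin_h]
    by (intro sum.cong) (auto simp: H_def)
  also have "\<dots> > 0" using \<open>\<alpha> \<in> H\<close> finH nz \<open>c > 0\<close> by (intro sum_pos) auto
  finally have "w \<noteq> 0" using linear_0[OF lin_h] by auto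
  then have "0 < w \<bullet> w" by simp
  also have "w \<bullet> w = (\<Sum>p\<in>H \<times> H. (fst p \<bullet> snd p) / (norm (fst p) * norm (snd p)))"
    by (simp add: w_def inner_sum_left inner_sum_right sum.cartesian_product sum_divide_distrib split_def)
      (simp add: inner_commute mult.commute)
  also have "\<dots> \<le> (\<Sum>p\<in>H \<times> H. (if fst p = snd p then 1 else 0) + (if p \<in> P then - 1 / 2 else 0))"
  proof (rule sum_mono)
    fix p assume p: "p \<in> H \<times> H"
    obtain a a' where [simp]: "p = (a, a')" by (cases p)
    have a: "a \<in> H" "a' \<in> H" "norm a > 0" "norm a' > 0" using p nz by auto
    show "(fst p \<bullet> snd p) / (norm (fst p) * norm (snd p))
        \<le> (if fst p = snd p then 1 else 0) + (if p \<in> P then - 1 / 2 else 0)"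
    proof (cases "p \<in> P")
      case True
      then show ?thesis using pairs[of a a'] a by (auto simp: field_simps)
    next
      case False
      show ?thesis
      proof (cases "a = a'")
        case True
        then show ?thesis using False a by (simp add: power2_norm_eq_inner[symmetric] power2_eq_square)
      next
        case ne: False
        then have "a \<bullet> a' \<le> 0" using obtuse[of a a'] a by (auto simp: H_def)
        then show ?thesis using False ne a by (simp add: divide_nonpos_pos)
      qed
    qed
  qed
  also have "\<dots> = real (card H) - card P / 2"
  proof -
    have "(\<Sum>p\<in>H \<times> H. if fst p = snd p then 1 else 0 :: real) = (\<Sum>a\<in>H. \<Sum>a'\<in>H. if a = a' then 1 else 0)"
      by (simp add: sum.cartesian_product split_def)
    also have "\<dots> = card H" using finH by simp
    finally have 1: "(\<Sum>p\<in>H \<times> H. if fst p = snd p then 1 else 0 :: real) = card H" .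
    have "(\<Sum>p\<in>H \<times> H. if p \<in> P then - 1 / 2 else 0 :: real) = (\<Sum>p\<in>P. - 1 / 2)"
      using finH by (subst sum.inter_restrict[symmetric]) (auto simp: P_def Int_absorb1)
    also have "\<dots> = - (card P / 2)" by simp
    finally show ?thesis unfolding sum.distrib 1 by simp
  qed
  finally show False using HleD \<open>2 * card D \<le> card P\<close> by simp
qed

subsection \<open>Rank two subsystems through a root\<close>

locale roots =
  fixes \<Phi> \<Delta> :: "'a::real_inner set"
  assumes rs: "root_system \<Phi>" and sr: "simple_roots \<Phi> \<Delta>"
begin

sublocale based \<Phi> \<Delta>
  by standard (use root_system_crystallographic[OF rs] sr in auto)

lemma span_\<Phi>: "span \<Phi> = UNIV"
  using rs by (simp add: root_system_def)

lemma span_\<Delta>: "span \<Delta> = UNIV"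
proof -
  have "\<Phi> \<subseteq> span \<Delta>"
  proof
    fix a assume "a \<in> \<Phi>"
    then have "a \<in> span \<Delta> \<or> - a \<in> span \<Delta>"
      using pos_or_neg combs_span by (auto simp: positive_roots_def)
    then show "a \<in> span \<Delta>" using span_neg[of "- a" \<Delta>] by auto
  qed
  then have "span \<Phi> \<subseteq> span \<Delta>" by (rule span_minimal) simp
  then show ?thesis using span_\<Phi> by auto
qed

lemma coroot_sum_pos: "x \<bullet> coroot_sum pos = 2 * ht x"
  by (rule coroot_sum_ht) (simp add: span_\<Delta>)

lemma pos_nonzero: "a \<in> pos \<Longrightarrow> a \<noteq> 0"
  using pos_sub crystallographicD(2)[OF crystallographic] by blast

lemma pos_not_multiple:
  assumes "a \<in> pos" "b \<in> pos" "b = c *\<^sub>R a"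
  shows "a = b"
proof -
  have "c = 1 \<or> c = -1" using crystallographicD(4)[OF crystallographic, of a c] assms pos_sub by auto
  moreover have "ht b = c * ht a" using assms(3) linear_scale[OF linear_ht] by simp
  ultimately have "c = 1" using ht_ge_1[OF assms(1)] ht_ge_1[OF assms(2)] by auto
  then show ?thesis using assms(3) by simp
qed

text \<open>The rank two subsystems that contain \<open>b\<close>.\<close>

definition flat :: "'a \<Rightarrow> 'a \<Rightarrow> 'a set" where
  "flat b g = \<Phi> \<inter> span {b, g}"

definition flats :: "'a \<Rightarrow> 'a set set" where
  "flats b = flat b ` (pos - {b})"

lemma flat_eq:
  assumes "b \<in> pos" "g \<in> pos - {b}" "g' \<in> flat b g \<inter> pos - {b}"
  shows "flat b g' = flat b g"
proof -
  obtain x y where xy: "g' = x *\<^sub>R b + y *\<^sub>R g"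
    using assms(3) by (auto simp: flat_def span_insert span_breakdown_eq algebra_simps)
  have "y \<noteq> 0" using xy assms pos_not_multiple[of b g' x] by auto
  then have g: "g = (1 / y) *\<^sub>R g' - (x / y) *\<^sub>R b" by (simp add: xy algebra_simps)
  have "g' \<in> span {b, g}" using assms(3) by (simp add: flat_def)
  moreover have "g \<in> span {b, g'}" unfolding g by (intro span_diff span_scale span_base) auto
  ultimately have "span {b, g'} = span {b, g}"
    by (intro span_eq[THEN iffD2]) (auto intro: span_base)
  then show ?thesis by (simp add: flat_def)
qed

text \<open>A formula that localises the height.  The left hand side is the sum over all positive roots other than \<open>b\<close>, since
  each of them lies in exactly one rank two subsystem with \<open>b\<close>, and half the product of \<open>b\<close> with \<open>2 \<rho>\<^sup>\<or>\<close>
  is the height of \<open>b\<close>.\<close>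

lemma sum_flats:
  assumes "b \<in> pos"
  shows "(\<Sum>\<Psi>\<in>flats b. \<Sum>g\<in>\<Psi> \<inter> pos - {b}. (b \<bullet> g) / (g \<bullet> g)) = ht b - 1"
proof -
  have eq: "{g \<in> pos - {b}. flat b g = \<Psi>} = \<Psi> \<inter> pos - {b}" if "\<Psi> \<in> flats b" for \<Psi>
  proof -
    obtain g0 where g0: "g0 \<in> pos - {b}" "\<Psi> = flat b g0" using \<open>\<Psi> \<in> flats b\<close> unfolding flats_def by blast
    have "g \<in> flat b g" if "g \<in> pos" for g
      using that pos_sub by (auto simp: flat_def intro: span_base)
    then show ?thesis using flat_eq[OF assms g0(1)] g0(2) by blast
  qed
  have "(\<Sum>\<Psi>\<in>flats b. \<Sum>g\<in>{g \<in> pos - {b}. flat b g = \<Psi>}. (b \<bullet> g) / (g \<bullet> g))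
      = (\<Sum>g\<in>pos - {b}. (b \<bullet> g) / (g \<bullet> g))"
    by (rule sum.group) (use fin_pos in \<open>auto simp: flats_def\<close>)
  then have "(\<Sum>\<Psi>\<in>flats b. \<Sum>g\<in>\<Psi> \<inter> pos - {b}. (b \<bullet> g) / (g \<bullet> g))
      = (\<Sum>g\<in>pos - {b}. (b \<bullet> g) / (g \<bullet> g))"
    using eq by simp
  moreover have "2 * (\<Sum>g\<in>pos. (b \<bullet> g) / (g \<bullet> g)) = 2 * ht b"
    unfolding coroot_sum_pos[symmetric] by (simp add: coroot_sum_def inner_sum_right sum_distrib_left)
  moreover have "(\<Sum>g\<in>pos. (b \<bullet> g) / (g \<bullet> g)) = 1 + (\<Sum>g\<in>pos - {b}. (b \<bullet> g) / (g \<bullet> g))"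
    using assms fin_pos pos_nonzero[OF assms] by (simp add: sum.remove[of pos b])
  ultimately show ?thesis by simp
qed

text \<open>The sum belonging to one subsystem is the height of \<open>b\<close> in that subsystem, minus 1.  A lower ideal from which
  only \<open>b\<close> is missing contains all other roots of the subsystem below \<open>b\<close>, and \<open>card_below\<close> counts these.\<close>

lemma flat_count:
  assumes b: "b \<in> pos" and \<Psi>: "\<Psi> \<in> flats b"
  shows "\<exists>m. (\<Sum>g\<in>\<Psi> \<inter> pos - {b}. (b \<bullet> g) / (g \<bullet> g)) = of_nat m \<and>
    (\<forall>I. lower_ideal \<Phi> \<Delta> (insert b I) \<longrightarrow> b \<notin> I \<longrightarrow> m = 0 \<or> m + 1 \<le> card (I \<inter> \<Psi>))"
proof -
  obtain g0 where g0: "g0 \<in> pos - {b}" "\<Psi> = \<Phi> \<inter> span {b, g0}" using \<Psi> by (auto simp: flats_def flat_def)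
  have cr\<Psi>: "crystallographic \<Psi>" unfolding g0(2) by (rule crystallographic_Int_subspace[OF crystallographic]) simp
  define S where "S = {a\<in>\<Psi>. ht a > 0 \<and> \<not> (\<exists>b\<in>\<Psi>. \<exists>c\<in>\<Psi>. ht b > 0 \<and> ht c > 0 \<and> a = b + c)}"
  have nz: "ht a \<noteq> 0" if "a \<in> \<Psi>" for a using that ht_nonzero g0(2) by auto
  note be = base_exists[OF cr\<Psi> linear_ht nz, folded S_def]
  interpret sub: based \<Psi> S by standard (use cr\<Psi> be(1) in auto)
  have pos\<Psi>: "sub.pos = \<Psi> \<inter> pos" using be(2) g0(2) by (auto simp: pos_iff_ht)
  have "b \<in> \<Psi>" using b pos_sub unfolding g0(2) by (auto intro: span_base)
  then have b\<Psi>: "b \<in> sub.pos" using b by (simp add: pos\<Psi>)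
  obtain n where n: "sub.ht b = of_nat n" "n \<ge> 1" using sub.ht_pos[OF b\<Psi>] by blast
  have "b \<bullet> coroot_sum sub.pos = 2 * sub.ht b"
    using b\<Psi> sub.combs_span by (intro sub.coroot_sum_ht) (auto simp: positive_roots_def)
  moreover have "b \<bullet> coroot_sum sub.pos = 2 * (\<Sum>g\<in>sub.pos. (b \<bullet> g) / (g \<bullet> g))"
    by (simp add: coroot_sum_def inner_sum_right sum_distrib_left)
  moreover have "(\<Sum>g\<in>sub.pos. (b \<bullet> g) / (g \<bullet> g)) = 1 + (\<Sum>g\<in>sub.pos - {b}. (b \<bullet> g) / (g \<bullet> g))"
    using b\<Psi> sub.fin_pos pos_nonzero[OF b] by (simp add: sum.remove[of sub.pos b])
  ultimately have val: "(\<Sum>g\<in>\<Psi> \<inter> pos - {b}. (b \<bullet> g) / (g \<bullet> g)) = of_nat (n - 1)"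
    using n by (simp add: pos\<Psi> of_nat_diff)
  have "n - 1 = 0 \<or> n - 1 + 1 \<le> card (I \<inter> \<Psi>)" if I: "lower_ideal \<Phi> \<Delta> (insert b I)" "b \<notin> I" for I
  proof (cases "b \<in> S")
    case True
    then show ?thesis using sub.ht_S[OF True] n by simp
  next
    case False
    have "S \<subseteq> nonneg_combs \<Delta>" using sub.S_pos unfolding pos\<Psi> by (auto simp: positive_roots_def)
    then have le: "root_le \<Delta> g b" if "root_le S g b" for g
      using that nonneg_combs_mono[of S \<Delta>] by (auto simp: root_le_def)
    have "{g\<in>sub.pos. root_le S g b} - {b} \<subseteq> I \<inter> \<Psi>"
    proof
      fix g assume g: "g \<in> {g\<in>sub.pos. root_le S g b} - {b}"
      then have "g \<in> pos" "root_le \<Delta> g b" using le by (auto simp: pos\<Psi>)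
      then have "g \<in> insert b I" using I(1) unfolding lower_ideal_def by blast
      then show "g \<in> I \<inter> \<Psi>" using g by (auto simp: pos\<Psi>)
    qed
    moreover have "finite (I \<inter> \<Psi>)" using sub.fin_\<Psi> by simp
    ultimately have "card ({g\<in>sub.pos. root_le S g b} - {b}) \<le> card (I \<inter> \<Psi>)" by (rule card_mono[rotated])
    moreover have "b \<in> {g\<in>sub.pos. root_le S g b}" using b\<Psi> by (auto simp: root_le_def nonneg_combs_0)
    ultimately have "card {g\<in>sub.pos. root_le S g b} - 1 \<le> card (I \<inter> \<Psi>)" by simp
    moreover have "real (card {g\<in>sub.pos. root_le S g b}) \<ge> n + 1" using sub.card_below[OF b\<Psi>] False n by simp
    ultimately show ?thesis by linarith
  qed
  then show ?thesis using val by blast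
qed

definition flat_mult :: "'a \<Rightarrow> 'a set \<Rightarrow> nat" where
  "flat_mult b \<Psi> = (THE m. (\<Sum>g\<in>\<Psi> \<inter> pos - {b}. (b \<bullet> g) / (g \<bullet> g)) = of_nat m)"

lemma flat_mult:
  assumes "b \<in> pos" "\<Psi> \<in> flats b"
  shows "(\<Sum>g\<in>\<Psi> \<inter> pos - {b}. (b \<bullet> g) / (g \<bullet> g)) = of_nat (flat_mult b \<Psi>)"
    and "lower_ideal \<Phi> \<Delta> (insert b I) \<Longrightarrow> b \<notin> I \<Longrightarrow> flat_mult b \<Psi> = 0 \<or> flat_mult b \<Psi> + 1 \<le> card (I \<inter> \<Psi>)"
proof -
  obtain m where m: "(\<Sum>g\<in>\<Psi> \<inter> pos - {b}. (b \<bullet> g) / (g \<bullet> g)) = of_nat m"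
    "\<forall>I. lower_ideal \<Phi> \<Delta> (insert b I) \<longrightarrow> b \<notin> I \<longrightarrow> m = 0 \<or> m + 1 \<le> card (I \<inter> \<Psi>)"
    using flat_count[OF assms] by blast
  have "flat_mult b \<Psi> = m" unfolding flat_mult_def m(1) by (rule the_equality) auto
  then show "(\<Sum>g\<in>\<Psi> \<inter> pos - {b}. (b \<bullet> g) / (g \<bullet> g)) = of_nat (flat_mult b \<Psi>)"
    "lower_ideal \<Phi> \<Delta> (insert b I) \<Longrightarrow> b \<notin> I \<Longrightarrow> flat_mult b \<Psi> = 0 \<or> flat_mult b \<Psi> + 1 \<le> card (I \<inter> \<Psi>)"
    using m by blast+
qed

lemma sum_flat_mult: "b \<in> pos \<Longrightarrow> ht b = 1 + of_nat (\<Sum>\<Psi>\<in>flats b. flat_mult b \<Psi>)"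
  using sum_flats[of b] flat_mult(1)[of b] by simp

end

text \<open>On a line through a point that avoids the earlier hyperplanes, in a direction \<open>u\<close> transversal to the next one, only
  finitely many points are excluded.\<close>

lemma avoid_hyperplanes:
  fixes V :: "'a::real_inner set"
  assumes "finite L" "subspace V" "\<And>a. a \<in> L \<Longrightarrow> \<exists>u\<in>V. a \<bullet> u \<noteq> 0"
  shows "\<exists>x\<in>V. \<forall>a\<in>L. a \<bullet> x \<noteq> 0"
  using assms(1,3)
proof (induction rule: finite_induct)
  case empty then show ?case using assms(2) by (auto intro: subspace_0)
next
  case (insert a L)
  then obtain x where x: "x \<in> V" "\<And>c. c \<in> L \<Longrightarrow> c \<bullet> x \<noteq> 0" by blast
  obtain u where u: "u \<in> V" "a \<bullet> u \<noteq> 0" using insert.prems by blast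
  define bad where "bad = (\<lambda>c. - (c \<bullet> x) / (c \<bullet> u)) ` insert a L"
  have "finite bad" using insert.hyps by (simp add: bad_def)
  then obtain t where t: "t \<notin> insert 0 bad" by (meson finite_insert ex_new_if_finite infinite_UNIV_char_0)
  have "c \<bullet> (x + t *\<^sub>R u) \<noteq> 0" if c: "c \<in> insert a L" for c
  proof (cases "c \<bullet> u = 0")
    case True
    then show ?thesis using c u x by (auto simp: inner_add_right)
  next
    case False
    show ?thesis
    proof
      assume "c \<bullet> (x + t *\<^sub>R u) = 0"
      then have "t = - (c \<bullet> x) / (c \<bullet> u)" using False by (simp add: inner_add_right field_simps)
      then show False using t c by (auto simp: bad_def)
    qed
  qed
  moreover have "x + t *\<^sub>R u \<in> V" using x u assms(2) by (auto intro: subspace_add subspace_scale)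
  ultimately show ?case by blast
qed

lemma orthogonal_witness:
  fixes a :: "'a::real_inner"
  assumes "finite B" "a \<notin> span B"
  shows "\<exists>u. (\<forall>b\<in>B. b \<bullet> u = 0) \<and> a \<bullet> u \<noteq> 0"
proof -
  obtain F where F: "finite F" "span F = span B" "\<And>e f. e \<in> F \<Longrightarrow> f \<in> F \<Longrightarrow> e \<bullet> f = (if e = f then 1 else 0)"
    using orthonormal_spanning_set[OF assms(1)] by blast
  define p where "p = (\<Sum>e\<in>F. (e \<bullet> a) *\<^sub>R e)"
  have p: "p \<in> span F" unfolding p_def by (intro span_sum span_scale span_base)
  have fo: "f \<bullet> (a - p) = 0" if f: "f \<in> F" for f
  proof -
    have "f \<bullet> p = (\<Sum>e\<in>F. (e \<bullet> a) * (if f = e then 1 else 0))"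
      using f by (auto simp: p_def inner_sum_right F(3) intro!: sum.cong)
    also have "\<dots> = f \<bullet> a" using f F(1) by (simp add: mult_delta_right)
    finally show ?thesis by (simp add: inner_diff_right)
  qed
  have orth: "y \<bullet> (a - p) = 0" if "y \<in> span F" for y
    using that by (induction rule: span_induct_alt) (simp_all add: inner_add_left fo)
  have "a \<noteq> p" using p assms(2) F(2) by auto
  moreover have "a \<bullet> (a - p) = (a - p) \<bullet> (a - p)" using orth[OF p] by (simp add: inner_diff_left)
  ultimately have "a \<bullet> (a - p) \<noteq> 0" by simp
  moreover have "\<forall>b\<in>B. b \<bullet> (a - p) = 0" using orth F(2) span_base by blast
  ultimately show ?thesis by blast
qed

lemma (in module) span_image_sum:
  assumes "finite A" "x \<in> span (v ` A)"
  shows "\<exists>r. x = (\<Sum>e\<in>A. scale (r e) (v e))"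
  using assms(2)
proof (induction rule: span_induct_alt)
  case base show ?case by (rule exI[of _ "\<lambda>_. 0"]) simp
next
  case (step c y z)
  then obtain r e0 where r: "z = (\<Sum>e\<in>A. scale (r e) (v e))" "e0 \<in> A" "y = v e0" by blast
  have "(\<Sum>e\<in>A. scale (r e + (if e = e0 then c else 0)) (v e)) = z + (\<Sum>e\<in>A. if e = e0 then scale c (v e) else 0)"
    unfolding r(1) sum.distrib[symmetric] by (intro sum.cong) (auto simp: scale_left_distrib)
  also have "\<dots> = scale c y + z" using r assms(1) by (simp add: add.commute)
  finally have "scale c y + z = (\<Sum>e\<in>A. scale (r e + (if e = e0 then c else 0)) (v e))" ..
  then show ?case by (rule exI[of _ "\<lambda>e. r e + (if e = e0 then c else 0)"])
qed

context frame
begin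

text \<open>The family is indexed by \<open>E\<close>, so it has as many members as the dimension; since \<open>D(I)\<close> contains multiples
  of all constant fields, such a family is automatically linearly independent (\<open>free_basis_indep\<close>).\<close>

definition free_basis :: "('a \<Rightarrow> 'a vf) \<Rightarrow> ('a \<Rightarrow> nat) \<Rightarrow> 'a set \<Rightarrow> bool" where
  "free_basis v d I \<longleftrightarrow> (\<forall>e\<in>E. homogv (d e) (v e)) \<and> vf.span (v ` E) = logder I"

lemma free_basis_mem: "free_basis v d I \<Longrightarrow> e \<in> E \<Longrightarrow> v e \<in> logder I"
  by (auto simp: free_basis_def intro: vf.span_base)

lemma free_basis_rep: "free_basis v d I \<Longrightarrow> a \<in> logder I \<Longrightarrow> \<exists>r. a = (\<Sum>e\<in>E. r e \<odot> v e)"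
  unfolding free_basis_def using vf.span_image_sum[OF fin_E, of a v] by blast

lemma free_basis_rep_homog:
  assumes "free_basis v d I" "a \<in> logder I" "homogv n a"
  shows "\<exists>r. a = (\<Sum>e\<in>E. r e \<odot> v e) \<and> (\<forall>e. if n < d e then r e = 0 else homog (n - d e) (r e))"
proof -
  obtain r where r: "a = (\<Sum>e\<in>E. r e \<odot> v e)" using free_basis_rep assms by blast
  define s where "s e = (if n < d e then 0 else hcomp (n - d e) (r e))" for e
  have "a = vcomp n a" using assms(3) by (simp add: vcomp_homogv)
  also have "\<dots> = (\<Sum>e\<in>E. vcomp n (r e \<odot> v e))" by (subst r) simp
  also have "\<dots> = (\<Sum>e\<in>E. s e \<odot> v e)"
    using assms(1) by (intro sum.cong refl) (auto simp: free_basis_def s_def vcomp_smul_homogv)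
  finally show ?thesis by (intro exI[of _ s]) (auto simp: s_def)
qed

lemma prod_smul_logder:
  assumes "finite I"
  shows "(\<Prod>a\<in>I. lin a) \<odot> b \<in> logder I"
  using assms by (auto simp: logder_def intro!: dvd_mult2 dvd_prodI)

text \<open>Multiplying a constant field by the product of the forms in \<open>I\<close> makes it tangent to the hyperplanes, and the product
  is nonzero at \<open>x\<close>.\<close>

lemma free_basis_spans_at:
  assumes "free_basis v d I" "finite I" "\<And>a. a \<in> I \<Longrightarrow> a \<bullet> x \<noteq> 0"
  shows "\<exists>t. w = (\<Sum>e\<in>E. t e *\<^sub>R vev (v e) x)"
proof -
  define q where "q = (\<Prod>a\<in>I. a \<bullet> x)"
  have q: "q \<noteq> 0" using assms(2,3) by (simp add: q_def)
  obtain r where r: "(\<Prod>a\<in>I. lin a) \<odot> const_vf w = (\<Sum>e\<in>E. r e \<odot> v e)"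
    using free_basis_rep[OF assms(1) prod_smul_logder[OF assms(2)]] by blast
  have "q *\<^sub>R w = vev ((\<Prod>a\<in>I. lin a) \<odot> const_vf w) x" by (simp add: q_def)
  also have "\<dots> = (\<Sum>e\<in>E. ev (r e) x *\<^sub>R vev (v e) x)" unfolding r by simp
  finally have "(1 / q) *\<^sub>R (q *\<^sub>R w) = (\<Sum>e\<in>E. (ev (r e) x / q) *\<^sub>R vev (v e) x)"
    by (simp add: scaleR_sum_right)
  then have "w = (\<Sum>e\<in>E. (ev (r e) x / q) *\<^sub>R vev (v e) x)" using q by simp
  then show ?thesis by (rule exI[of _ "\<lambda>e. ev (r e) x / q"])
qed

text \<open>If \<open>r e0\<close> were nonzero, then at a point where it does not vanish and the fields span, one of \<open>n\<close> vectors
  spanning the \<open>n\<close>-dimensional space would be a combination of the others.\<close>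

lemma indep_family:
  fixes v :: "'a \<Rightarrow> 'a vf"
  assumes F: "F \<noteq> 0" "\<And>x w. ev F x \<noteq> 0 \<Longrightarrow> \<exists>t. w = (\<Sum>e\<in>E. t e *\<^sub>R vev (v e) x)"
    and r: "(\<Sum>e\<in>E. r e \<odot> v e) = 0" and e0: "e0 \<in> E"
  shows "r e0 = 0"
proof -
  have "ev (r e0 * F) x = 0" for x
  proof (rule ccontr)
    assume "ev (r e0 * F) x \<noteq> 0"
    then have nz: "ev (r e0) x \<noteq> 0" "ev F x \<noteq> 0" by auto
    define T where "T = (\<lambda>e. vev (v e) x) ` (E - {e0})"
    have "vev (\<Sum>e\<in>E. r e \<odot> v e) x = 0" by (simp add: r)
    then have "ev (r e0) x *\<^sub>R vev (v e0) x = - (\<Sum>e\<in>E - {e0}. ev (r e) x *\<^sub>R vev (v e) x)"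
      using e0 fin_E by (simp add: sum.remove[of E e0] eq_neg_iff_add_eq_0)
    also have "\<dots> \<in> span T"
      by (intro span_neg span_sum span_scale span_base) (auto simp: T_def)
    finally have "(1 / ev (r e0) x) *\<^sub>R (ev (r e0) x *\<^sub>R vev (v e0) x) \<in> span T" by (rule span_scale)
    then have e0T: "vev (v e0) x \<in> span T" using nz by simp
    have vT: "vev (v e) x \<in> span T" if "e \<in> E" for e
      using that e0T by (cases "e = e0") (auto simp: T_def intro: span_base)
    have "E \<subseteq> span T"
    proof
      fix w assume "w \<in> E"
      obtain t where "w = (\<Sum>e\<in>E. t e *\<^sub>R vev (v e) x)" using F(2)[OF nz(2)] by blast
      then show "w \<in> span T" using vT by (auto intro!: span_sum span_scale)
    qed
    moreover have finT: "finite T" using fin_E by (simp add: T_def)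
    ultimately have "card E \<le> card T" using independent_span_bound[OF _ indep_E] by blast
    also have "card T \<le> card (E - {e0})" unfolding T_def using fin_E by (intro card_image_le) auto
    also have "\<dots> < card E" using e0 fin_E by (intro card_Diff1_less) auto
    finally show False by simp
  qed
  then have "r e0 * F = 0" by (intro rpoly_eqI) simp
  then show ?thesis using F(1) by simp
qed

lemma free_basis_indep:
  assumes "free_basis v d I" "finite I" "0 \<notin> I" "(\<Sum>e\<in>E. r e \<odot> v e) = 0" "e \<in> E"
  shows "r e = 0"
proof (rule indep_family[OF _ _ assms(4,5)])
  show "(\<Prod>a\<in>I. lin a) \<noteq> 0" using assms(2,3) by auto
  show "\<exists>t. w = (\<Sum>e\<in>E. t e *\<^sub>R vev (v e) x)" if "ev (\<Prod>a\<in>I. lin a) x \<noteq> 0" for x w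
    by (rule free_basis_spans_at[OF assms(1,2)]) (use that assms(2) in auto)
qed

lemma free_basis_empty: "free_basis const_vf (\<lambda>_. 0) {}"
proof -
  have "(\<Sum>e\<in>E. coord e a \<odot> const_vf e) \<in> vf.span (const_vf ` E)" for a
    by (intro vf.span_sum vf.span_scale vf.span_base imageI)
  then have "a \<in> vf.span (const_vf ` E)" for a using vf_expand[of a] by metis
  then show ?thesis by (auto simp: free_basis_def logder_def)
qed

end

section \<open>Bases of logarithmic derivations for lower ideals\<close>

locale roots_frame = roots \<Phi> \<Delta> + frame E for \<Phi> \<Delta> E :: "'a::real_inner set"
begin

abbreviation lower :: "'a set \<Rightarrow> bool" where "lower \<equiv> lower_ideal \<Phi> \<Delta>"

lemma lower_pos: "lower I \<Longrightarrow> I \<subseteq> pos"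
  by (simp add: lower_ideal_def)

lemma lower_fin: "lower I \<Longrightarrow> finite I"
  using lower_pos fin_pos finite_subset by blast

lemma root_le_ht: "root_le \<Delta> a b \<Longrightarrow> ht a \<le> ht b" "root_le \<Delta> a b \<Longrightarrow> ht a = ht b \<Longrightarrow> a = b"
proof -
  assume "root_le \<Delta> a b"
  then have *: "b - a \<in> nonneg_combs \<Delta>" by (simp add: root_le_def)
  show "ht a \<le> ht b" using ht_combs[OF *] by (auto simp: linear_diff[OF linear_ht])
  show "a = b" if "ht a = ht b" using combs_ht_0[OF *] that by (simp add: linear_diff[OF linear_ht])
qed

text \<open>The number \<open>ht b - 1\<close>, in a form that makes it evidently a natural number and the degree of \<open>add_poly b\<close>.\<close>

definition pred_ht :: "'a \<Rightarrow> nat" where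
  "pred_ht b = (\<Sum>\<Psi>\<in>flats b. flat_mult b \<Psi>)"

lemma ht_pred_ht: "b \<in> pos \<Longrightarrow> ht b = 1 + of_nat (pred_ht b)"
  by (simp add: pred_ht_def sum_flat_mult del: of_nat_sum)

lemma lower_truncate: "lower I \<Longrightarrow> lower {g\<in>I. pred_ht g < k}"
  unfolding lower_ideal_def
proof (intro conjI ballI impI)
  fix a b assume *: "I \<subseteq> pos \<and> (\<forall>a\<in>pos. \<forall>b\<in>I. root_le \<Delta> a b \<longrightarrow> a \<in> I)" "a \<in> pos"
    "b \<in> {g \<in> I. pred_ht g < k}" "root_le \<Delta> a b"
  then have "ht a \<le> ht b" "b \<in> pos" using root_le_ht by auto
  then have "pred_ht a \<le> pred_ht b" using ht_pred_ht[of a] ht_pred_ht[of b] *(2) by simp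
  then show "a \<in> {g \<in> I. pred_ht g < k}" using * by auto
qed auto

lemma lower_insert:
  assumes "lower I" "b \<in> pos" "\<And>a. a \<in> pos \<Longrightarrow> a \<notin> I \<Longrightarrow> root_le \<Delta> a b \<Longrightarrow> a = b"
  shows "lower (insert b I)"
  using assms unfolding lower_ideal_def by auto

lemma lower_pos_self: "lower pos"
  by (auto simp: lower_ideal_def)

lemma lower_insert_min:
  assumes "lower I" "b \<in> pos" "\<And>a. a \<in> pos \<Longrightarrow> a \<notin> I \<Longrightarrow> pred_ht b \<le> pred_ht a"
  shows "lower (insert b I)"
proof (rule lower_insert[OF assms(1,2)])
  fix a assume a: "a \<in> pos" "a \<notin> I" "root_le \<Delta> a b"
  then have "ht b \<le> ht a" using assms(3)[of a] ht_pred_ht[of a] ht_pred_ht[OF assms(2)] by simp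
  then show "a = b" using root_le_ht a(3) by (metis order_antisym)
qed

lemma lower_remove_max:
  assumes "lower J" "b \<in> J" "\<And>a. a \<in> J \<Longrightarrow> pred_ht a \<le> pred_ht b"
  shows "lower (J - {b})"
  unfolding lower_ideal_def
proof (intro conjI ballI impI)
  show "J - {b} \<subseteq> pos" using lower_pos assms by auto
  fix a c assume ac: "a \<in> pos" "c \<in> J - {b}" "root_le \<Delta> a c"
  then have "a \<in> J" using assms(1) by (auto simp: lower_ideal_def)
  moreover have "a \<noteq> b"
  proof
    assume "a = b"
    then have "ht c \<le> ht a" using assms(3)[of c] ac lower_pos[OF assms(1)] assms(2) ht_pred_ht[of c] ht_pred_ht[of b] by auto
    then have "a = c" using root_le_ht ac(3) by (metis order_antisym)
    then show False using \<open>a = b\<close> ac by simp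
  qed
  ultimately show "a \<in> J - {b}" by simp
qed

subsection \<open>The polynomial governing the addition of a root\<close>

text \<open>An arbitrary choice: restricted to \<open>ker b\<close>, the roots of a plane through \<open>b\<close> are proportional.\<close>

definition flat_rep :: "'a \<Rightarrow> 'a set \<Rightarrow> 'a" where
  "flat_rep b \<Psi> = (SOME g. g \<in> pos - {b} \<and> flat b g = \<Psi>)"

lemma flat_rep:
  assumes "\<Psi> \<in> flats b"
  shows "flat_rep b \<Psi> \<in> pos - {b}" "flat b (flat_rep b \<Psi>) = \<Psi>"
proof -
  have "\<exists>g. g \<in> pos - {b} \<and> flat b g = \<Psi>" using assms by (auto simp: flats_def)
  from someI_ex[OF this] show "flat_rep b \<Psi> \<in> pos - {b}" "flat b (flat_rep b \<Psi>) = \<Psi>"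
    unfolding flat_rep_def by auto
qed

text \<open>The polynomial on \<open>ker b\<close> (extended by composition with the projection) that divides the restriction of
  \<open>\<theta>(b)\<close> for every \<open>\<theta> \<in> D(I)\<close>.\<close>

definition add_poly :: "'a \<Rightarrow> 'a rpoly" where
  "add_poly b = (\<Prod>\<Psi>\<in>flats b. lin (hproj b (flat_rep b \<Psi>)) ^ flat_mult b \<Psi>)"

lemma fin_flats: "finite (flats b)"
  using fin_pos by (simp add: flats_def)

lemma hproj_nonzero: "b \<in> pos \<Longrightarrow> g \<in> pos - {b} \<Longrightarrow> hproj b g \<noteq> 0"
  using pos_not_multiple[of b g "(b \<bullet> g) / (b \<bullet> b)"] by (auto simp: hproj_def)

lemma add_poly_nonzero: "b \<in> pos \<Longrightarrow> add_poly b \<noteq> 0"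
  using fin_flats flat_rep hproj_nonzero by (auto simp: add_poly_def)

lemma homog_add_poly: "homog (pred_ht b) (add_poly b)"
  unfolding add_poly_def pred_ht_def using homog_power[OF homog_simps(4)] by (intro homog_prod) simp

lemma hproj_hproj: "hproj b (hproj b x) = hproj b x"
  by (rule hproj_id) (simp add: inner_hproj)

lemma res_add_poly: "res b (add_poly b) = add_poly b"
  by (simp add: add_poly_def res_prod res_power res_lin hproj_hproj)

lemma flat_member:
  assumes "b \<in> pos" "g \<in> pos - {b}" "c \<in> flat b g \<inter> pos - {b}"
  shows "\<exists>x y. c = x *\<^sub>R b + y *\<^sub>R g \<and> y \<noteq> 0"
proof -
  obtain x y where xy: "c = x *\<^sub>R b + y *\<^sub>R g"
    using assms(3) by (auto simp: flat_def span_insert span_breakdown_eq algebra_simps)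
  moreover have "y \<noteq> 0" using xy assms pos_not_multiple[of b c x] by auto
  ultimately show ?thesis by blast
qed

lemma lin_not_dvd: "a \<in> pos \<Longrightarrow> b \<in> pos \<Longrightarrow> a \<noteq> b \<Longrightarrow> \<not> lin a dvd lin b"
  using lin_dvd_lin[of a b] pos_not_multiple[of a b] by auto

text \<open>With \<open>q = \<theta>(b)\<close> and \<open>p = \<theta>(u)\<close> the polynomial \<open>q u - p b\<close> is, up to scalars, \<open>q c - \<theta>(c) b\<close> for every root
  \<open>c\<close> in the plane of \<open>b\<close> and \<open>u\<close>.  Hence it is divisible by all those \<open>c\<close> that belong to \<open>I\<close>.  After
  restriction to \<open>ker b\<close> all of these are multiples of \<open>u\<close>, and \<open>q u\<close> is divisible by a power of \<open>u\<close> whose exponent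
  is the number of these \<open>c\<close>, which exceeds \<open>flat_mult b \<Psi>\<close>.\<close>

lemma flat_power_dvd:
  assumes J: "lower (insert b I)" "b \<notin> I" "b \<in> pos" and \<theta>: "\<theta> \<in> logder I" and \<Psi>: "\<Psi> \<in> flats b"
  shows "lin (hproj b (flat_rep b \<Psi>)) ^ flat_mult b \<Psi> dvd res b (coord b \<theta>)"
proof (cases "flat_mult b \<Psi> = 0")
  case False
  define u where "u = flat_rep b \<Psi>"
  define q where "q = coord b \<theta>"
  define F where "F = q * lin u - coord u \<theta> * lin b"
  have u: "u \<in> pos - {b}" "flat b u = \<Psi>" using flat_rep[OF \<Psi>] by (simp_all add: u_def)
  have I: "I \<subseteq> pos" using lower_pos[OF J(1)] by auto
  have "\<forall>c\<in>I \<inter> \<Psi>. \<exists>y. y \<noteq> 0 \<and> lin (hproj b c) = cst y * lin (hproj b u) \<and> lin c dvd F"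
  proof
    fix c assume c: "c \<in> I \<inter> \<Psi>"
    then obtain x y where xy: "c = x *\<^sub>R b + y *\<^sub>R u" "y \<noteq> 0"
      using flat_member[OF J(3) u(1)] u(2) J(2) I by blast
    have "cst y * F = q * lin c - lin b * coord c \<theta>"
      by (rule rpoly_eqI) (simp add: F_def q_def xy inner_add_left algebra_simps)
    then have "lin c dvd cst y * F" using logder_dvd[OF \<theta>, of c] c by auto
    then have "lin c dvd cst (1 / y) * (cst y * F)" by (rule dvd_mult)
    then have "lin c dvd F" by (simp add: mult.assoc[symmetric] cst_inverse(2)[OF xy(2)])
    moreover have "lin (hproj b c) = cst y * lin (hproj b u)"
      unfolding xy(1) by (rule rpoly_eqI) (simp add: inner_hproj[symmetric] inner_add_left inner_hproj(1))
    ultimately show "\<exists>y. y \<noteq> 0 \<and> lin (hproj b c) = cst y * lin (hproj b u) \<and> lin c dvd F" using xy(2) by blast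
  qed
  then obtain y where y: "\<And>c. c \<in> I \<inter> \<Psi> \<Longrightarrow> y c \<noteq> 0"
    "\<And>c. c \<in> I \<inter> \<Psi> \<Longrightarrow> lin (hproj b c) = cst (y c) * lin (hproj b u)" "\<And>c. c \<in> I \<inter> \<Psi> \<Longrightarrow> lin c dvd F"
    by (auto dest!: bchoice)
  have fin: "finite (I \<inter> \<Psi>)" using I fin_pos finite_subset by blast
  have "(\<Prod>c\<in>I \<inter> \<Psi>. lin c ^ 1) dvd F"
  proof (rule prod_lin_power_dvd[OF fin])
    show "lin c ^ 1 dvd F" if "c \<in> I \<inter> \<Psi>" for c using y(3)[OF that] by simp
    show "c \<noteq> 0" if "c \<in> I \<inter> \<Psi>" for c using pos_nonzero that I by blast
    show "\<not> lin c dvd lin c'" if "c \<in> I \<inter> \<Psi>" "c' \<in> I \<inter> \<Psi>" "c \<noteq> c'" for c c'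
      using lin_not_dvd that I by blast
  qed
  then obtain k where "F = (\<Prod>c\<in>I \<inter> \<Psi>. lin c) * k" by (auto elim: dvdE)
  then have "res b F = (\<Prod>c\<in>I \<inter> \<Psi>. lin (hproj b c)) * res b k" by (simp add: res_simps res_prod res_lin)
  also have "(\<Prod>c\<in>I \<inter> \<Psi>. lin (hproj b c)) = (\<Prod>c\<in>I \<inter> \<Psi>. cst (y c)) * lin (hproj b u) ^ card (I \<inter> \<Psi>)"
    using y(2) by (simp add: prod.distrib)
  finally have "lin (hproj b u) ^ card (I \<inter> \<Psi>) dvd res b F" by simp
  moreover have "res b F = res b q * lin (hproj b u)"
    by (simp add: F_def res_simps res_lin lin_simps)
  moreover have "flat_mult b \<Psi> + 1 \<le> card (I \<inter> \<Psi>)" using flat_mult(2)[OF J(3) \<Psi> J(1,2)] False by simp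
  then have "lin (hproj b u) ^ Suc (flat_mult b \<Psi>) dvd lin (hproj b u) ^ card (I \<inter> \<Psi>)"
    by (intro le_imp_power_dvd) simp
  ultimately have "lin (hproj b u) ^ Suc (flat_mult b \<Psi>) dvd lin (hproj b u) * res b q"
    by (metis dvd_trans mult.commute)
  moreover have "lin (hproj b u) \<noteq> 0" using hproj_nonzero[OF J(3) u(1)] by simp
  ultimately show ?thesis unfolding power_Suc dvd_mult_cancel_left u_def q_def by blast
qed simp

lemma add_poly_dvd:
  assumes J: "lower (insert b I)" "b \<notin> I" "b \<in> pos" and \<theta>: "\<theta> \<in> logder I"
  shows "add_poly b dvd res b (coord b \<theta>)"
  unfolding add_poly_def
proof (rule prod_lin_power_dvd[OF fin_flats])
  fix \<Psi> assume \<Psi>: "\<Psi> \<in> flats b"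
  show "lin (hproj b (flat_rep b \<Psi>)) ^ flat_mult b \<Psi> dvd res b (coord b \<theta>)" by (rule flat_power_dvd[OF assms \<Psi>])
  show "hproj b (flat_rep b \<Psi>) \<noteq> 0" using hproj_nonzero[OF J(3)] flat_rep[OF \<Psi>] by blast
  fix \<Psi>' assume \<Psi>': "\<Psi>' \<in> flats b" "\<Psi> \<noteq> \<Psi>'"
  show "\<not> lin (hproj b (flat_rep b \<Psi>)) dvd lin (hproj b (flat_rep b \<Psi>'))"
  proof
    define g where "g = flat_rep b \<Psi>"
    define g' where "g' = flat_rep b \<Psi>'"
    assume "lin (hproj b (flat_rep b \<Psi>)) dvd lin (hproj b (flat_rep b \<Psi>'))"
    then obtain c where c: "hproj b g' = c *\<^sub>R hproj b g" using lin_dvd_lin unfolding g_def g'_def by blast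
    define s where "s = (b \<bullet> g') / (b \<bullet> b) - c * ((b \<bullet> g) / (b \<bullet> b))"
    have "g' = s *\<^sub>R b + c *\<^sub>R g"
      using c by (simp add: hproj_def s_def algebra_simps)
    then have "g' \<in> span {b, g}" by (metis insertCI span_add span_base span_scale)
    moreover have "g' \<in> pos - {b}" "g \<in> pos - {b}" using flat_rep \<Psi> \<Psi>' by (auto simp: g_def g'_def)
    ultimately have "g' \<in> flat b g \<inter> pos - {b}" using pos_sub by (auto simp: flat_def)
    then have "flat b g' = flat b g" using flat_eq[OF J(3)] \<open>g \<in> pos - {b}\<close> by blast
    then show False using flat_rep \<Psi> \<Psi>' by (auto simp: g_def g'_def)
  qed
qed

text \<open>Degrees: a field in \<open>D(I)\<close> of degree less than \<open>ht b - 1\<close> is tangent to \<open>ker b\<close>, and for degree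
  \<open>ht b - 1\<close> the quotient \<open>q\<close> is a constant.\<close>

lemma add_poly_quotient:
  assumes J: "lower (insert b I)" "b \<notin> I" "b \<in> pos" and \<theta>: "\<theta> \<in> logder I" "homogv d \<theta>"
  shows "\<exists>q. res b (coord b \<theta>) = add_poly b * q \<and> res b q = q \<and>
           (if d < pred_ht b then q = 0 else homog (d - pred_ht b) q)"
proof -
  obtain p where p: "res b (coord b \<theta>) = add_poly b * p" using add_poly_dvd[OF J \<theta>(1)] by (rule dvdE)
  define q where "q = (if d < pred_ht b then 0 else hcomp (d - pred_ht b) (res b p))"
  have "res b (coord b \<theta>) = res b (res b (coord b \<theta>))" by (rule rpoly_eqI) (simp add: hproj_hproj)
  also have "\<dots> = add_poly b * res b p" unfolding p by (simp add: res_simps res_add_poly)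
  finally have *: "res b (coord b \<theta>) = add_poly b * res b p" .
  have "res b (coord b \<theta>) = hcomp d (res b (coord b \<theta>))"
    using hcomp_homog[OF homog_res[OF homogv_coord[OF \<theta>(2)]], of d b b] by simp
  also have "\<dots> = add_poly b * q" unfolding * by (simp add: q_def hcomp_mult_homog[OF homog_add_poly])
  finally have "res b (coord b \<theta>) = add_poly b * q" .
  moreover have "res b (hcomp n (res b p)) = hcomp n (res b p)" for n
  proof -
    have "res b (res b p) = res b p" by (rule rpoly_eqI) (simp add: hproj_hproj)
    then show ?thesis by (simp add: hcomp_res[symmetric])
  qed
  then have "res b q = q" by (auto simp: q_def res_simps)
  ultimately show ?thesis by (intro exI[of _ q]) (auto simp: q_def)
qed

text \<open>One field serves all lower ideals that do not contain \<open>b\<close>.\<close>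

definition adding_derivation :: "'a \<Rightarrow> 'a vf \<Rightarrow> bool" where
  "adding_derivation b \<phi> \<longleftrightarrow> homogv (pred_ht b) \<phi> \<and> (\<forall>I. lower I \<longrightarrow> b \<notin> I \<longrightarrow> \<phi> \<in> logder I) \<and> \<not> lin b dvd coord b \<phi>"

text \<open>A field \<open>\<theta> \<in> D(I)\<close> is tangent to \<open>ker b\<close> if the quotient of the restricted \<open>\<theta>(b)\<close> by \<open>add_poly b\<close> vanishes.
  For \<open>\<phi>\<close> the quotient is a nonzero constant.  Comparing constant terms in the expansion of \<open>\<phi>\<close> shows that a basis field \<open>v n\<close>
  of the same degree enters with a nonzero scalar, so \<open>\<phi>\<close> can take its place.  Subtracting multiples of \<open>\<phi>\<close>
  makes the other basis fields tangent to \<open>ker b\<close>, and then the tangent fields are those whose coefficient at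
  \<open>\<phi>\<close> is divisible by \<open>b\<close>.\<close>

lemma exchange:
  assumes I: "lower I" and J: "lower (insert b I)" "b \<notin> I" and \<phi>: "adding_derivation b \<phi>" and v: "free_basis v d I"
  shows "\<exists>w n. n \<in> E \<and> w n = \<phi> \<and> d n = pred_ht b \<and> free_basis w d I \<and>
           free_basis (w(n := lin b \<odot> \<phi>)) (d(n := Suc (pred_ht b))) (insert b I)"
proof -
  have b: "b \<in> pos" using lower_pos[OF J(1)] by auto
  have \<phi>I: "\<phi> \<in> logder I" and \<phi>h: "homogv (pred_ht b) \<phi>" and \<phi>b: "\<not> lin b dvd coord b \<phi>"
    using \<phi> I J(2) by (auto simp: adding_derivation_def)
  obtain q0 where q0: "res b (coord b \<phi>) = add_poly b * q0" "homog 0 q0"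
    using add_poly_quotient[OF J b \<phi>I \<phi>h] by auto
  define c where "c = ev q0 0"
  have resphi: "res b (coord b \<phi>) = add_poly b * cst c" using q0 by (simp add: homog_0_iff c_def)
  have c: "c \<noteq> 0" using \<phi>b resphi by (auto simp: lin_dvd_iff cst_simps)
  have "\<forall>e\<in>E. \<exists>q. res b (coord b (v e)) = add_poly b * q \<and> res b q = q \<and>
           (if d e < pred_ht b then q = 0 else homog (d e - pred_ht b) q)"
    using add_poly_quotient[OF J b free_basis_mem[OF v]] v by (auto simp: free_basis_def)
  then obtain q where q: "\<And>e. e \<in> E \<Longrightarrow> res b (coord b (v e)) = add_poly b * q e"
    "\<And>e. e \<in> E \<Longrightarrow> res b (q e) = q e"
    "\<And>e. e \<in> E \<Longrightarrow> (if d e < pred_ht b then q e = 0 else homog (d e - pred_ht b) (q e))"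
    by (auto dest!: bchoice)
  obtain r where r: "\<phi> = (\<Sum>e\<in>E. r e \<odot> v e)"
    "\<And>e. if pred_ht b < d e then r e = 0 else homog (pred_ht b - d e) (r e)"
    using free_basis_rep_homog[OF v \<phi>I \<phi>h] by blast
  have "add_poly b * cst c = res b (coord b (\<Sum>e\<in>E. r e \<odot> v e))" using resphi r(1) by simp
  also have "\<dots> = add_poly b * (\<Sum>e\<in>E. res b (r e) * q e)"
    by (simp add: res_sum res_simps q(1) sum_distrib_left ac_simps)
  finally have "cst c = (\<Sum>e\<in>E. res b (r e) * q e)" using add_poly_nonzero[OF b] by simp
  then have "ev (cst c :: 'a rpoly) 0 = ev (\<Sum>e\<in>E. res b (r e) * q e) 0" by (rule arg_cong[where f = "\<lambda>p. ev p 0"])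
  then have "c = (\<Sum>e\<in>E. ev (r e) 0 * ev (q e) 0)" by (simp add: hproj_id[of b 0])
  then obtain n where n: "n \<in> E" "ev (r n) 0 \<noteq> 0" "ev (q n) 0 \<noteq> 0"
    using c by (metis (no_types, lifting) mult_eq_0_iff sum.neutral)
  have dn: "d n = pred_ht b"
    using r(2)[of n] q(3)[OF n(1)] homog_ev_0[of "pred_ht b - d n" "r n"] homog_ev_0[of "d n - pred_ht b" "q n"] n
    by (auto split: if_splits)
  define \<rho> where "\<rho> = ev (r n) 0"
  have rn: "r n = cst \<rho>" "\<rho> \<noteq> 0" using r(2)[of n] dn n(2) by (auto simp: homog_0_iff \<rho>_def)
  define w where "w e = (if e = n then \<phi> else v e - (cst (1 / c) * q e) \<odot> \<phi>)" for e
  have wn: "w n = \<phi>" by (simp add: w_def)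
  have whom: "homogv (d e) (w e)" if e: "e \<in> E" for e
  proof (cases "e = n")
    case False
    have "homogv (d e) ((cst (1 / c) * q e) \<odot> \<phi>)"
    proof (cases "d e < pred_ht b")
      case True then show ?thesis using q(3)[OF e] by simp
    next
      case False
      then have "homog (d e - pred_ht b) (cst (1 / c) * q e)" using q(3)[OF e] by (simp add: homog_cst_mult)
      from homogv_smul[OF this \<phi>h] show ?thesis using False by simp
    qed
    moreover have "homogv (d e) (v e)" using v e by (simp add: free_basis_def)
    ultimately show ?thesis using False by (simp add: w_def homogv_diff)
  qed (use \<phi>h dn wn in simp)
  have wI: "w e \<in> logder I" if "e \<in> E" for e
    using free_basis_mem[OF v that] \<phi>I
    by (auto simp: w_def intro: vf.subspace_diff[OF subspace_logder] vf.subspace_scale[OF subspace_logder])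
  have vw: "v e \<in> vf.span (w ` E)" if e: "e \<in> E" "e \<noteq> n" for e
  proof -
    have "v e = w e + (cst (1 / c) * q e) \<odot> w n" using e by (simp add: w_def)
    then show ?thesis using e n(1) by (auto intro!: vf.span_add vf.span_scale intro: vf.span_base)
  qed
  have "v n \<in> vf.span (w ` E)"
  proof -
    have "\<phi> = cst \<rho> \<odot> v n + (\<Sum>e\<in>E - {n}. r e \<odot> v e)"
      using r(1) rn n(1) fin_E by (simp add: sum.remove[of E n])
    then have "cst \<rho> \<odot> v n = w n - (\<Sum>e\<in>E - {n}. r e \<odot> v e)" by (simp add: wn)
    also have "\<dots> \<in> vf.span (w ` E)"
      using vw n(1) by (intro vf.span_diff vf.span_sum vf.span_scale) (auto intro: vf.span_base)
    finally have "cst (1 / \<rho>) \<odot> (cst \<rho> \<odot> v n) \<in> vf.span (w ` E)" by (rule vf.span_scale)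
    then show ?thesis by (simp add: cst_inverse(2)[OF rn(2)])
  qed
  then have "v ` E \<subseteq> vf.span (w ` E)" using vw by blast
  then have spanw: "vf.span (w ` E) = logder I"
  proof (intro antisym)
    show "vf.span (w ` E) \<subseteq> logder I" using wI by (intro vf.span_minimal subspace_logder) auto
    have "vf.span (v ` E) \<subseteq> vf.span (w ` E)"
      by (rule vf.span_minimal[OF \<open>v ` E \<subseteq> vf.span (w ` E)\<close> vf.subspace_span])
    then show "logder I \<subseteq> vf.span (w ` E)" using v by (simp add: free_basis_def)
  qed
  have basisI: "free_basis w d I" using whom spanw by (simp add: free_basis_def)
  have resw: "res b (coord b (w e)) = 0" if e: "e \<in> E" "e \<noteq> n" for e
  proof -
    have "res b (coord b (w e)) = add_poly b * q e - add_poly b * q e * (cst c * cst (1 / c))"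
      using e by (simp add: w_def res_simps q(1,2) resphi)
    then show ?thesis by (simp add: cst_inverse(1)[OF c])
  qed
  define w' where "w' = w(n := lin b \<odot> \<phi>)"
  have w'J: "w' e \<in> logder (insert b I)" if "e \<in> E" for e
    using wI[OF that] resw[OF that] \<phi>I by (auto simp: w'_def logder_def lin_dvd_iff[symmetric])
  have gen: "a \<in> vf.span (w' ` E)" if a: "a \<in> logder (insert b I)" for a
  proof -
    have "a \<in> logder I" using a logder_mono[of I "insert b I"] by blast
    then obtain s where s: "a = (\<Sum>e\<in>E. s e \<odot> w e)" using free_basis_rep[OF basisI] by blast
    have s': "a = s n \<odot> \<phi> + (\<Sum>e\<in>E - {n}. s e \<odot> w e)"
      unfolding s using n(1) fin_E by (simp add: sum.remove[of E n] wn)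
    have "0 = res b (coord b a)" using a by (simp add: logder_def lin_dvd_iff)
    also have "\<dots> = res b (s n) * (add_poly b * cst c)"
      using resw by (simp add: s' res_simps res_sum resphi)
    finally have "res b (s n) = 0" using add_poly_nonzero[OF b] c by (metis mult_eq_0_iff cst_inverse(1) mult_zero_left zero_neq_one)
    then obtain s0 where s0: "s n = lin b * s0" by (auto simp: lin_dvd_iff[symmetric] elim: dvdE)
    have "a = s0 \<odot> w' n + (\<Sum>e\<in>E - {n}. s e \<odot> w' e)"
      unfolding s' s0 by (auto simp: w'_def mult.commute intro!: sum.cong)
    then show ?thesis using n(1)
      by (auto intro!: vf.span_add vf.span_sum vf.span_scale intro: vf.span_base)
  qed
  have "vf.span (w' ` E) = logder (insert b I)"
    using gen w'J by (intro antisym vf.span_minimal subspace_logder) auto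
  moreover have "homogv ((d(n := Suc (pred_ht b))) e) (w' e)" if "e \<in> E" for e
    using whom[OF that] homogv_smul[OF homog_simps(5) \<phi>h, of b] by (auto simp: w'_def)
  ultimately have "free_basis w' (d(n := Suc (pred_ht b))) (insert b I)" by (simp add: free_basis_def)
  then show ?thesis using n(1) wn dn basisI unfolding w'_def by blast
qed

text \<open>The bound on the degrees is what \<open>adding_derivation_exists\<close> needs in order to separate the fields of degree
  \<open>k\<close> from the others.\<close>

lemma free_basis_bounded:
  assumes "\<And>g. g \<in> pos \<Longrightarrow> pred_ht g < K \<Longrightarrow> \<exists>\<phi>. adding_derivation g \<phi>" "lower I" "\<And>g. g \<in> I \<Longrightarrow> pred_ht g < K"
  shows "\<exists>v d. free_basis v d I \<and> (\<forall>e\<in>E. d e \<le> K)"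
  using assms(2,3)
proof (induction "card I" arbitrary: I)
  case 0
  then have "I = {}" using lower_fin by auto
  then show ?case using free_basis_empty by (intro exI[of _ const_vf] exI[of _ "\<lambda>_. 0"]) auto
next
  case (Suc n)
  then have fin: "finite I" "I \<noteq> {}" using lower_fin by auto
  then have "Max (pred_ht ` I) \<in> pred_ht ` I" by (intro Max_in) auto
  then obtain b where b: "Max (pred_ht ` I) = pred_ht b" "b \<in> I" by (rule imageE)
  have bmax: "pred_ht a \<le> pred_ht b" if "a \<in> I" for a using fin that unfolding b(1)[symmetric] by simp
  have low: "lower (I - {b})" by (rule lower_remove_max[OF Suc.prems(1) b(2) bmax])
  have "card (I - {b}) = n" using Suc.hyps(2) b(2) fin by simp
  then obtain v d where v: "free_basis v d (I - {b})" "\<forall>e\<in>E. d e \<le> K"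
    using Suc.hyps(1)[of "I - {b}"] low Suc.prems(2) by auto
  have bp: "b \<in> pos" using b lower_pos Suc.prems by auto
  obtain \<phi> where \<phi>: "adding_derivation b \<phi>" using assms(1)[OF bp] Suc.prems(2)[OF b(2)] by blast
  have ins: "insert b (I - {b}) = I" using b by auto
  obtain w m where "free_basis (w(m := lin b \<odot> \<phi>)) (d(m := Suc (pred_ht b))) I"
    using exchange[OF low _ _ \<phi> v(1)] Suc.prems(1) ins by auto
  moreover have "\<forall>e\<in>E. (d(m := Suc (pred_ht b))) e \<le> K" using v(2) Suc.prems(2)[OF b(2)] by auto
  ultimately show ?case by blast
qed

text \<open>Let \<open>b\<close> have height \<open>k + 1\<close>, and take a basis of \<open>D(L)\<close> for the set \<open>L\<close> of all roots of smaller height; its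
  degrees are at most \<open>k\<close>.  By \<open>no_low_root_in_span\<close> there is a point \<open>x\<close> on the hyperplanes of all roots of
  height \<open>k + 1\<close> (the set \<open>M\<close>) and on none from \<open>L\<close>.  At \<open>x\<close> the basis spans, so some combination takes a
  value \<open>u\<close> that is tangent to the hyperplanes from \<open>M - {b}\<close> but not to \<open>ker b\<close>.  Its basis fields of
  degree less than \<open>k\<close> are tangent to all these hyperplanes anyway, so they may be dropped; this leaves a
  homogeneous field \<open>\<phi>\<close> of degree \<open>k\<close>.  For \<open>g \<in> M - {b}\<close> tangency at the single point \<open>x\<close> suffices, the quotient
  of \<open>\<phi>(g)\<close> by \<open>add_poly g\<close> being constant.  For roots of larger height tangency is automatic for reasons of
  degree.\<close>

lemma adding_derivation_exists: "b \<in> pos \<Longrightarrow> \<exists>\<phi>. adding_derivation b \<phi>"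
proof (induction "pred_ht b" arbitrary: b rule: less_induct)
  case less
  define k where "k = pred_ht b"
  define L where "L = {g\<in>pos. pred_ht g < k}"
  define M where "M = {g\<in>pos. pred_ht g = k}"
  have finLM: "finite L" "finite M" using fin_pos by (auto simp: L_def M_def)
  have Llow: "lower L" unfolding L_def by (rule lower_truncate[OF lower_pos_self])
  have bM: "b \<in> M" using less.prems by (simp add: M_def k_def)
  have "\<exists>v d. free_basis v d L \<and> (\<forall>e\<in>E. d e \<le> k)"
    using free_basis_bounded[OF _ Llow, of k] less.hyps by (auto simp: L_def k_def)
  then obtain v d where v: "free_basis v d L" "\<And>e. e \<in> E \<Longrightarrow> d e \<le> k" by blast
  have htM: "ht g = 1 + of_nat k" if "g \<in> M" for g using that ht_pred_ht by (auto simp: M_def)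
  have M\<Phi>: "M \<subseteq> \<Phi>" using pos_sub by (auto simp: M_def)
  have "\<exists>x\<in>{x. \<forall>g\<in>M. g \<bullet> x = 0}. \<forall>a\<in>L. a \<bullet> x \<noteq> 0"
  proof (rule avoid_hyperplanes[OF finLM(1)])
    show "subspace {x. \<forall>g\<in>M. g \<bullet> x = 0}" by (auto simp: subspace_def inner_add_right)
    fix a assume a: "a \<in> L"
    have "a \<notin> span M"
    proof
      assume "a \<in> span M"
      then show False
        using no_low_root_in_span[OF crystallographic linear_ht ht_nonzero M\<Phi> htM _ _ \<open>a \<in> span M\<close>] a pos_sub ht_pred_ht[of a]
        by (auto simp: L_def)
    qed
    then show "\<exists>u\<in>{x. \<forall>g\<in>M. g \<bullet> x = 0}. a \<bullet> u \<noteq> 0" using orthogonal_witness[OF finLM(2)] by blast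
  qed
  then obtain x where x: "\<And>g. g \<in> M \<Longrightarrow> g \<bullet> x = 0" "\<And>a. a \<in> L \<Longrightarrow> a \<bullet> x \<noteq> 0" by blast
  have indM: "independent M"
  proof (rule obtuse_independent[OF finLM(2) _ linear_ht])
    show "ht a > 0" if "a \<in> M" for a using htM[OF that] by simp
    show "a \<bullet> c \<le> 0" if ac: "a \<in> M" "c \<in> M" "a \<noteq> c" for a c
    proof (rule ccontr)
      assume "\<not> a \<bullet> c \<le> 0"
      then have "a - c \<in> \<Phi>" using crystallographic_diff[OF crystallographic, of a c] ac M\<Phi> by auto
      from ht_nonzero[OF this] show False using htM ac by (simp add: linear_diff[OF linear_ht])
    qed
  qed
  have "b \<notin> span (M - {b})" using indM bM by (auto simp: dependent_def)
  then obtain u where u: "\<And>g. g \<in> M - {b} \<Longrightarrow> g \<bullet> u = 0" "b \<bullet> u \<noteq> 0"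
    using orthogonal_witness[of "M - {b}" b] finLM by blast
  obtain t where t: "u = (\<Sum>e\<in>E. t e *\<^sub>R vev (v e) x)"
    using free_basis_spans_at[OF v(1) finLM(1) x(2)] by blast
  define \<phi> where "\<phi> = (\<Sum>e\<in>E. if d e = k then cst (t e) \<odot> v e else 0)"
  have \<phi>h: "homogv k \<phi>"
    unfolding \<phi>_def using v(1) homogv_smul[OF homog_simps(2)]
    by (intro homogv_sum) (force simp: free_basis_def)
  have \<phi>L: "\<phi> \<in> logder L"
    unfolding \<phi>_def using free_basis_mem[OF v(1)]
    by (intro vf.subspace_sum[OF subspace_logder])
      (auto intro: vf.subspace_scale[OF subspace_logder] vf.subspace_0[OF subspace_logder])
  have Mg: "lower (insert g L)" "g \<notin> L" "g \<in> pos" "pred_ht g = k" if "g \<in> M" for g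
    using that lower_insert_min[OF Llow, of g] by (auto simp: M_def L_def)
  have val: "g \<bullet> vev \<phi> x = g \<bullet> u" if g: "g \<in> M" for g
  proof -
    have low: "g \<bullet> vev (v e) x = 0" if e: "e \<in> E" "d e \<noteq> k" for e
    proof -
      have "d e < pred_ht g" using v(2)[OF e(1)] e(2) Mg(4)[OF g] by simp
      then have "res g (coord g (v e)) = 0"
        using add_poly_quotient[OF Mg(1,2,3)[OF g] free_basis_mem[OF v(1) e(1)], of "d e"] v(1) e(1)
        by (auto simp: free_basis_def)
      then have "lin g dvd coord g (v e)" by (simp add: lin_dvd_iff)
      from lin_dvdD[OF this x(1)[OF g]] show ?thesis by simp
    qed
    have "g \<bullet> vev \<phi> x = (\<Sum>e\<in>E. g \<bullet> vev (if d e = k then cst (t e) \<odot> v e else 0) x)"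
      by (simp add: \<phi>_def inner_sum_right)
    also have "\<dots> = (\<Sum>e\<in>E. t e * (g \<bullet> vev (v e) x))"
      using low by (intro sum.cong) auto
    also have "\<dots> = g \<bullet> u" by (simp add: t inner_sum_right)
    finally show ?thesis .
  qed
  \<comment> \<open>Each factor with a positive exponent comes from a plane that contains a root of \<open>L\<close>, and this root is
    nonzero at \<open>x\<close>.\<close>
  have bnz: "ev (add_poly g) x \<noteq> 0" if g: "g \<in> M" for g
  proof -
    have "(hproj g (flat_rep g \<Psi>) \<bullet> x) ^ flat_mult g \<Psi> \<noteq> 0" if \<Psi>: "\<Psi> \<in> flats g" for \<Psi>
    proof (cases "flat_mult g \<Psi> = 0")
      case False
      then have "flat_mult g \<Psi> + 1 \<le> card (L \<inter> \<Psi>)" using flat_mult(2)[OF Mg(3)[OF g] \<Psi> Mg(1,2)[OF g]] by simp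
      then obtain a where a: "a \<in> L \<inter> \<Psi>" by (metis Suc_eq_plus1 card.empty ex_in_conv not_less_eq_eq zero_le)
      then have "a \<in> flat g (flat_rep g \<Psi>) \<inter> pos - {g}" using flat_rep(2)[OF \<Psi>] Mg(2)[OF g] by (auto simp: L_def)
      then obtain y z where "a = y *\<^sub>R g + z *\<^sub>R flat_rep g \<Psi>"
        using flat_member[OF Mg(3)[OF g] flat_rep(1)[OF \<Psi>]] by blast
      then have "a \<bullet> x = z * (flat_rep g \<Psi> \<bullet> x)" using x(1)[OF g] by (simp add: inner_add_left)
      then have "flat_rep g \<Psi> \<bullet> x \<noteq> 0" using x(2)[of a] a by auto
      moreover have "hproj g (flat_rep g \<Psi>) \<bullet> x = flat_rep g \<Psi> \<bullet> x"
        using inner_hproj(2)[of "flat_rep g \<Psi>" g x] hproj_id[OF x(1)[OF g]] by simp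
      ultimately show ?thesis by simp
    qed simp
    then show ?thesis using fin_flats by (simp add: add_poly_def)
  qed
  have "adding_derivation b \<phi>"
    unfolding adding_derivation_def
  proof (intro conjI allI impI)
    show "homogv (pred_ht b) \<phi>" using \<phi>h by (simp add: k_def)
    show "\<not> lin b dvd coord b \<phi>"
    proof
      assume "lin b dvd coord b \<phi>"
      then have "ev (coord b \<phi>) x = 0" by (rule lin_dvdD[OF _ x(1)[OF bM]])
      then show False using val[OF bM] u(2) by simp
    qed
    fix I assume I: "lower I" "b \<notin> I"
    have "lin g dvd coord g \<phi>" if "g \<in> I" for g
      using that
    proof (induction "pred_ht g" arbitrary: g rule: less_induct)
      case (less g)
      have gp: "g \<in> pos" using less.prems lower_pos[OF I(1)] by auto
      consider "pred_ht g < k" | "pred_ht g = k" | "pred_ht g > k" by linarith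
      then show ?case
      proof cases
        case 1
        then show ?thesis using logder_dvd[OF \<phi>L, of g] gp by (simp add: L_def)
      next
        case 2
        then have g: "g \<in> M" "g \<noteq> b" using gp less.prems I(2) by (auto simp: M_def)
        obtain q where q: "res g (coord g \<phi>) = add_poly g * q" "homog 0 q"
          using add_poly_quotient[OF Mg(1,2,3)[OF g(1)] \<phi>L \<phi>h] 2 by auto
        have "ev (res g (coord g \<phi>)) x = 0" using hproj_id[OF x(1)[OF g(1)]] val[OF g(1)] u(1)[of g] g by simp
        then have "ev q x = 0" using q(1) bnz[OF g(1)] by simp
        moreover have "q = cst (ev q 0)" using q(2) by (simp add: homog_0_iff)
        then have "ev q x = ev q 0" by (metis ev_simps(7))
        ultimately have "q = 0" using \<open>q = cst (ev q 0)\<close> by (simp add: cst_simps)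
        then show ?thesis using q(1) by (simp add: lin_dvd_iff)
      next
        case 3
        define I' where "I' = {a\<in>I. pred_ht a < pred_ht g}"
        have I': "lower I'" "g \<notin> I'" unfolding I'_def using lower_truncate[OF I(1)] by auto
        have "lower (insert g I')"
        proof (rule lower_insert[OF I'(1) gp])
          fix a assume a: "a \<in> pos" "a \<notin> I'" "root_le \<Delta> a g"
          then have "a \<in> I" using I(1) less.prems by (auto simp: lower_ideal_def)
          then have "ht g \<le> ht a" using a ht_pred_ht[OF a(1)] ht_pred_ht[OF gp] by (simp add: I'_def)
          then show "a = g" using root_le_ht a(3) by (metis order_antisym)
        qed
        moreover have "\<phi> \<in> logder I'" using less.hyps by (auto simp: logder_def I'_def)
        ultimately have "res g (coord g \<phi>) = 0" using add_poly_quotient[of g I' \<phi> k] I'(2) gp \<phi>h 3 by auto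
        then show ?thesis by (simp add: lin_dvd_iff)
      qed
    qed
    then show "\<phi> \<in> logder I" by (simp add: logder_def)
  qed
  then show ?case by blast
qed

lemma free_basis_exists: "lower I \<Longrightarrow> \<exists>v d. free_basis v d I"
proof -
  assume I: "lower I"
  have "pred_ht g < Suc (\<Sum>a\<in>I. pred_ht a)" if "g \<in> I" for g
    using member_le_sum[OF that, of pred_ht] lower_fin[OF I] by simp
  then show ?thesis using free_basis_bounded[of "Suc (\<Sum>a\<in>I. pred_ht a)" I] adding_derivation_exists I by blast
qed

text \<open>Adding a root to a lower ideal is an instance of the Koszul step, with \<open>B\<close> the basis fields other than
  \<open>\<phi>\<close>.\<close>

lemma koszul_step_data:
  assumes "lower I" "lower (insert b I)" "b \<notin> I"
  shows "\<exists>B \<phi> k. (\<forall>g\<in>B. \<exists>d. homogv d g) \<and> homogv k \<phi> \<and> b \<noteq> 0 \<and>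
      (\<forall>r. r \<odot> \<phi> \<in> vf.span B \<longrightarrow> r = 0) \<and>
      vf.span (insert (lin b \<odot> \<phi>) B) = logder (insert b I) \<and> vf.span (insert \<phi> B) = logder I"
proof -
  have b: "b \<in> pos" using lower_pos[OF assms(2)] by auto
  obtain \<phi> where \<phi>: "adding_derivation b \<phi>" using adding_derivation_exists[OF b] by blast
  obtain v d where "free_basis v d I" using free_basis_exists[OF assms(1)] by blast
  from exchange[OF assms \<phi> this] obtain w n where w: "n \<in> E" "w n = \<phi>" "d n = pred_ht b" "free_basis w d I"
    "free_basis (w(n := lin b \<odot> \<phi>)) (d(n := Suc (pred_ht b))) (insert b I)" by blast
  define B where "B = w ` (E - {n})"
  have E: "insert n (E - {n}) = E" using w(1) by auto
  have "vf.span (insert \<phi> B) = logder I"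
    using w(4) unfolding free_basis_def B_def w(2)[symmetric] image_insert[symmetric] E by blast
  moreover have "vf.span (insert (lin b \<odot> \<phi>) B) = logder (insert b I)"
  proof -
    have "(w(n := lin b \<odot> \<phi>)) ` insert n (E - {n}) = insert (lin b \<odot> \<phi>) B" by (auto simp: B_def)
    then have "(w(n := lin b \<odot> \<phi>)) ` E = insert (lin b \<odot> \<phi>) B" unfolding E .
    then show ?thesis using w(5) unfolding free_basis_def by metis
  qed
  moreover have "r = 0" if r: "r \<odot> \<phi> \<in> vf.span B" for r
  proof -
    obtain s where s: "r \<odot> \<phi> = (\<Sum>e\<in>E - {n}. s e \<odot> w e)"
      using vf.span_image_sum[of "E - {n}"] r fin_E unfolding B_def by blast
    define s' where "s' = s(n := - r)"
    have "(\<Sum>e\<in>E. s' e \<odot> w e) = s' n \<odot> w n + (\<Sum>e\<in>E - {n}. s' e \<odot> w e)"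
      using fin_E w(1) by (rule sum.remove)
    also have "(\<Sum>e\<in>E - {n}. s' e \<odot> w e) = (\<Sum>e\<in>E - {n}. s e \<odot> w e)" by (intro sum.cong) (auto simp: s'_def)
    also have "s' n \<odot> w n + \<dots> = 0" by (simp add: s'_def w(2) s[symmetric])
    finally have "s' n = 0"
      using free_basis_indep[OF w(4) lower_fin[OF assms(1)] _ _ w(1), of s'] lower_pos[OF assms(1)] pos_nonzero by blast
    then show ?thesis by (simp add: s'_def)
  qed
  moreover have "\<forall>g\<in>B. \<exists>d. homogv d g" using w(4) by (auto simp: B_def free_basis_def)
  moreover have "homogv (pred_ht b) \<phi>" using \<phi> by (simp add: adding_derivation_def)
  ultimately show ?thesis using pos_nonzero[OF b] by blast
qed

end

context roots_frame
begin

section \<open>The Weyl group and invariants\<close>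

abbreviation W :: "('a \<Rightarrow> 'a) set" where "W \<equiv> weyl_group \<Phi>"

lemma W_bounded_linear: "w \<in> W \<Longrightarrow> bounded_linear w"
  by (induction rule: weyl_group.induct)
    (auto simp: id_def bounded_linear_ident o_def intro: bounded_linear_compose[OF bounded_linear_reflection])

lemma W_inner: "w \<in> W \<Longrightarrow> w x \<bullet> w y = x \<bullet> y"
  by (rule weyl_group_inner)

lemma W_reflection: "a \<in> \<Phi> \<Longrightarrow> reflection a \<in> W"
  using weyl_group.refl[OF _ weyl_group.id, of a \<Phi>] by simp

lemma W_\<Phi>: "w \<in> W \<Longrightarrow> a \<in> \<Phi> \<Longrightarrow> w a \<in> \<Phi>"
  by (induction arbitrary: a rule: weyl_group.induct) (auto intro: crystallographicD(3)[OF crystallographic])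

lemma W_comp: "w \<in> W \<Longrightarrow> w' \<in> W \<Longrightarrow> w \<circ> w' \<in> W"
  by (induction rule: weyl_group.induct) (auto simp: comp_assoc intro: weyl_group.refl)

lemma W_inverse: "w \<in> W \<Longrightarrow> \<exists>u\<in>W. w \<circ> u = id \<and> u \<circ> w = id"
proof (induction rule: weyl_group.induct)
  case id then show ?case by (intro bexI[of _ id]) (auto intro: weyl_group.id)
next
  case (refl a w)
  then obtain u where u: "u \<in> W" "w \<circ> u = id" "u \<circ> w = id" by blast
  have rr: "reflection a \<circ> reflection a = id" by (auto simp: reflection_reflection)
  have 1: "(reflection a \<circ> w) \<circ> (u \<circ> reflection a) = id"
    using u(2) rr by (metis comp_assoc comp_id)
  have 2: "(u \<circ> reflection a) \<circ> (reflection a \<circ> w) = id"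
    using u(3) rr by (metis comp_assoc comp_id)
  have "u \<circ> reflection a \<in> W" by (intro W_comp u W_reflection refl.hyps)
  then show ?case using 1 2 by blast
qed

lemma W_inv: assumes "w \<in> W"
  shows "inv w \<in> W" "w (inv w x) = x" "inv w (w x) = x" "inv (inv w) = w" "bij w"
proof -
  obtain u where u: "u \<in> W" "w \<circ> u = id" "u \<circ> w = id" using W_inverse[OF assms] by blast
  have eq: "inv w = u" using u by (intro inv_unique_comp)
  show b: "bij w" using u o_bij by blast
  show "inv w \<in> W" using eq u by simp
  show "w (inv w x) = x" "inv w (w x) = x" using u eq by (auto simp: fun_eq_iff)
  show "inv (inv w) = w" using b by (rule inv_inv_eq)
qed

lemma inv_reflection: "inv (reflection a) = reflection a"
  by (rule inv_unique_comp) (auto simp: reflection_reflection)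

lemma fin_W: "finite W"
proof (rule inj_on_finite)
  show "inj_on (\<lambda>w. restrict w \<Phi>) W"
  proof (rule inj_onI)
    fix w u assume wu: "w \<in> W" "u \<in> W" "restrict w \<Phi> = restrict u \<Phi>"
    then have "w x = u x" if "x \<in> \<Phi>" for x using that by (metis restrict_apply')
    then have "w x = u x" if "x \<in> span \<Phi>" for x
      using linear_eq_on_span[of w u \<Phi> x] W_bounded_linear wu that by (auto simp: bounded_linear.linear)
    then show "w = u" by (auto simp: span_\<Phi>)
  qed
  show "(\<lambda>w. restrict w \<Phi>) ` W \<subseteq> \<Phi> \<rightarrow>\<^sub>E \<Phi>" using W_\<Phi> by auto
  show "finite (\<Phi> \<rightarrow>\<^sub>E \<Phi>)" using fin_\<Psi> by (intro finite_PiE) auto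
qed

lemma card_W: "card W > 0"
  using fin_W weyl_group.id[of \<Phi>] by (auto simp: card_gt_0_iff)

definition weyl_act :: "('a \<Rightarrow> 'a) \<Rightarrow> 'a vf \<Rightarrow> 'a vf" where
  "weyl_act w a = Vf (\<lambda>x. w (vev a (inv w x)))"

lemma vev_weyl_act: assumes "w \<in> W" shows "vev (weyl_act w a) x = w (vev a (inv w x))"
proof -
  have "polynomial_function (\<lambda>x. w (vev a (inv w x)))"
    unfolding polynomial_function_def
  proof (intro allI impI)
    fix f :: "'a \<Rightarrow> real" assume "bounded_linear f"
    then have "bounded_linear (\<lambda>x. f (w x))" by (rule bounded_linear_compose[OF _ W_bounded_linear[OF assms]])
    moreover have "polynomial_function (vev a)" using vev[of a] by simp
    ultimately have "real_polynomial_function (\<lambda>x. f (w (vev a x)))"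
      unfolding polynomial_function_def o_def by blast
    from rpf_compose[OF W_bounded_linear[OF W_inv(1)[OF assms]] this]
    show "real_polynomial_function (f \<circ> (\<lambda>x. w (vev a (inv w x))))" by (simp add: o_def)
  qed
  then show ?thesis by (simp add: weyl_act_def vev_Vf)
qed

lemma W_linear:
  assumes "w \<in> W"
  shows "w (x + y) = w x + w y" "w (x - y) = w x - w y" "w (c *\<^sub>R x) = c *\<^sub>R w x" "w (- x) = - w x" "w 0 = 0"
    "w (\<Sum>i\<in>A. f i) = (\<Sum>i\<in>A. w (f i))"
proof -
  have l: "linear w" using W_bounded_linear[OF assms] by (rule bounded_linear.linear)
  show "w (x + y) = w x + w y" "w (x - y) = w x - w y" "w (c *\<^sub>R x) = c *\<^sub>R w x" "w (- x) = - w x" "w 0 = 0"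
    "w (\<Sum>i\<in>A. f i) = (\<Sum>i\<in>A. w (f i))"
    using linear_add[OF l] linear_diff[OF l] linear_scale[OF l] linear_neg[OF l] linear_0[OF l] linear_sum[OF l]
    by simp_all (simp add: linear_sum[OF l])
qed

lemma W_inner_swap: "w \<in> W \<Longrightarrow> v \<bullet> w x = inv w v \<bullet> x"
  using W_inner[of w "inv w v" x] W_inv(2)[of w v] by simp

lemma weyl_act_simps:
  assumes w: "w \<in> W"
  shows "weyl_act w (a + b) = weyl_act w a + weyl_act w b" "weyl_act w (a - b) = weyl_act w a - weyl_act w b" "weyl_act w 0 = 0"
    "weyl_act w (p \<odot> a) = pull (inv w) p \<odot> weyl_act w a"
  using W_bounded_linear[OF W_inv(1)[OF w]]
  by (auto intro!: vf_eqI simp: vev_weyl_act[OF w] W_linear[OF w])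

lemma weyl_act_sum: "w \<in> W \<Longrightarrow> weyl_act w (\<Sum>i\<in>A. f i) = (\<Sum>i\<in>A. weyl_act w (f i))"
  by (induction A rule: infinite_finite_induct) (auto simp: weyl_act_simps)

lemma radial_weyl_act: "w \<in> W \<Longrightarrow> radial (weyl_act w a) = pull (inv w) (radial a)"
  using W_bounded_linear[OF W_inv(1)] by (intro rpoly_eqI) (simp add: vev_weyl_act W_inner_swap)

lemma weyl_act_comp: "w \<in> W \<Longrightarrow> u \<in> W \<Longrightarrow> weyl_act (w \<circ> u) a = weyl_act w (weyl_act u a)"
  by (rule vf_eqI) (simp add: vev_weyl_act W_comp o_inv_distrib W_inv(5))

lemma weyl_act_id: "weyl_act id a = a"
  by (rule vf_eqI) (simp add: vev_weyl_act weyl_group.id)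

lemma coord_weyl_act: "w \<in> W \<Longrightarrow> coord v (weyl_act w a) = pull (inv w) (coord (inv w v) a)"
  using W_bounded_linear[OF W_inv(1)] by (intro rpoly_eqI) (simp add: vev_weyl_act W_inner_swap)

lemma homogv_weyl_act: "w \<in> W \<Longrightarrow> homogv d a \<Longrightarrow> homogv d (weyl_act w a)"
  by (simp add: homogv_def coord_weyl_act homog_pull W_bounded_linear W_inv(1))

lemma logder_pos_\<Phi>: "logder pos = logder \<Phi>"
proof (intro antisym logder_mono[OF pos_sub] subsetI)
  fix \<theta> assume \<theta>: "\<theta> \<in> logder pos"
  have "lin a dvd coord a \<theta>" if "a \<in> \<Phi>" for a
    using pos_or_neg[OF that] logder_dvd[OF \<theta>, of a] logder_dvd[OF \<theta>, of "- a"] by (auto simp: lin_simps coord_left_simps)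
  then show "\<theta> \<in> logder \<Phi>" by (simp add: logder_def)
qed

lemma weyl_act_logder: "w \<in> W \<Longrightarrow> a \<in> logder pos \<Longrightarrow> weyl_act w a \<in> logder pos"
  unfolding logder_pos_\<Phi>
proof -
  assume w: "w \<in> W" and a: "a \<in> logder \<Phi>"
  have "lin c dvd coord c (weyl_act w a)" if c: "c \<in> \<Phi>" for c
  proof (rule lin_dvdI)
    fix x assume "c \<bullet> x = 0"
    then have "inv w c \<bullet> inv w x = 0" using W_inner[OF W_inv(1)[OF w]] by simp
    moreover have "inv w c \<in> \<Phi>" using W_\<Phi> W_inv(1)[OF w] c by blast
    ultimately have "ev (coord (inv w c) a) (inv w x) = 0" using lin_dvdD logder_dvd[OF a] by blast
    then show "ev (coord c (weyl_act w a)) x = 0" by (simp add: vev_weyl_act[OF w] W_inner_swap[OF w])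
  qed
  then show "weyl_act w a \<in> logder \<Phi>" by (simp add: logder_def)
qed

text \<open>The reflection fixes \<open>ker a\<close> pointwise, and \<open>\<theta>\<close> is tangent to it; so \<open>\<theta>\<close> and its reflected field agree on
  \<open>ker a\<close>.  Tangency of the quotient \<open>\<eta>\<close> to \<open>ker a\<close> itself holds because \<open>\<eta>(a)\<close> is \<open>h - h \<circ> s\<close> for
  \<open>h = \<theta>(a) / a\<close>.\<close>

lemma reflection_diff:
  assumes \<theta>: "\<theta> \<in> logder pos" and a: "a \<in> \<Phi>"
  shows "\<exists>\<eta>\<in>logder pos. \<theta> - weyl_act (reflection a) \<theta> = lin a \<odot> \<eta>"
proof -
  define s where "s = reflection a"
  have sW: "s \<in> W" using W_reflection a by (simp add: s_def)
  have vs: "vev (weyl_act s \<theta>) x = s (vev \<theta> (s x))" for x using vev_weyl_act[OF sW] by (simp add: s_def inv_reflection)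
  have a0: "a \<noteq> 0" using a crystallographicD(2)[OF crystallographic] by blast
  have fix_s: "s x = x" if "a \<bullet> x = 0" for x using that by (simp add: s_def reflection_def)
  have \<theta>\<Phi>: "\<theta> \<in> logder \<Phi>" using \<theta> logder_pos_\<Phi> by simp
  define \<delta> where "\<delta> = \<theta> - weyl_act s \<theta>"
  have "lin a dvd coord e \<delta>" for e
  proof (rule lin_dvdI)
    fix x assume x: "a \<bullet> x = 0"
    then have "a \<bullet> vev \<theta> x = 0" using lin_dvdD[OF logder_dvd[OF \<theta>\<Phi> a] x] by simp
    then show "ev (coord e \<delta>) x = 0" using fix_s x by (simp add: \<delta>_def vs)
  qed
  then obtain \<eta> where \<eta>: "\<delta> = lin a \<odot> \<eta>" using smul_dividesI[of "lin a" \<delta>] by blast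
  have "lin c dvd coord c \<eta>" if c: "c \<in> \<Phi>" for c
  proof (cases "lin c dvd lin a")
    case False
    have "lin c dvd lin a * coord c \<eta>"
      using logder_dvd[OF vf.subspace_diff[OF subspace_logder \<theta>\<Phi>, of "weyl_act s \<theta>"] c] weyl_act_logder[OF sW \<theta>] logder_pos_\<Phi>
      by (metis \<delta>_def \<eta> coord_simps(5))
    then show ?thesis using False by (simp add: lin_dvd_mult_iff)
  next
    case True
    then obtain k where k: "a = k *\<^sub>R c" using lin_dvd_lin by blast
    then have k0: "k \<noteq> 0" using a0 by auto
    obtain h where h: "coord a \<theta> = lin a * h" using logder_dvd[OF \<theta>\<Phi> a] by (rule dvdE)
    have "coord a \<delta> = lin a * (h - pull s h)"
    proof (rule rpoly_eqI)
      fix x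
      have bl: "bounded_linear s" unfolding s_def by (rule bounded_linear_reflection)
      have "a \<bullet> s (vev \<theta> (s x)) = - (a \<bullet> vev \<theta> (s x))" by (simp add: s_def inner_self_reflection)
      also have "a \<bullet> vev \<theta> (s x) = ev (lin a * h) (s x)" unfolding h[symmetric] by simp
      also have "\<dots> = - (a \<bullet> x) * ev h (s x)" by (simp add: s_def inner_self_reflection)
      finally have "a \<bullet> s (vev \<theta> (s x)) = (a \<bullet> x) * ev h (s x)" by simp
      moreover have "a \<bullet> vev \<theta> x = (a \<bullet> x) * ev h x" using arg_cong[OF h, of "\<lambda>p. ev p x"] by simp
      ultimately show "ev (coord a \<delta>) x = ev (lin a * (h - pull s h)) x"
        by (simp add: \<delta>_def vs bl inner_diff_right right_diff_distrib)
    qed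
    then have "coord a \<eta> = h - pull s h" using a0 by (simp add: \<eta>)
    moreover have "lin a dvd h - pull s h"
      by (rule lin_dvdI) (simp add: s_def bounded_linear_reflection fix_s[unfolded s_def])
    ultimately have "lin a dvd coord a \<eta>" by simp
    then show ?thesis
    proof -
      assume "lin a dvd coord a \<eta>"
      then have "ev (coord c \<eta>) x = 0" if "c \<bullet> x = 0" for x
        using lin_dvdD[of a "coord a \<eta>" x] that k k0 by simp
      then show ?thesis by (rule lin_dvdI)
    qed
  qed
  then have "\<eta> \<in> logder pos" unfolding logder_pos_\<Phi> by (simp add: logder_def)
  then show ?thesis using \<eta> unfolding \<delta>_def s_def by blast
qed

text \<open>Every element of the Weyl group is a product of reflections, and the differences telescope.\<close>

lemma W_diff_induct:
  assumes T: "vf.subspace T" and w: "w \<in> W"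
    and S: "\<And>a \<theta>. a \<in> \<Phi> \<Longrightarrow> \<theta> \<in> S \<Longrightarrow> weyl_act (reflection a) \<theta> \<in> S \<and> \<theta> - weyl_act (reflection a) \<theta> \<in> T"
  shows "\<theta> \<in> S \<Longrightarrow> weyl_act w \<theta> \<in> S \<and> \<theta> - weyl_act w \<theta> \<in> T"
  using w
proof (induction rule: weyl_group.induct)
  case id then show ?case unfolding weyl_act_id using vf.subspace_0[OF T] by simp
next
  case (refl a w)
  have eq: "weyl_act (reflection a \<circ> w) \<theta> = weyl_act (reflection a) (weyl_act w \<theta>)"
    using weyl_act_comp W_reflection refl by blast
  have "(\<theta> - weyl_act w \<theta>) + (weyl_act w \<theta> - weyl_act (reflection a) (weyl_act w \<theta>)) \<in> T"
    using refl S[of a "weyl_act w \<theta>"] by (intro vf.subspace_add[OF T]) auto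
  then show ?case unfolding eq using refl S[of a "weyl_act w \<theta>"] by simp
qed

definition weyl_avg :: "'a vf \<Rightarrow> 'a vf" where
  "weyl_avg \<theta> = cst (1 / card W) \<odot> (\<Sum>w\<in>W. weyl_act w \<theta>)"

lemma pull_W_cst: "w \<in> W \<Longrightarrow> pull w (cst c) = cst c"
  by (simp add: pull_simps W_bounded_linear)

lemma weyl_act_weyl_avg: assumes u: "u \<in> W" shows "weyl_act u (weyl_avg \<theta>) = weyl_avg \<theta>"
proof -
  have "(\<Sum>w\<in>W. weyl_act u (weyl_act w \<theta>)) = (\<Sum>w\<in>W. weyl_act (u \<circ> w) \<theta>)"
    using u by (simp add: weyl_act_comp)
  also have "\<dots> = (\<Sum>w\<in>W. weyl_act w \<theta>)"
    by (rule sum.reindex_bij_witness[of _ "\<lambda>w. inv u \<circ> w" "\<lambda>w. u \<circ> w"])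
      (auto simp: W_comp W_inv u fun_eq_iff)
  finally show ?thesis using u by (simp add: weyl_avg_def weyl_act_simps weyl_act_sum pull_W_cst W_inv)
qed

lemma weyl_avg_diff:
  assumes T: "vf.subspace T" and "\<And>w. w \<in> W \<Longrightarrow> \<theta> - weyl_act w \<theta> \<in> T"
  shows "\<theta> - weyl_avg \<theta> \<in> T"
proof -
  have c: "cst (1 / card W) * of_nat (card W) = (1 :: 'a rpoly)"
    using card_W by (intro rpoly_eqI) simp
  have "\<theta> - weyl_avg \<theta> = cst (1 / card W) \<odot> (\<Sum>w\<in>W. \<theta> - weyl_act w \<theta>)"
    unfolding weyl_avg_def sum_subtractf vf.sum_constant_scale vf.scale_right_diff_distrib vf.scale_scale c by simp
  also have "\<dots> \<in> T" using assms by (intro vf.subspace_scale[OF T] vf.subspace_sum[OF T]) auto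
  finally show ?thesis .
qed

lemma weyl_avg_closed:
  assumes T: "vf.subspace T" and "\<And>w. w \<in> W \<Longrightarrow> weyl_act w \<theta> \<in> T"
  shows "weyl_avg \<theta> \<in> T"
  unfolding weyl_avg_def using assms by (intro vf.subspace_scale[OF T] vf.subspace_sum[OF T]) auto

lemma homogv_weyl_avg: "homogv d \<theta> \<Longrightarrow> homogv d (weyl_avg \<theta>)"
  unfolding weyl_avg_def
  using homogv_smul[OF homog_simps(2) homogv_sum[of W d "\<lambda>w. weyl_act w \<theta>"], of "1 / card W"] homogv_weyl_act by simp

text \<open>Modulo lower degrees the Weyl group acts trivially, which makes averaging harmless in inductions on the
  degree.\<close>

lemma reflection_diff_homog:
  assumes \<theta>: "\<theta> \<in> logder pos" "homogv n \<theta>" and a: "a \<in> \<Phi>"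
  shows "(n = 0 \<and> \<theta> - weyl_act (reflection a) \<theta> = 0) \<or>
    (n > 0 \<and> (\<exists>\<eta>\<in>logder pos. homogv (n - 1) \<eta> \<and> \<theta> - weyl_act (reflection a) \<theta> = lin a \<odot> \<eta>))"
proof -
  obtain \<eta> where \<eta>: "\<eta> \<in> logder pos" "\<theta> - weyl_act (reflection a) \<theta> = lin a \<odot> \<eta>" using reflection_diff[OF \<theta>(1) a] by blast
  have "homogv n (\<theta> - weyl_act (reflection a) \<theta>)"
    using \<theta>(2) homogv_weyl_act[OF W_reflection[OF a]] by (intro homogv_diff) auto
  then have "\<theta> - weyl_act (reflection a) \<theta> = vcomp n (lin a \<odot> \<eta>)" using \<eta>(2) by (metis vcomp_homogv)
  also have "\<dots> = (if n < 1 then 0 else lin a \<odot> vcomp (n - 1) \<eta>)" by (rule vcomp_smul_homog) simp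
  finally have eq: "\<theta> - weyl_act (reflection a) \<theta> = (if n < 1 then 0 else lin a \<odot> vcomp (n - 1) \<eta>)" .
  show ?thesis
  proof (cases "n = 0")
    case True then show ?thesis using eq by simp
  next
    case False
    then have "\<theta> - weyl_act (reflection a) \<theta> = lin a \<odot> vcomp (n - 1) \<eta>" using eq by simp
    then show ?thesis using False vcomp_logder[OF \<eta>(1), of "n - 1"] homogv_vcomp[of "n - 1" \<eta>] by blast
  qed
qed

text \<open>The averages of the members of a basis again generate: by induction on the degree every field of smaller degree
  is in their span, and by \<open>reflection_diff_homog\<close> a basis field differs from its average by a combination of such
  fields.\<close>

lemma invariant_basis:
  shows "\<exists>v d. free_basis v d pos \<and> (\<forall>e\<in>E. \<forall>w\<in>W. weyl_act w (v e) = v e)"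
proof -
  obtain v d where v: "free_basis v d pos" using free_basis_exists[OF lower_pos_self] by blast
  define u where "u e = weyl_avg (v e)" for e
  have uD: "u e \<in> logder pos" if "e \<in> E" for e
    unfolding u_def using free_basis_mem[OF v that] weyl_act_logder by (intro weyl_avg_closed subspace_logder) auto
  have uh: "homogv (d e) (u e)" if "e \<in> E" for e
    unfolding u_def using v that by (intro homogv_weyl_avg) (auto simp: free_basis_def)
  define T where "T = vf.span (u ` E)"
  have T: "vf.subspace T" by (simp add: T_def)
  have "\<theta> \<in> T" if "\<theta> \<in> logder pos" "homogv n \<theta>" for n \<theta>
    using that
  proof (induction n arbitrary: \<theta> rule: less_induct)
    case (less n)
    have red: "\<theta>' - weyl_avg \<theta>' \<in> T" if \<theta>': "\<theta>' \<in> logder pos" "homogv m \<theta>'" "m \<le> n" for \<theta>' m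
    proof (rule weyl_avg_diff[OF T])
      fix w assume w: "w \<in> W"
      define S where "S = {\<theta>\<in>logder pos. homogv m \<theta>}"
      have "weyl_act (reflection a) \<xi> \<in> S \<and> \<xi> - weyl_act (reflection a) \<xi> \<in> T" if a: "a \<in> \<Phi>" and \<xi>: "\<xi> \<in> S" for a \<xi>
      proof
        show "weyl_act (reflection a) \<xi> \<in> S" using \<xi> weyl_act_logder homogv_weyl_act W_reflection[OF a] by (simp add: S_def)
        show "\<xi> - weyl_act (reflection a) \<xi> \<in> T"
          using reflection_diff_homog[of \<xi> m a] \<xi> a less.IH[of "m - 1"] \<theta>'(3) vf.subspace_0[OF T]
            vf.subspace_scale[OF T, of _ "lin a"] unfolding S_def by force
      qed
      then show "\<theta>' - weyl_act w \<theta>' \<in> T" using W_diff_induct[OF T w, of S \<theta>'] \<theta>' by (simp add: S_def)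
    qed
    obtain r where r: "\<theta> = (\<Sum>e\<in>E. r e \<odot> v e)" "\<And>e. if n < d e then r e = 0 else homog (n - d e) (r e)"
      using free_basis_rep_homog[OF v less.prems] by blast
    have "r e \<odot> v e \<in> T" if e: "e \<in> E" for e
    proof (cases "n < d e")
      case True then show ?thesis using r(2)[of e] vf.subspace_0[OF T] by simp
    next
      case False
      have "v e - u e \<in> T" unfolding u_def
        using red[of "v e" "d e"] free_basis_mem[OF v e] v e False by (auto simp: free_basis_def)
      moreover have "u e \<in> T" using e by (auto simp: T_def intro: vf.span_base)
      ultimately have "(v e - u e) + u e \<in> T" by (rule vf.subspace_add[OF T])
      then show ?thesis by (simp add: vf.subspace_scale[OF T])
    qed
    then show ?case unfolding r(1) by (intro vf.subspace_sum[OF T])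
  qed
  note hom = this
  have "\<theta> \<in> T" if \<theta>: "\<theta> \<in> logder pos" for \<theta>
  proof -
    obtain N where "\<theta> = (\<Sum>n\<le>N. vcomp n \<theta>)" using vcomp_decomp by blast
    also have "\<dots> \<in> T" using hom vcomp_logder[OF \<theta>] homogv_vcomp by (intro vf.subspace_sum[OF T]) blast
    finally show ?thesis .
  qed
  moreover have "T \<subseteq> logder pos" unfolding T_def using uD by (intro vf.span_minimal subspace_logder) auto
  ultimately have "free_basis u d pos" using uh by (auto simp: free_basis_def T_def)
  then show ?thesis using weyl_act_weyl_avg by (intro exI[of _ u] exI[of _ d]) (simp add: u_def)
qed

definition weyl_invariant :: "'a rpoly \<Rightarrow> bool" where
  "weyl_invariant p \<longleftrightarrow> (\<forall>w\<in>W. pull w p = p)"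

lemma weyl_invariant_hcomp: "weyl_invariant p \<Longrightarrow> weyl_invariant (hcomp d p)"
  by (auto simp: weyl_invariant_def hcomp_pull[symmetric] W_bounded_linear)

lemma weyl_invariant_radial: "(\<And>w. w \<in> W \<Longrightarrow> weyl_act w a = a) \<Longrightarrow> weyl_invariant (radial a)"
  unfolding weyl_invariant_def using radial_weyl_act[OF W_inv(1)] W_inv by metis

lemma grad_equivariant:
  assumes "weyl_invariant p" "w \<in> W"
  shows "vev (grad p) (w x) = w (vev (grad p) x)"
proof -
  have "e \<bullet> vev (grad p) (w x) = e \<bullet> w (vev (grad p) x)" for e
  proof -
    have "dderiv (inv w e) p = dderiv (inv w e) (pull w p)" using assms by (simp add: weyl_invariant_def)
    also have "\<dots> = pull w (dderiv e p)" using assms(2) by (simp add: dderiv_pull W_bounded_linear W_inv)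
    finally have "ev (dderiv (inv w e) p) x = ev (dderiv e p) (w x)"
      using assms(2) by (simp add: W_bounded_linear)
    then have "ev (coord (inv w e) (grad p)) x = ev (coord e (grad p)) (w x)" by (simp only: coord_grad)
    then show ?thesis using assms(2) by (simp add: W_inner_swap)
  qed
  then have "(vev (grad p) (w x) - w (vev (grad p) x)) \<bullet> (vev (grad p) (w x) - w (vev (grad p) x)) = 0"
    by (metis inner_diff_right right_minus_eq)
  then show ?thesis by simp
qed

lemma grad_invariant: "weyl_invariant p \<Longrightarrow> w \<in> W \<Longrightarrow> weyl_act w (grad p) = grad p"
  by (rule vf_eqI) (simp add: vev_weyl_act grad_equivariant[symmetric] W_inv)

text \<open>The gradient of an invariant commutes with reflections, so on \<open>ker a\<close> it is fixed by the reflection in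
  \<open>a\<close>.\<close>

lemma grad_logder: assumes p: "weyl_invariant p" shows "grad p \<in> logder pos"
proof -
  have "lin a dvd coord a (grad p)" if a: "a \<in> \<Phi>" for a
  proof (rule lin_dvdI)
    fix x assume "a \<bullet> x = 0"
    then have "reflection a x = x" by (simp add: reflection_def)
    then have "vev (grad p) x = reflection a (vev (grad p) x)"
      using grad_equivariant[OF p W_reflection[OF a], of x] by simp
    then have "a \<bullet> vev (grad p) x = - (a \<bullet> vev (grad p) x)" by (metis inner_self_reflection)
    then show "ev (coord a (grad p)) x = 0" by simp
  qed
  then show ?thesis using pos_sub by (auto simp: logder_def)
qed

text \<open>By Euler's formula the invariant is a multiple of the radial part of its gradient.\<close>

lemma inv_homog_in_ideal:
  assumes "weyl_invariant p" "homog n p" "n > 0"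
  shows "\<exists>a\<in>logder pos. p = radial a"
proof (rule bexI)
  show "p = radial (cst (1 / n) \<odot> grad p)"
    using assms(3) by (intro rpoly_eqI) (simp add: euler[OF assms(2)] del: ev_radial)
  show "cst (1 / n) \<odot> grad p \<in> logder pos"
    by (intro vf.subspace_scale[OF subspace_logder] grad_logder assms)
qed

definition sq_dist :: "'a \<Rightarrow> 'a rpoly" where
  "sq_dist z = (\<Sum>e\<in>E. (lin e - cst (e \<bullet> z)) ^ 2)"

lemma ev_sq_dist: "ev (sq_dist z) x = (x - z) \<bullet> (x - z)"
  unfolding parseval[of "x - z" "x - z"] by (simp add: sq_dist_def inner_diff_right power2_eq_square)

lemma dderiv_sq_dist: "ev (dderiv v (sq_dist z)) z = 0"
  by (simp add: sq_dist_def dderiv_sum power2_eq_square dderiv_simps)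

text \<open>Average the polynomial \<open>(v \<bullet> (y - x)) * (\<Prod>w. \<bar>y - w x\<bar>\<^sup>2)\<close>, where \<open>w\<close> runs through the elements other than
  the identity: near \<open>x\<close> it is a multiple of \<open>v \<bullet> (y - x)\<close> to first order, and at the other points of the
  orbit it vanishes to second order.\<close>

lemma gradient_interpolation:
  assumes x: "\<And>w. w \<in> W \<Longrightarrow> w \<noteq> id \<Longrightarrow> w x \<noteq> x"
  shows "\<exists>p. weyl_invariant p \<and> vev (grad p) x = v"
proof -
  define M where "M = (\<Prod>w\<in>W - {id}. sq_dist (w x))"
  define K where "K = (lin v - cst (v \<bullet> x)) * M"
  define p where "p = (\<Sum>w\<in>W. pull w K)"
  define \<kappa> where "\<kappa> = ev M x"
  have "ev (sq_dist (w x)) x \<noteq> 0" if "w \<in> W - {id}" for w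
    using x[of w] that by (auto simp: ev_sq_dist)
  then have "\<kappa> \<noteq> 0" unfolding \<kappa>_def M_def using fin_W by simp
  have "pull u p = p" if u: "u \<in> W" for u
  proof -
    have "pull u p = (\<Sum>w\<in>W. pull (w \<circ> u) K)"
      unfolding p_def by (rule rpoly_eqI) (simp add: W_bounded_linear u W_comp)
    also have "\<dots> = p" unfolding p_def
      by (rule sum.reindex_bij_witness[of _ "\<lambda>w. w \<circ> inv u" "\<lambda>w. w \<circ> u"])
        (auto simp: W_comp W_inv u fun_eq_iff)
    finally show ?thesis .
  qed
  then have inv: "weyl_invariant p" by (simp add: weyl_invariant_def)
  have far: "ev (dderiv z K) (w x) = 0" if w: "w \<in> W" "w \<noteq> id" for z w
  proof -
    have "M = sq_dist (w x) * (\<Prod>w\<in>W - {id} - {w}. sq_dist (w x))"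
      unfolding M_def using w fin_W by (intro prod.remove) auto
    then obtain K' where "K = sq_dist (w x) * K'" unfolding K_def by (metis mult.left_commute)
    then show ?thesis by (simp add: dderiv_simps dderiv_sq_dist ev_sq_dist)
  qed
  have near: "ev (dderiv z K) x = (v \<bullet> z) * \<kappa>" for z
  proof -
    have "dderiv z (lin v - cst (v \<bullet> x)) = cst (v \<bullet> z)"
      using dderiv_simps(2)[of z "lin v - cst (v \<bullet> x)" "cst (v \<bullet> x)"] by (simp add: dderiv_simps)
    then show ?thesis unfolding K_def \<kappa>_def by (simp add: dderiv_simps)
  qed
  have "e \<bullet> vev (grad p) x = e \<bullet> (\<kappa> *\<^sub>R v)" for e
  proof -
    have "e \<bullet> vev (grad p) x = ev (dderiv e p) x" by (metis coord_grad ev_coord)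
    also have "\<dots> = (\<Sum>w\<in>W. ev (dderiv (w e) K) (w x))"
      unfolding p_def by (simp add: dderiv_sum dderiv_pull W_bounded_linear)
    also have "\<dots> = (\<Sum>w\<in>W. if w = id then ev (dderiv e K) x else 0)"
      by (intro sum.cong) (auto simp: far)
    also have "\<dots> = ev (dderiv e K) x" using fin_W weyl_group.id[of \<Phi>] by simp
    finally show ?thesis by (simp add: near inner_commute)
  qed
  then have "(vev (grad p) x - \<kappa> *\<^sub>R v) \<bullet> (vev (grad p) x - \<kappa> *\<^sub>R v) = 0" by (metis inner_diff_right right_minus_eq)
  then have g: "vev (grad p) x = \<kappa> *\<^sub>R v" by simp
  have "grad (cst (1 / \<kappa>) * p) = cst (1 / \<kappa>) \<odot> grad p" by (simp add: grad_simps)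
  then have "vev (grad (cst (1 / \<kappa>) * p)) x = v" using g \<open>\<kappa> \<noteq> 0\<close> by simp
  moreover have "weyl_invariant (cst (1 / \<kappa>) * p)" using inv by (simp add: weyl_invariant_def pull_simps W_bounded_linear)
  ultimately show ?thesis by blast
qed

end

section \<open>Exactness for the full arrangement\<close>

text \<open>The polynomials \<open>fund e\<close> generate the ideal of the full arrangement; they play the part of the basic
  invariants.\<close>

locale invariant_basis = roots_frame \<Phi> \<Delta> E for \<Phi> \<Delta> E :: "'a::real_inner set" +
  fixes v :: "'a \<Rightarrow> 'a vf" and d :: "'a \<Rightarrow> nat"
  assumes basis: "free_basis v d pos" and inv_v: "\<And>e w. e \<in> E \<Longrightarrow> w \<in> W \<Longrightarrow> weyl_act w (v e) = v e"
begin

definition fund :: "'a \<Rightarrow> 'a rpoly" where "fund e = radial (v e)"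

lemma homogv_v: "e \<in> E \<Longrightarrow> homogv (d e) (v e)"
  using basis by (simp add: free_basis_def)

lemma homog_fund: "e \<in> E \<Longrightarrow> homog (Suc (d e)) (fund e)"
  unfolding fund_def by (rule homog_radial[OF homogv_v])

lemma weyl_invariant_fund: "e \<in> E \<Longrightarrow> weyl_invariant (fund e)"
  unfolding fund_def by (rule weyl_invariant_radial) (rule inv_v)

lemma v_indep: "(\<Sum>e\<in>E. r e \<odot> v e) = 0 \<Longrightarrow> e \<in> E \<Longrightarrow> r e = 0"
  using free_basis_indep[OF basis fin_pos] pos_nonzero by blast

text \<open>The coefficients with respect to an invariant basis are unique.\<close>

lemma coeffs_weyl_invariant:
  assumes "\<And>w. w \<in> W \<Longrightarrow> weyl_act w (\<Sum>e\<in>E. r e \<odot> v e) = (\<Sum>e\<in>E. r e \<odot> v e)" "e \<in> E"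
  shows "weyl_invariant (r e)"
  unfolding weyl_invariant_def
proof
  fix w assume w: "w \<in> W"
  note u = W_inv(1)[OF w]
  have "(\<Sum>e\<in>E. pull w (r e) \<odot> v e) = weyl_act (inv w) (\<Sum>e\<in>E. r e \<odot> v e)"
    by (simp add: weyl_act_sum[OF u] weyl_act_simps[OF u] W_inv[OF w] inv_v u)
  also have "\<dots> = (\<Sum>e\<in>E. r e \<odot> v e)" using assms(1)[OF u] .
  finally have "(\<Sum>e\<in>E. (pull w (r e) - r e) \<odot> v e) = 0"
    by (simp add: vf.scale_left_diff_distrib sum_subtractf)
  from v_indep[OF this assms(2)] show "pull w (r e) = r e" by simp
qed

text \<open>By induction on the degree: with respect to the invariant basis the gradient of \<open>c\<close> has invariant coefficients
  \<open>r e\<close> of smaller degree than \<open>c\<close>, and Euler's formula \<open>n c = \<Sum>e. r e * fund e\<close> is differentiated.\<close>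

lemma grad_in_span: "weyl_invariant c \<Longrightarrow> grad c \<in> vf.span ((\<lambda>e. grad (fund e)) ` E)"
proof -
  let ?T = "vf.span ((\<lambda>e. grad (fund e)) ` E)"
  have hom: "grad c \<in> ?T" if "weyl_invariant c" "homog n c" for n c
    using that
  proof (induction n arbitrary: c rule: less_induct)
    case (less n)
    show ?case
    proof (cases "n = 0")
      case True
      then have "c = cst (ev c 0)" using less.prems(2) homog_0_iff by blast
      then have "grad c = 0" using grad_simps(4)[of "ev c 0"] by simp
      then show ?thesis by (simp add: vf.span_zero)
    next
      case False
      obtain r where r: "grad c = (\<Sum>e\<in>E. r e \<odot> v e)"
        "\<And>e. if n - 1 < d e then r e = 0 else homog (n - 1 - d e) (r e)"
        using free_basis_rep_homog[OF basis grad_logder[OF less.prems(1)] homogv_grad[OF less.prems(2)]] by blast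
      have inv: "weyl_invariant (r e)" if "e \<in> E" for e
        using coeffs_weyl_invariant[of r e] grad_invariant[OF less.prems(1)] r(1) that by simp
      have T: "grad (r e) \<in> ?T" if e: "e \<in> E" for e
      proof (cases "n - 1 < d e")
        case True then show ?thesis using r(2)[of e] by (simp add: grad_simps vf.span_zero)
      next
        case F: False
        then have "homog (n - 1 - d e) (r e)" using r(2)[of e] by simp
        then show ?thesis using less.IH[of "n - 1 - d e"] inv[OF e] False by simp
      qed
      have "of_nat n * c = (\<Sum>e\<in>E. r e * fund e)"
        using euler[OF less.prems(2)] unfolding r(1) fund_def by simp
      then have "grad (of_nat n * c) = (\<Sum>e\<in>E. r e \<odot> grad (fund e) + fund e \<odot> grad (r e))"
        by (simp add: grad_sum grad_simps)
      also have "\<dots> \<in> ?T"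
        using T by (intro vf.span_sum vf.span_add vf.span_scale) (auto intro: vf.span_base)
      finally have "cst (1 / n) \<odot> grad (of_nat n * c) \<in> ?T" by (rule vf.span_scale)
      moreover have "of_nat n = (cst (of_nat n) :: 'a rpoly)" by (rule rpoly_eqI) simp
      then have "cst (1 / n) \<odot> grad (of_nat n * c) = grad c"
        using False by (simp add: grad_simps cst_inverse(2)[of "of_nat n"])
      ultimately show ?thesis by simp
    qed
  qed
  assume c: "weyl_invariant c"
  obtain N where "c = (\<Sum>n\<le>N. hcomp n c)" using hcomp_decomp by blast
  then have "grad c = (\<Sum>n\<le>N. grad (hcomp n c))" by (metis grad_sum)
  also have "\<dots> \<in> ?T" using hom[OF weyl_invariant_hcomp[OF c] homog_hcomp] by (intro vf.span_sum)
  finally show ?thesis .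
qed

text \<open>A polynomial that vanishes exactly at the points with a nontrivial stabiliser.\<close>

definition moved :: "'a rpoly" where
  "moved = (\<Prod>w\<in>W - {id}. \<Sum>e\<in>E. (pull w (lin e) - lin e) ^ 2)"

lemma ev_moved: "ev moved x = (\<Prod>w\<in>W - {id}. (w x - x) \<bullet> (w x - x))"
proof -
  have "(w x - x) \<bullet> (w x - x) = ev (\<Sum>e\<in>E. (pull w (lin e) - lin e) ^ 2) x" if "w \<in> W" for w
    unfolding parseval[of "w x - x" "w x - x"]
    by (simp add: W_bounded_linear[OF that] inner_diff_right power2_eq_square)
  then show ?thesis unfolding moved_def by (simp del: ev_sum)
qed

lemma moved_nonzero: "moved \<noteq> 0"
  unfolding moved_def
proof (subst prod_zero_iff)
  show "finite (W - {id})" using fin_W by simp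
  show "\<not> (\<exists>w\<in>W - {id}. (\<Sum>e\<in>E. (pull w (lin e) - lin e) ^ 2) = 0)"
  proof
    assume "\<exists>w\<in>W - {id}. (\<Sum>e\<in>E. (pull w (lin e) - lin e) ^ 2) = 0"
    then obtain w where w: "w \<in> W" "w \<noteq> id" "(\<Sum>e\<in>E. (pull w (lin e) - lin e) ^ 2) = 0" by blast
    obtain x where x: "w x \<noteq> x" using w(2) by (metis eq_id_iff)
    have "(w x - x) \<bullet> (w x - x) = ev (\<Sum>e\<in>E. (pull w (lin e) - lin e) ^ 2) x"
      unfolding parseval[of "w x - x" "w x - x"]
      by (simp add: W_bounded_linear[OF w(1)] inner_diff_right power2_eq_square)
    then show False using x unfolding w(3) by simp
  qed
qed

text \<open>At a point with trivial stabiliser every vector is the gradient of an invariant, hence a combination of the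
  gradients of the \<open>fund e\<close>.\<close>

lemma grad_fund_indep: "(\<Sum>e\<in>E. r e \<odot> grad (fund e)) = 0 \<Longrightarrow> e \<in> E \<Longrightarrow> r e = 0"
proof (rule indep_family[OF moved_nonzero])
  fix x u assume x: "ev moved x \<noteq> 0"
  then have "w x \<noteq> x" if "w \<in> W" "w \<noteq> id" for w
    using that fin_W by (auto simp: ev_moved)
  then obtain p where p: "weyl_invariant p" "vev (grad p) x = u" using gradient_interpolation by blast
  obtain r where r: "grad p = (\<Sum>e\<in>E. r e \<odot> grad (fund e))"
    using vf.span_image_sum[OF fin_E grad_in_span[OF p(1)]] by blast
  have "u = (\<Sum>e\<in>E. ev (r e) x *\<^sub>R vev (grad (fund e)) x)" unfolding p(2)[symmetric] r by simp
  then show "\<exists>t. u = (\<Sum>e\<in>E. t e *\<^sub>R vev (grad (fund e)) x)" by (rule exI[of _ "\<lambda>e. ev (r e) x"])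
qed

text \<open>A relation \<open>\<Sum>e. c e * fund e = 0\<close> with invariant coefficients is differentiated, with
  \<open>grad (c e) = \<Sum>j. h e j * grad (fund j)\<close>.  Independence of the gradients gives
  \<open>c j = - (\<Sum>e. h e j * fund e)\<close>, while Euler's formula for \<open>c j\<close> gives
  \<open>deg (c j) * c j = \<Sum>e. h j e * deg (fund e) * fund e\<close>.  The first equation times \<open>deg (fund j)\<close> plus the second
  one expresses \<open>c j\<close> through an antisymmetric matrix \<open>s\<close>, so the relation is a combination of the trivial ones.\<close>

lemma exact_invariant:
  assumes \<theta>: "\<theta> \<in> logder pos" "homogv n \<theta>" "radial \<theta> = 0" and inv: "\<And>w. w \<in> W \<Longrightarrow> weyl_act w \<theta> = \<theta>"
  shows "\<theta> \<in> koszul_span (logder pos)"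
proof -
  obtain c where c: "\<theta> = (\<Sum>e\<in>E. c e \<odot> v e)" "\<And>e. if n < d e then c e = 0 else homog (n - d e) (c e)"
    using free_basis_rep_homog[OF basis \<theta>(1,2)] by blast
  have invc: "weyl_invariant (c e)" if "e \<in> E" for e
    using coeffs_weyl_invariant[of c e] inv that unfolding c(1) by blast
  have homc: "homog (n - d e) (c e)" for e using c(2)[of e] by (auto split: if_splits)
  have "\<forall>e\<in>E. \<exists>h. grad (c e) = (\<Sum>j\<in>E. h j \<odot> grad (fund j))"
    using vf.span_image_sum[OF fin_E grad_in_span] invc by blast
  then obtain h where h: "\<And>e. e \<in> E \<Longrightarrow> grad (c e) = (\<Sum>j\<in>E. h e j \<odot> grad (fund j))"
    by (auto dest!: bchoice)
  have rel: "(\<Sum>e\<in>E. c e * fund e) = 0" using \<theta>(3) unfolding c(1) by (simp add: fund_def)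
  have "0 = grad (\<Sum>e\<in>E. c e * fund e)" by (simp add: rel grad_simps)
  also have "\<dots> = (\<Sum>e\<in>E. c e \<odot> grad (fund e)) + (\<Sum>e\<in>E. fund e \<odot> grad (c e))"
    by (simp add: grad_sum grad_simps sum.distrib)
  also have "(\<Sum>e\<in>E. fund e \<odot> grad (c e)) = (\<Sum>e\<in>E. \<Sum>j\<in>E. (fund e * h e j) \<odot> grad (fund j))"
    by (simp add: h vf.scale_sum_right)
  also have "\<dots> = (\<Sum>j\<in>E. (\<Sum>e\<in>E. fund e * h e j) \<odot> grad (fund j))"
    by (subst sum.swap) (simp add: vf.scale_sum_left)
  finally have "(\<Sum>j\<in>E. (c j + (\<Sum>e\<in>E. fund e * h e j)) \<odot> grad (fund j)) = 0"
    by (simp add: vf.scale_left_distrib sum.distrib)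
  from grad_fund_indep[OF this] have c1: "c j = - (\<Sum>e\<in>E. fund e * h e j)" if "j \<in> E" for j
    using that by (simp add: eq_neg_iff_add_eq_0)
  have c2: "of_nat (n - d j) * c j = (\<Sum>e\<in>E. h j e * (of_nat (Suc (d e)) * fund e))" if j: "j \<in> E" for j
  proof -
    have "of_nat (n - d j) * c j = radial (grad (c j))" using euler[OF homc] by simp
    also have "\<dots> = (\<Sum>e\<in>E. h j e * radial (grad (fund e)))" by (simp add: h[OF j])
    finally show ?thesis by (simp add: euler[OF homog_fund] del: of_nat_Suc)
  qed
  define s where "s j e = h j e * of_nat (Suc (d e)) - h e j * of_nat (Suc (d j))" for j e
  have cs: "of_nat (Suc n) * c j = (\<Sum>e\<in>E. s j e * fund e)" if j: "j \<in> E" for j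
  proof -
    \<comment> \<open>The degrees of \<open>fund j\<close> and \<open>c j\<close> add up to \<open>n + 1\<close> for all \<open>j\<close> with \<open>c j \<noteq> 0\<close>.\<close>
    have "of_nat (Suc n) * c j = of_nat (Suc (d j)) * c j + of_nat (n - d j) * c j"
    proof (cases "n < d j")
      case True then show ?thesis using c(2)[of j] by simp
    next
      case False
      then have "Suc n = Suc (d j) + (n - d j)" by simp
      then show ?thesis by (metis distrib_right of_nat_add)
    qed
    also have "\<dots> = - (\<Sum>e\<in>E. of_nat (Suc (d j)) * (fund e * h e j)) + (\<Sum>e\<in>E. h j e * (of_nat (Suc (d e)) * fund e))"
      unfolding c2[OF j] by (subst c1[OF j]) (simp only: mult_minus_right sum_distrib_left)
    also have "\<dots> = (\<Sum>e\<in>E. h j e * (of_nat (Suc (d e)) * fund e) - of_nat (Suc (d j)) * (fund e * h e j))"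
      by (simp only: sum_subtractf) (simp only: add.commute diff_conv_add_uminus)
    also have "\<dots> = (\<Sum>e\<in>E. s j e * fund e)"
      by (intro sum.cong HOL.refl) (simp add: s_def algebra_simps)
    finally show ?thesis .
  qed
  have santi: "s j e = - s e j" for j e by (simp add: s_def)
  have A: "of_nat (Suc n) \<odot> \<theta> = (\<Sum>j\<in>E. \<Sum>e\<in>E. (s j e * fund e) \<odot> v j)"
    unfolding c(1) by (simp add: vf.scale_sum_right vf.scale_sum_left[symmetric] cs del: of_nat_Suc)
  then have B: "of_nat (Suc n) \<odot> \<theta> = (\<Sum>j\<in>E. \<Sum>e\<in>E. (s e j * fund j) \<odot> v e)"
    by (subst sum.swap)
  have "of_nat (Suc n) \<odot> \<theta> + of_nat (Suc n) \<odot> \<theta> = (\<Sum>j\<in>E. \<Sum>e\<in>E. (s j e * fund e) \<odot> v j + (s e j * fund j) \<odot> v e)"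
    by (subst (1) A, subst B) (simp add: sum.distrib)
  also have "\<dots> = (\<Sum>j\<in>E. \<Sum>e\<in>E. s j e \<odot> koszul (v e) (v j))"
  proof (intro sum.cong HOL.refl)
    fix j e
    show "(s j e * fund e) \<odot> v j + (s e j * fund j) \<odot> v e = s j e \<odot> koszul (v e) (v j)"
      by (subst santi[of e j]) (simp add: koszul_def fund_def algebra_simps)
  qed
  also have "\<dots> \<in> koszul_span (logder pos)"
    using free_basis_mem[OF basis]
    by (intro vf.subspace_sum[OF subspace_koszul_span] vf.subspace_scale[OF subspace_koszul_span] koszul_in_koszul_span) auto
  finally have "cst (1 / (2 * Suc n)) \<odot> (of_nat (Suc n) \<odot> \<theta> + of_nat (Suc n) \<odot> \<theta>) \<in> koszul_span (logder pos)"
    by (rule vf.subspace_scale[OF subspace_koszul_span])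
  moreover have "cst (1 / (2 * Suc n)) \<odot> (of_nat (Suc n) \<odot> \<theta> + of_nat (Suc n) \<odot> \<theta>) = \<theta>"
  proof -
    have eq: "of_nat (Suc n) + of_nat (Suc n) = (cst (2 * Suc n) :: 'a rpoly)"
      by (rule rpoly_eqI) (simp only: ev_simps ev_of_nat, simp)
    have "cst (1 / (2 * Suc n)) * (of_nat (Suc n) + of_nat (Suc n)) = (1 :: 'a rpoly)"
      unfolding eq by (rule cst_inverse(2)) simp
    then show ?thesis by (metis vf.scale_left_distrib vf.scale_one vf.scale_scale)
  qed
  ultimately show ?thesis by simp
qed

text \<open>By induction on the degree one may pass from \<open>\<theta>\<close> to its average over the Weyl group: the differences
  \<open>\<xi> - s \<xi>\<close> are of the form \<open>a \<eta>\<close> with \<open>radial \<eta> = 0\<close> and \<open>\<eta>\<close> of smaller degree.\<close>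

lemma exact_homog:
  "\<theta> \<in> logder pos \<Longrightarrow> homogv n \<theta> \<Longrightarrow> radial \<theta> = 0 \<Longrightarrow> \<theta> \<in> koszul_span (logder pos)"
proof (induction n arbitrary: \<theta> rule: less_induct)
  case (less n)
  define S where "S = {\<theta>\<in>logder pos. homogv n \<theta> \<and> radial \<theta> = 0}"
  have step: "weyl_act (reflection a) \<xi> \<in> S \<and> \<xi> - weyl_act (reflection a) \<xi> \<in> koszul_span (logder pos)"
    if a: "a \<in> \<Phi>" and \<xi>: "\<xi> \<in> S" for a \<xi>
  proof
    have s: "reflection a \<in> W" by (rule W_reflection[OF a])
    have e0: "radial (weyl_act (reflection a) \<xi>) = 0"
      using \<xi> W_bounded_linear[OF W_inv(1)[OF s]] by (simp add: radial_weyl_act[OF s] S_def pull_simps)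
    show "weyl_act (reflection a) \<xi> \<in> S" using \<xi> weyl_act_logder homogv_weyl_act s e0 by (simp add: S_def)
    consider "\<xi> - weyl_act (reflection a) \<xi> = 0"
      | \<eta> where "n > 0" "\<eta> \<in> logder pos" "homogv (n - 1) \<eta>" "\<xi> - weyl_act (reflection a) \<xi> = lin a \<odot> \<eta>"
      using reflection_diff_homog[of \<xi> n a] \<xi> a unfolding S_def by blast
    then show "\<xi> - weyl_act (reflection a) \<xi> \<in> koszul_span (logder pos)"
    proof cases
      case 1 then show ?thesis by (simp add: vf.subspace_0[OF subspace_koszul_span])
    next
      case 2
      have "lin a * radial \<eta> = radial (\<xi> - weyl_act (reflection a) \<xi>)" by (simp add: 2(4))
      also have "\<dots> = 0" using \<xi> e0 by (simp add: S_def)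
      finally have "radial \<eta> = 0" using a crystallographicD(2)[OF crystallographic] by auto
      then have "\<eta> \<in> koszul_span (logder pos)" using less.IH[of "n - 1"] 2 by simp
      then show ?thesis unfolding 2(4) by (rule vf.subspace_scale[OF subspace_koszul_span])
    qed
  qed
  have \<theta>S: "\<theta> \<in> S" using less.prems by (simp add: S_def)
  have W: "weyl_act w \<theta> \<in> S" "\<theta> - weyl_act w \<theta> \<in> koszul_span (logder pos)" if "w \<in> W" for w
    using W_diff_induct[OF subspace_koszul_span that step \<theta>S] by auto
  have "\<theta> - weyl_avg \<theta> \<in> koszul_span (logder pos)" by (rule weyl_avg_diff[OF subspace_koszul_span W(2)])
  moreover have "weyl_avg \<theta> \<in> koszul_span (logder pos)"
  proof (rule exact_invariant)
    show "weyl_avg \<theta> \<in> logder pos" using W(1) by (intro weyl_avg_closed subspace_logder) (auto simp: S_def)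
    show "homogv n (weyl_avg \<theta>)" by (rule homogv_weyl_avg[OF less.prems(2)])
    show "radial (weyl_avg \<theta>) = 0" using W(1) by (simp add: weyl_avg_def S_def)
    show "weyl_act w (weyl_avg \<theta>) = weyl_avg \<theta>" if "w \<in> W" for w by (rule weyl_act_weyl_avg[OF that])
  qed
  ultimately have "(\<theta> - weyl_avg \<theta>) + weyl_avg \<theta> \<in> koszul_span (logder pos)" by (rule vf.subspace_add[OF subspace_koszul_span])
  then show ?case by simp
qed

lemma exact_top: "koszul_exact (logder pos)"
  unfolding koszul_exact_def
proof (intro ballI impI)
  fix \<theta> assume \<theta>: "\<theta> \<in> logder pos" "radial \<theta> = 0"
  obtain N where "\<theta> = (\<Sum>n\<le>N. vcomp n \<theta>)" using vcomp_decomp by blast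
  also have "\<dots> \<in> koszul_span (logder pos)"
    using exact_homog[OF vcomp_logder[OF \<theta>(1)] homogv_vcomp] by (intro vf.subspace_sum[OF subspace_koszul_span]) (simp add: radial_vcomp \<theta>(2))
  finally show "\<theta> \<in> koszul_span (logder pos)" .
qed

end

context roots_frame
begin

lemma koszul_exact_pos: "koszul_exact (logder pos)"
proof -
  obtain v d where vd: "free_basis v d pos" "\<forall>e\<in>E. \<forall>w\<in>W. weyl_act w (v e) = v e"
    using invariant_basis by blast
  interpret invariant_basis \<Phi> \<Delta> E v d by standard (use vd in auto)
  show ?thesis by (rule exact_top)
qed

lemma koszul_stepI:
  assumes "lower I" "lower (insert b I)" "b \<notin> I" "koszul_exact (logder (insert b I))"
  shows "\<exists>B \<phi> k. koszul_step E B b \<phi> k \<and>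
      vf.span (insert (lin b \<odot> \<phi>) B) = logder (insert b I) \<and> vf.span (insert \<phi> B) = logder I"
proof -
  obtain B \<phi> k where B: "\<forall>g\<in>B. \<exists>d. homogv d g" "homogv k \<phi>" "b \<noteq> 0" "\<forall>r. r \<odot> \<phi> \<in> vf.span B \<longrightarrow> r = 0"
    "vf.span (insert (lin b \<odot> \<phi>) B) = logder (insert b I)" "vf.span (insert \<phi> B) = logder I"
    using koszul_step_data[OF assms(1-3)] by (elim exE conjE) (rule that)
  have ex: "koszul_exact (vf.span (insert (lin b \<odot> \<phi>) B))" unfolding B(5) by (rule assms(4))
  have "koszul_step E B b \<phi> k"
  proof unfold_locales
    show "\<forall>g\<in>B. \<exists>d. homogv d g" "homogv k \<phi>" "b \<noteq> 0" by (fact B)+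
    show "r = 0" if "r \<odot> \<phi> \<in> vf.span B" for r using B(4) that by blast
  qed (fact ex)
  then show ?thesis using B(5,6) by (intro exI conjI)
qed

text \<open>The roots outside of \<open>I\<close> are removed from \<open>\<Phi>\<^sup>+\<close> in the order of decreasing height, so that all sets on the way
  are lower ideals.\<close>

lemma koszul_exact_lower: "lower I \<Longrightarrow> koszul_exact (logder I)"
proof (induction "card (pos - I)" arbitrary: I)
  case 0
  then have "I = pos" using lower_pos fin_pos by auto
  then show ?case using koszul_exact_pos by simp
next
  case (Suc n)
  have "finite (pos - I)" using fin_pos by simp
  moreover have "pos - I \<noteq> {}" using Suc.hyps(2) by (metis card.empty nat.distinct(1))
  ultimately have "Min (pred_ht ` (pos - I)) \<in> pred_ht ` (pos - I)" by (intro Min_in) auto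
  then obtain b where b: "Min (pred_ht ` (pos - I)) = pred_ht b" "b \<in> pos - I" by (rule imageE)
  have "pred_ht b \<le> pred_ht a" if "a \<in> pos" "a \<notin> I" for a
    using that \<open>finite (pos - I)\<close> unfolding b(1)[symmetric] by (intro Min_le) auto
  then have low: "lower (insert b I)" using lower_insert_min[OF Suc.prems] b(2) by blast
  have "pos - insert b I = (pos - I) - {b}" by auto
  then have "card (pos - insert b I) = n" using Suc.hyps(2) b(2) \<open>finite (pos - I)\<close> by simp
  then have ex: "koszul_exact (logder (insert b I))" using Suc.hyps(1) low by blast
  obtain B \<phi> k where B: "koszul_step E B b \<phi> k" "vf.span (insert \<phi> B) = logder I"
    using koszul_stepI[OF Suc.prems low _ ex] b(2) by blast
  show ?case using koszul_step.exact_removed[OF B(1)] B(2) by simp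
qed

section \<open>The socle\<close>

text \<open>By \<open>socle_step\<close> a socle element for \<open>J\<close> is \<open>b\<close> times one for \<open>J - {b}\<close>, if \<open>b\<close> is a root of maximal height
  in \<open>J\<close>.  For the empty set the quotient is the ground field, spanned by the empty product.\<close>

lemma socle:
  "lower J \<Longrightarrow> (\<And>v. \<exists>a\<in>logder J. lin v * h = radial a) \<Longrightarrow> \<exists>c. \<exists>a\<in>logder J. h = cst c * (\<Prod>g\<in>J. lin g) + radial a"
proof (induction "card J" arbitrary: J h)
  case 0
  then have "J = {}" using lower_fin by auto
  obtain a where "h - cst (ev h 0) = radial a" using homog_pos_in_radial[of "h - cst (ev h 0)"] by auto
  then have "h = cst (ev h 0) * (\<Prod>g\<in>J. lin g) + radial a" using \<open>J = {}\<close> by (simp add: algebra_simps)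
  moreover have "a \<in> logder J" using \<open>J = {}\<close> by (simp add: logder_def)
  ultimately show ?case by blast
next
  case (Suc n)
  have fin: "finite J" "J \<noteq> {}" using Suc.hyps(2) lower_fin[OF Suc.prems(1)] by auto
  then have "Max (pred_ht ` J) \<in> pred_ht ` J" by (intro Max_in) auto
  then obtain b where b: "Max (pred_ht ` J) = pred_ht b" "b \<in> J" by (rule imageE)
  have bmax: "pred_ht a \<le> pred_ht b" if "a \<in> J" for a using fin that unfolding b(1)[symmetric] by simp
  define I where "I = J - {b}"
  have I: "lower I" unfolding I_def by (rule lower_remove_max[OF Suc.prems(1) b(2) bmax])
  have J: "insert b I = J" "b \<notin> I" using b(2) by (auto simp: I_def)
  have "koszul_exact (logder (insert b I))" using koszul_exact_lower Suc.prems(1) J(1) by simp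
  then obtain B \<phi> k where B: "koszul_step E B b \<phi> k" "vf.span (insert (lin b \<odot> \<phi>) B) = logder J"
    "vf.span (insert \<phi> B) = logder I"
    using koszul_stepI[OF I _ J(2)] Suc.prems(1) J(1) by auto
  obtain r a where ra: "a \<in> logder J" "h = lin b * r + radial a" "\<And>v. \<exists>a\<in>logder I. lin v * r = radial a"
    using koszul_step.socle_step[OF B(1), of h] Suc.prems(2) unfolding B(2,3) by blast
  have "card I = n" using Suc.hyps(2) b(2) fin by (simp add: I_def)
  then obtain c a' where ca: "a' \<in> logder I" "r = cst c * (\<Prod>g\<in>I. lin g) + radial a'"
    using Suc.hyps(1)[OF _ I ra(3)] by blast
  have "(\<Prod>g\<in>J. lin g) = lin b * (\<Prod>g\<in>I. lin g)"
    unfolding I_def using fin(1) b(2) by (rule prod.remove)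
  then have "h = cst c * (\<Prod>g\<in>J. lin g) + radial (lin b \<odot> a' + a)"
    unfolding ra(2) ca(2) by (simp add: algebra_simps)
  moreover have "lin b \<odot> a' + a \<in> logder J"
  proof -
    have "lin b \<odot> a' \<in> logder J" using ca(1) unfolding J(1)[symmetric] by (auto simp: logder_def)
    then show ?thesis using ra(1) by (rule vf.subspace_add[OF subspace_logder])
  qed
  ultimately show ?case by blast
qed

lemma weyl_invariant_reflections:
  assumes "\<And>a. a \<in> \<Phi> \<Longrightarrow> pull (reflection a) p = p"
  shows "weyl_invariant p"
  unfolding weyl_invariant_def
proof
  fix w assume "w \<in> W"
  then have "\<forall>x. ev p (w x) = ev p x"
  proof (induction rule: weyl_group.induct)
    case (refl a w)
    have "ev p (reflection a y) = ev p y" for y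
      using assms[OF refl(1)] ev_pull[OF bounded_linear_reflection, of a p y] by simp
    then show ?case using refl by simp
  qed simp
  then show "pull w p = p" using W_bounded_linear[OF \<open>w \<in> W\<close>] by (intro rpoly_eqI) simp
qed

text \<open>The root \<open>a\<close> is a zero of the polynomial \<open>\<Prod>g\<in>\<Phi>. (T - g)\<close>; apart from the leading one its coefficients are
  invariants of positive degree, namely the elementary symmetric polynomials in the roots, up to sign.\<close>

lemma root_power_in_ideal:
  assumes a: "a \<in> \<Phi>"
  shows "\<exists>\<theta>\<in>logder pos. lin a ^ card \<Phi> = radial \<theta>"
proof -
  define s where "s k = (\<Sum>X\<in>{X\<in>Pow \<Phi>. card X = k}. \<Prod>g\<in>X. lin g)" for k
  have fin: "finite \<Phi>" by (rule fin_\<Psi>)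
  have fin_sub: "finite X" if "X \<in> Pow \<Phi>" for X using that fin finite_subset by blast
  have "weyl_invariant (s k)" for k
  proof (rule weyl_invariant_reflections)
    fix c assume c: "c \<in> \<Phi>"
    have inj: "inj_on (reflection c) X" for X by (rule inj_on_inverseI[of _ "reflection c"]) (rule reflection_reflection)
    have "pull (reflection c) (s k) = (\<Sum>X\<in>{X\<in>Pow \<Phi>. card X = k}. \<Prod>g\<in>X. lin (reflection c g))"
      unfolding s_def by (rule rpoly_eqI) (simp add: bounded_linear_reflection inner_reflection_swap)
    also have "\<dots> = (\<Sum>X\<in>{X\<in>Pow \<Phi>. card X = k}. \<Prod>g\<in>reflection c ` X. lin g)"
      by (simp add: prod.reindex[OF inj])
    also have "\<dots> = s k" unfolding s_def
      by (rule sum.reindex_bij_witness[of _ "image (reflection c)" "image (reflection c)"])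
        (use crystallographicD(3)[OF crystallographic c] in \<open>auto simp: image_image reflection_reflection card_image[OF inj]\<close>)
    finally show "pull (reflection c) (s k) = s k" .
  qed
  moreover have "homog k (s k)" for k
  proof -
    have "homog (card X) (\<Prod>g\<in>X. lin g)" for X :: "'a set"
      using homog_prod[of X "\<lambda>_. 1" lin] by simp
    then show ?thesis unfolding s_def by (intro homog_sum) auto
  qed
  ultimately have sk: "\<exists>b\<in>logder pos. s k = radial b" if "k > 0" for k using inv_homog_in_ideal that by blast
  then obtain b where b: "\<And>k. k > 0 \<Longrightarrow> b k \<in> logder pos \<and> s k = radial (b k)" by metis
  have "0 = (\<Prod>g\<in>\<Phi>. lin a - lin g)" using a fin by (intro prod_zero[symmetric]) auto
  also have "\<dots> = (\<Sum>X\<in>Pow \<Phi>. (-1) ^ card X * (\<Prod>g\<in>X. lin g) * (\<Prod>g\<in>\<Phi> - X. lin a))"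
    by (rule prod_diff_conv_sum[OF fin])
  also have "\<dots> = (\<Sum>k\<le>card \<Phi>. \<Sum>X\<in>{X\<in>Pow \<Phi>. card X = k}. (-1) ^ card X * (\<Prod>g\<in>X. lin g) * (\<Prod>g\<in>\<Phi> - X. lin a))"
    by (rule sum.group[symmetric]) (use fin in \<open>auto intro: card_mono\<close>)
  also have "\<dots> = (\<Sum>k\<le>card \<Phi>. (-1) ^ k * lin a ^ (card \<Phi> - k) * s k)"
  proof (rule sum.cong[OF HOL.refl])
    fix k
    have "(-1) ^ card X * (\<Prod>g\<in>X. lin g) * (\<Prod>g\<in>\<Phi> - X. lin a) = (-1) ^ k * lin a ^ (card \<Phi> - k) * (\<Prod>g\<in>X. lin g)"
      if "X \<in> {X\<in>Pow \<Phi>. card X = k}" for X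
      using that fin_sub[of X] by (simp add: card_Diff_subset)
    then show "(\<Sum>X\<in>{X\<in>Pow \<Phi>. card X = k}. (-1) ^ card X * (\<Prod>g\<in>X. lin g) * (\<Prod>g\<in>\<Phi> - X. lin a))
        = (-1) ^ k * lin a ^ (card \<Phi> - k) * s k"
      unfolding s_def sum_distrib_left by (intro sum.cong HOL.refl)
  qed
  also have "\<dots> = lin a ^ card \<Phi> * s 0 + (\<Sum>k\<in>{0<..card \<Phi>}. (-1) ^ k * lin a ^ (card \<Phi> - k) * s k)"
  proof -
    have "{..card \<Phi>} = insert 0 {0<..card \<Phi>}" by auto
    then show ?thesis by simp
  qed
  also have "s 0 = 1"
  proof -
    have "{X\<in>Pow \<Phi>. card X = 0} = {{}}" using fin_sub by (auto simp: card_eq_0_iff)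
    then show ?thesis by (simp add: s_def)
  qed
  also have "(\<Sum>k\<in>{0<..card \<Phi>}. (-1) ^ k * lin a ^ (card \<Phi> - k) * s k)
      = radial (\<Sum>k\<in>{0<..card \<Phi>}. ((-1) ^ k * lin a ^ (card \<Phi> - k)) \<odot> b k)"
    using b by simp
  finally have "lin a ^ card \<Phi> = radial (- (\<Sum>k\<in>{0<..card \<Phi>}. ((-1) ^ k * lin a ^ (card \<Phi> - k)) \<odot> b k))"
    by (simp add: eq_neg_iff_add_eq_0 del: radial_sum)
  moreover have "- (\<Sum>k\<in>{0<..card \<Phi>}. ((-1) ^ k * lin a ^ (card \<Phi> - k)) \<odot> b k) \<in> logder pos"
    using b by (intro vf.subspace_neg[OF subspace_logder] vf.subspace_sum[OF subspace_logder] vf.subspace_scale[OF subspace_logder]) auto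
  ultimately show ?thesis by blast
qed

text \<open>If no multiple of \<open>p\<close> by a monomial in the roots represented a socle element, one could multiply \<open>p\<close> by arbitrarily
  many roots without entering the ideal; but one of them would occur often enough for its power to lie in the
  ideal.\<close>

lemma socle_multiple:
  assumes J: "lower J" and p: "p \<notin> radial ` logder J"
  shows "\<exists>q c. \<exists>a\<in>logder J. c \<noteq> 0 \<and> q * p = cst c * (\<Prod>g\<in>J. lin g) + radial a"
proof -
  define Z where "Z = radial ` logder J"
  have Zmult: "q * z \<in> Z" if z: "z \<in> Z" for q z
  proof -
    obtain a where "a \<in> logder J" "z = radial a" using z by (auto simp: Z_def)
    then have 1: "q \<odot> a \<in> logder J" and 2: "q * z = radial (q \<odot> a)"
      by (auto intro: vf.subspace_scale[OF subspace_logder])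
    show ?thesis using 1 unfolding Z_def 2 by (rule imageI)
  qed
  have Zadd: "y + z \<in> Z" if yz: "y \<in> Z" "z \<in> Z" for y z
  proof -
    obtain a b where "a \<in> logder J" "y = radial a" "b \<in> logder J" "z = radial b" using yz by (auto simp: Z_def)
    then have 1: "a + b \<in> logder J" and 2: "y + z = radial (a + b)"
      by (auto intro: vf.subspace_add[OF subspace_logder])
    show ?thesis using 1 unfolding Z_def 2 by (rule imageI)
  qed
  define N where "N = card \<Phi>"
  have "\<exists>q. q * p \<notin> Z \<and> (\<forall>g\<in>\<Phi>. lin g * (q * p) \<in> Z)"
  proof (rule ccontr)
    assume no: "\<not> ?thesis"
    have "\<exists>m. (\<Sum>g\<in>\<Phi>. m g) = k \<and> (\<Prod>g\<in>\<Phi>. lin g ^ m g) * p \<notin> Z" for k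
    proof (induction k)
      case 0 then show ?case using p by (intro exI[of _ "\<lambda>_. 0"]) (simp add: Z_def)
    next
      case (Suc k)
      then obtain m where m: "(\<Sum>g\<in>\<Phi>. m g) = k" "(\<Prod>g\<in>\<Phi>. lin g ^ m g) * p \<notin> Z" by blast
      then obtain g where g: "g \<in> \<Phi>" "lin g * ((\<Prod>g\<in>\<Phi>. lin g ^ m g) * p) \<notin> Z" using no by blast
      define m' where "m' = m(g := Suc (m g))"
      have "(\<Sum>h\<in>\<Phi>. m' h) = Suc k"
        using m(1) g(1) fin_\<Psi> by (simp add: m'_def sum.remove[of \<Phi> g])
      moreover have "(\<Prod>h\<in>\<Phi>. lin h ^ m' h) = lin g * (\<Prod>h\<in>\<Phi>. lin h ^ m h)"
      proof -
        have "(\<Prod>h\<in>\<Phi> - {g}. lin h ^ m' h) = (\<Prod>h\<in>\<Phi> - {g}. lin h ^ m h)"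
          by (intro prod.cong) (auto simp: m'_def)
        then show ?thesis using g(1) fin_\<Psi> by (simp add: prod.remove[of \<Phi> g] m'_def mult.assoc)
      qed
      then have "(\<Prod>h\<in>\<Phi>. lin h ^ m' h) * p \<notin> Z" using g(2) by (simp only: mult.assoc not_False_eq_True)
      ultimately show ?case by (intro exI[of _ m'] conjI)
    qed
    then obtain m where m: "(\<Sum>g\<in>\<Phi>. m g) = N * N + 1" "(\<Prod>g\<in>\<Phi>. lin g ^ m g) * p \<notin> Z" by blast
    have "\<exists>g\<in>\<Phi>. N \<le> m g"
    proof (rule ccontr)
      assume "\<not> (\<exists>g\<in>\<Phi>. N \<le> m g)"
      then have "(\<Sum>g\<in>\<Phi>. m g) \<le> (\<Sum>g\<in>\<Phi>. N)" by (intro sum_mono) (auto simp: not_le less_imp_le)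
      then show False using m(1) by (simp add: N_def)
    qed
    then obtain g where g: "g \<in> \<Phi>" "N \<le> m g" by blast
    obtain \<theta> where "\<theta> \<in> logder pos" "lin g ^ N = radial \<theta>" using root_power_in_ideal[OF g(1)] by (auto simp: N_def)
    then have "lin g ^ N \<in> Z" using logder_mono[OF lower_pos[OF J]] by (auto simp: Z_def)
    moreover have "lin g ^ N dvd (\<Prod>g\<in>\<Phi>. lin g ^ m g) * p"
    proof -
      have "lin g ^ N dvd lin g ^ m g" using g(2) by (rule le_imp_power_dvd)
      also have "\<dots> dvd (\<Prod>g\<in>\<Phi>. lin g ^ m g)" using g(1) fin_\<Psi> by (intro dvd_prodI)
      finally show ?thesis by (rule dvd_mult2)
    qed
    then obtain k where "(\<Prod>g\<in>\<Phi>. lin g ^ m g) * p = lin g ^ N * k" by (rule dvdE)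
    ultimately show False using m(2) Zmult[of "lin g ^ N" k] by (simp add: mult.commute)
  qed
  then obtain q where q: "q * p \<notin> Z" "\<And>g. g \<in> \<Phi> \<Longrightarrow> lin g * (q * p) \<in> Z" by blast
  have "\<exists>a\<in>logder J. lin v * (q * p) = radial a" for v
  proof -
    \<comment> \<open>The roots span the space of linear forms, so being annihilated by the roots is enough.\<close>
    have "v \<in> span \<Phi>" by (simp add: span_\<Phi>)
    then have "lin v * (q * p) \<in> Z"
    proof (induction rule: span_induct_alt)
      case base
      have "0 \<in> Z" unfolding Z_def using vf.subspace_0[OF subspace_logder] by (intro image_eqI[of _ _ 0]) auto
      then show ?case by (simp add: lin_simps)
    next
      case (step c x y)
      have "lin (c *\<^sub>R x + y) * (q * p) = cst c * (lin x * (q * p)) + lin y * (q * p)"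
        by (simp add: lin_simps algebra_simps)
      then show ?case using step q(2) Zadd Zmult by simp
    qed
    then show ?thesis by (auto simp: Z_def)
  qed
  from socle[OF J this] obtain c a where ca: "a \<in> logder J" "q * p = cst c * (\<Prod>g\<in>J. lin g) + radial a" by blast
  have "c \<noteq> 0"
  proof
    assume "c = 0"
    then have "q * p = radial a" using ca(2) by (simp add: cst_simps)
    then show False using q(1) ca(1) by (auto simp: Z_def)
  qed
  then show ?thesis using ca by blast
qed

end

section \<open>Differential operators\<close>

context frame
begin

definition pdiff :: "'a rpoly \<Rightarrow> 'a rpoly \<Rightarrow> 'a rpoly" where
  "pdiff p g = Rpoly (diff_op (ev p) (ev g))"

lemma const_coeff_ex: "\<exists>D. const_coeff (ev (p :: 'a rpoly)) D"
  by (rule poly_const_coeff[OF fin_E span_E rpf_ev])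

lemma diff_op_ev: "const_coeff (ev (p :: 'a rpoly)) D \<Longrightarrow> diff_op (ev p) (ev g) = D (ev g)"
  by (rule diff_op_eq[OF fin_E span_E rpf_ev])

lemma ev_pdiff: "ev (pdiff p g) = diff_op (ev p) (ev g)"
proof -
  obtain D where "const_coeff (ev p) D" using const_coeff_ex by blast
  then have "real_polynomial_function (diff_op (ev p) (ev g))"
    using diff_op_ev const_coeff_apply_poly[OF _ rpf_ev[of g]] by metis
  then show ?thesis by (simp add: pdiff_def ev_Rpoly)
qed

lemma ev_pdiff_eq: "const_coeff (ev p) D \<Longrightarrow> ev (pdiff p g) = D (ev g)"
  by (simp add: ev_pdiff diff_op_ev)

lemma ev_inject_iff: "ev p = ev q \<Longrightarrow> p = q"
  by (simp add: ev_inject)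

lemma pdiff_mult: "pdiff (p * q) g = pdiff p (pdiff q g)"
proof -
  obtain D where D: "const_coeff (ev p) D" using const_coeff_ex by blast
  obtain F where F: "const_coeff (ev q) F" using const_coeff_ex by blast
  have "const_coeff (ev (p * q)) (\<lambda>h. D (F h))"
    unfolding times_rpoly.rep_eq using const_coeff.mult[OF D F] .
  then have "ev (pdiff (p * q) g) = D (F (ev g))" by (rule ev_pdiff_eq)
  also have "\<dots> = ev (pdiff p (pdiff q g))" by (simp add: ev_pdiff_eq[OF D] ev_pdiff_eq[OF F])
  finally show ?thesis by (rule ev_inject_iff)
qed

lemma pdiff_add_left: "pdiff (p + q) g = pdiff p g + pdiff q g"
proof -
  obtain D where D: "const_coeff (ev p) D" using const_coeff_ex by blast
  obtain F where F: "const_coeff (ev q) F" using const_coeff_ex by blast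
  have "const_coeff (ev (p + q)) (\<lambda>h x. D h x + F h x)"
    unfolding plus_rpoly.rep_eq using const_coeff.add[OF D F] .
  then have "ev (pdiff (p + q) g) = (\<lambda>x. D (ev g) x + F (ev g) x)" by (rule ev_pdiff_eq)
  also have "\<dots> = ev (pdiff p g + pdiff q g)" by (simp add: plus_rpoly.rep_eq ev_pdiff_eq[OF D] ev_pdiff_eq[OF F])
  finally show ?thesis by (rule ev_inject_iff)
qed

lemma pdiff_cst: "pdiff (cst c) g = cst c * g"
proof -
  have "const_coeff (ev (cst c :: 'a rpoly)) (\<lambda>g x. c * g x)"
    unfolding cst.rep_eq by (rule const_coeff.const)
  then have "ev (pdiff (cst c) g) = (\<lambda>x. c * ev g x)" by (rule ev_pdiff_eq)
  then show ?thesis by (intro rpoly_eqI) simp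
qed

lemma pdiff_lin: "pdiff (lin v) g = dderiv v g"
proof -
  have "const_coeff (ev (lin v)) (dir_deriv v)"
    unfolding lin.rep_eq by (rule const_coeff.linear)
  then have "ev (pdiff (lin v) g) = dir_deriv v (ev g)" by (rule ev_pdiff_eq)
  then show ?thesis by (intro ev_inject_iff) (simp add: dderiv.rep_eq)
qed

lemma pdiff_add_right: "pdiff p (g + h) = pdiff p g + pdiff p h"
proof -
  obtain D where D: "const_coeff (ev p) D" using const_coeff_ex by blast
  have "ev (pdiff p (g + h)) = ev (pdiff p g + pdiff p h)"
    unfolding plus_rpoly.rep_eq ev_pdiff_eq[OF D] by (rule const_coeff_apply_add[OF D rpf_ev rpf_ev])
  then show ?thesis by (rule ev_inject_iff)
qed

lemma pdiff_0_right: "pdiff p 0 = 0"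
proof -
  have "pdiff p 0 + 0 = pdiff p 0 + pdiff p 0" using pdiff_add_right[of p 0 0] by (simp only: add_0_right)
  then show ?thesis by (simp only: add_left_cancel)
qed

lemma pdiff_0_left: "pdiff 0 g = 0"
  using pdiff_cst[of 0 g] by (simp add: cst_simps)

lemma pdiff_uminus_right: "pdiff p (- g) = - pdiff p g"
  using pdiff_add_right[of p g "- g"] pdiff_0_right[of p] by (simp add: add_eq_0_iff)

lemma pdiff_sum_left: "pdiff (\<Sum>i\<in>A. q i) g = (\<Sum>i\<in>A. pdiff (q i) g)"
  by (induction A rule: infinite_finite_induct) (auto simp: pdiff_0_left pdiff_add_left)

lemma rpoly_induct [case_names cst lin add mult]:
  fixes P :: "'a rpoly \<Rightarrow> bool"
  assumes "\<And>c. P (cst c)" "\<And>a. P (lin a)" "\<And>p q. P p \<Longrightarrow> P q \<Longrightarrow> P (p + q)" "\<And>p q. P p \<Longrightarrow> P q \<Longrightarrow> P (p * q)"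
  shows "P p"
proof -
  obtain D where D: "const_coeff (ev p) D" using const_coeff_ex by blast
  have "P (Rpoly h)" if "const_coeff h D" for h D
    using that
  proof (induction rule: const_coeff.induct)
    case (const c) then show ?case using assms(1)[of c] ev_inverse[of "cst c :: 'a rpoly"] by (simp add: cst.rep_eq)
  next
    case (linear v) then show ?case using assms(2)[of v] ev_inverse[of "lin v"] by (simp add: lin.rep_eq)
  next
    case (add f D g F)
    have "Rpoly (\<lambda>x. f x + g x) = Rpoly f + Rpoly g"
      by (rule rpoly_eqI) (simp add: ev_Rpoly const_coeff_poly[OF add.hyps(1)] const_coeff_poly[OF add.hyps(2)] real_polynomial_function.intros(3))
    then show ?case using assms(3) add.IH by simp
  next
    case (mult f D g F)
    have "Rpoly (\<lambda>x. f x * g x) = Rpoly f * Rpoly g"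
      by (rule rpoly_eqI) (simp add: ev_Rpoly const_coeff_poly[OF mult.hyps(1)] const_coeff_poly[OF mult.hyps(2)] real_polynomial_function.intros(4))
    then show ?case using assms(4) mult.IH by simp
  qed
  from this[OF D] show ?thesis by (simp add: ev_inverse)
qed

text \<open>It suffices to see this for linear forms, where it is the chain rule.  The map \<open>L\<close> will be a reflection or a
  scaling; for a scaling the statement compares degrees.\<close>

lemma pdiff_pull:
  assumes L: "bounded_linear L" and self: "\<And>x y. x \<bullet> L y = L x \<bullet> y"
  shows "pdiff p (pull L g) = pull L (pdiff (pull L p) g)"
proof (induction p arbitrary: g rule: rpoly_induct)
  case (cst c) then show ?case by (simp add: pdiff_cst pull_simps[OF L])
next
  case (lin a)
  have "pull L (lin a) = lin (L a)" by (rule rpoly_eqI) (simp add: L self)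
  then show ?case by (simp add: pdiff_lin dderiv_pull[OF L])
next
  case (add p q) then show ?case by (simp add: pdiff_add_left pull_simps[OF L])
next
  case (mult p q) then show ?case by (simp add: pdiff_mult pull_simps[OF L])
qed

text \<open>Multiplication by \<open>lin e\<close> is adjoint to the derivative in direction \<open>e\<close>.  With Euler's formula
  \<open>n p = \<Sum>e. lin e * dderiv e p\<close> this expresses the pairing of \<open>p\<close> with itself by those of its derivatives, up
  to the factor \<open>n\<close>.\<close>

lemma pdiff_self_pos: "homog n p \<Longrightarrow> p \<noteq> 0 \<Longrightarrow> ev (pdiff p p) 0 > 0"
proof (induction n arbitrary: p)
  case 0
  then have p: "p = cst (ev p 0)" by (simp add: homog_0_iff)
  have "ev p 0 \<noteq> 0"
  proof
    assume 0: "ev p 0 = 0"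
    have "p = 0" using p unfolding 0 cst_simps(1) .
    then show False using \<open>p \<noteq> 0\<close> by simp
  qed
  moreover have "pdiff p p = p * p" using pdiff_cst[of "ev p 0" p] unfolding p[symmetric] .
  ultimately show ?case by (simp add: zero_less_mult_iff linorder_neq_iff disj_commute)
next
  case (Suc n)
  have hom: "homog n (dderiv e p)" for e using homog_dderiv[OF Suc.prems(1)] by simp
  have eu: "of_nat (Suc n) * p = (\<Sum>e\<in>E. lin e * dderiv e p)"
    using euler[OF Suc.prems(1)] by (simp add: radial_def coord_grad)
  have nn: "ev (pdiff (dderiv e p) (dderiv e p)) 0 \<ge> 0" for e
    using Suc.IH[OF hom, of e] by (cases "dderiv e p = 0") (auto simp: pdiff_0_left)
  have "\<exists>e\<in>E. dderiv e p \<noteq> 0"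
  proof (rule ccontr)
    assume "\<not> (\<exists>e\<in>E. dderiv e p \<noteq> 0)"
    then have "of_nat (Suc n) * p = 0" unfolding eu by simp
    moreover have "(of_nat (Suc n) :: 'a rpoly) \<noteq> 0"
    proof
      assume "(of_nat (Suc n) :: 'a rpoly) = 0"
      from arg_cong[OF this, of "\<lambda>p. ev p 0"] show False by (simp del: of_nat_Suc)
    qed
    ultimately show False using Suc.prems(2) by simp
  qed
  then obtain e where e: "e \<in> E" "dderiv e p \<noteq> 0" by blast
  have "0 < (\<Sum>e\<in>E. ev (pdiff (dderiv e p) (dderiv e p)) 0)"
    by (rule sum_pos2[where f = "\<lambda>e. ev (pdiff (dderiv e p) (dderiv e p)) 0", OF fin_E e(1) Suc.IH[OF hom e(2)] nn])
  also have "\<dots> = ev (pdiff (of_nat (Suc n) * p) p) 0"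
    unfolding eu by (simp add: pdiff_sum_left mult.commute[of "lin _"] pdiff_mult pdiff_lin)
  also have "of_nat (Suc n) * p = cst (of_nat (Suc n)) * p" by (rule rpoly_eqI) simp
  finally have "0 < of_nat (Suc n) * ev (pdiff p p) 0" by (simp only: pdiff_mult pdiff_cst ev_simps)
  then show ?case by (simp add: zero_less_mult_iff)
qed

end

section \<open>The annihilator\<close>

context roots_frame
begin

definition pos_prod :: "'a rpoly" where "pos_prod = (\<Prod>g\<in>pos. lin g)"

lemma homog_pos_prod: "homog (card pos) pos_prod"
  unfolding pos_prod_def using homog_prod[of pos "\<lambda>_. 1" lin] by simp

lemma pos_prod_nonzero: "pos_prod \<noteq> 0"
  using fin_pos pos_nonzero by (auto simp: pos_prod_def)

lemma pos_prod_square: "(\<Prod>g\<in>\<Phi>. lin g) = (-1) ^ card pos * pos_prod\<^sup>2"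
proof -
  have \<Phi>: "\<Phi> = pos \<union> uminus ` pos"
  proof (intro antisym subsetI)
    fix g assume "g \<in> \<Phi>"
    then show "g \<in> pos \<union> uminus ` pos"
      using pos_or_neg[of g] by (auto intro: image_eqI[of g uminus "- g"])
  qed (use pos_sub crystallographic_neg[OF crystallographic] in auto)
  have disj: "pos \<inter> uminus ` pos = {}"
  proof -
    have "- g \<notin> pos" if "g \<in> pos" for g
      using ht_ge_1[OF that] ht_ge_1[of "- g"] by (auto simp: linear_neg[OF linear_ht])
    then show ?thesis by auto
  qed
  have "(\<Prod>g\<in>\<Phi>. lin g) = pos_prod * (\<Prod>g\<in>uminus ` pos. lin g)"
    unfolding pos_prod_def by (subst \<Phi>, rule prod.union_disjoint) (use fin_pos disj in auto)
  also have "(\<Prod>g\<in>uminus ` pos. lin g) = (\<Prod>g\<in>pos. (-1) * lin g)"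
    by (subst prod.reindex) (auto simp: lin_simps)
  also have "\<dots> = (-1) ^ card pos * pos_prod" unfolding pos_prod_def prod.distrib by simp
  finally show ?thesis by (simp add: power2_eq_square ac_simps)
qed

text \<open>The product of all roots is \<open>\<plusminus>P\<^sup>2\<close> and invariant, so the reflection changes \<open>P\<close> at most by a sign.  If \<open>P\<close> were
  fixed, then the product of the positive roots other than \<open>a\<close> would change its sign and therefore vanish on
  \<open>ker a\<close>, but none of its factors does.\<close>

lemma pull_pos_prod:
  assumes a: "a \<in> pos"
  shows "pull (reflection a) pos_prod = - pos_prod"
proof -
  let ?s = "reflection a"
  note bl = bounded_linear_reflection[of a]
  have a\<Phi>: "a \<in> \<Phi>" using a pos_sub by blast
  have "pull ?s (\<Prod>g\<in>\<Phi>. lin g) = (\<Prod>g\<in>\<Phi>. lin (?s g))"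
    by (rule rpoly_eqI) (simp add: bl inner_reflection_swap)
  also have "\<dots> = (\<Prod>g\<in>\<Phi>. lin g)"
    by (rule prod.reindex_bij_witness[of _ ?s ?s])
      (use crystallographicD(3)[OF crystallographic a\<Phi>] in \<open>auto simp: reflection_reflection\<close>)
  finally have "(-1) ^ card pos * (pull ?s pos_prod)\<^sup>2 = (-1) ^ card pos * pos_prod\<^sup>2"
    unfolding pos_prod_square by (simp add: pull_simps[OF bl] pull_power[OF bl])
  then have "(pull ?s pos_prod)\<^sup>2 = pos_prod\<^sup>2" by simp
  then consider "pull ?s pos_prod = pos_prod" | "pull ?s pos_prod = - pos_prod" by (auto simp: power2_eq_iff)
  then show ?thesis
  proof cases
    case 1
    define R where "R = (\<Prod>g\<in>pos - {a}. lin g)"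
    have PR: "pos_prod = lin a * R" unfolding pos_prod_def R_def using fin_pos a by (rule prod.remove)
    have "pull ?s (lin a) = - lin a" by (rule rpoly_eqI) (simp add: bl inner_self_reflection)
    then have "lin a * R = lin a * (- pull ?s R)" using 1 unfolding PR by (simp add: pull_simps[OF bl])
    then have R: "R = - pull ?s R" using pos_nonzero[OF a] by (simp only: mult_cancel_left lin_eq_0_iff) simp
    have "lin a dvd R"
    proof (rule lin_dvdI)
      fix x assume "a \<bullet> x = 0"
      then have "?s x = x" by (simp add: reflection_def)
      then have "ev R x = - ev R x" using arg_cong[OF R, of "\<lambda>p. ev p x"] by (simp add: bl)
      then show "ev R x = 0" by simp
    qed
    then obtain g where "g \<in> pos - {a}" "lin a dvd lin g"
      unfolding R_def using lin_dvd_prod[of "pos - {a}" a lin] fin_pos pos_nonzero[OF a] by auto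
    then show ?thesis using lin_not_dvd[OF a, of g] by auto
  qed
qed

text \<open>Like \<open>P\<close>, the polynomial \<open>h = \<partial>\<^sub>c P\<close> changes its sign under reflections, so it vanishes on all hyperplanes and
  is a multiple of \<open>P\<close>.  Its degree is smaller, hence it is 0.\<close>

lemma invariant_kills_pos_prod:
  assumes c: "weyl_invariant c" "homog n c" "n > 0"
  shows "pdiff c pos_prod = 0"
proof -
  define h where "h = pdiff c pos_prod"
  have "lin a dvd h" if a: "a \<in> pos" for a
  proof (rule lin_dvdI)
    fix x assume "a \<bullet> x = 0"
    then have s: "reflection a x = x" by (simp add: reflection_def)
    note bl = bounded_linear_reflection[of a]
    have "pull (reflection a) c = c" using c(1) W_reflection a pos_sub by (auto simp: weyl_invariant_def)
    then have "pdiff c (pull (reflection a) pos_prod) = pull (reflection a) h"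
      using pdiff_pull[OF bl inner_reflection_swap, of c pos_prod] by (simp add: h_def)
    then have "- h = pull (reflection a) h" by (simp add: pull_pos_prod[OF a] pdiff_uminus_right h_def)
    then have "- ev h x = ev h x" using arg_cong[of "- h" _ "\<lambda>p. ev p x"] bl s by (metis ev_pull ev_simps(5))
    then show "ev h x = 0" by simp
  qed
  then have "(\<Prod>g\<in>pos. lin g ^ 1) dvd h"
    by (intro prod_lin_power_dvd[OF fin_pos]) (use lin_not_dvd pos_nonzero in auto)
  then obtain q where q: "h = pos_prod * q" unfolding pos_prod_def by (auto elim: dvdE)
  \<comment> \<open>That the degree of \<open>h\<close> drops by \<open>n\<close> is expressed by its behaviour under scalings.\<close>
  have scale: "t ^ card pos * ev h x = t ^ n * ev h (t *\<^sub>R x)" for t x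
  proof -
    note bl = bounded_linear_scaleR_right[of t, where 'a = 'a]
    have 1: "pull ((*\<^sub>R) t) pos_prod = cst (t ^ card pos) * pos_prod"
      using homog_pos_prod by (intro rpoly_eqI) (simp add: bl homog_def)
    have 2: "pull ((*\<^sub>R) t) c = cst (t ^ n) * c"
      using c(2) by (intro rpoly_eqI) (simp add: bl homog_def)
    have "pdiff c (cst (t ^ card pos) * pos_prod) = pull ((*\<^sub>R) t) (pdiff (cst (t ^ n) * c) pos_prod)"
      using pdiff_pull[OF bl, of c pos_prod] unfolding 1 2 by simp
    moreover have "pdiff c (cst (t ^ card pos) * pos_prod) = cst (t ^ card pos) * h"
    proof -
      have "pdiff c (cst (t ^ card pos) * pos_prod) = pdiff (c * cst (t ^ card pos)) pos_prod" by (simp only: pdiff_cst pdiff_mult)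
      also have "\<dots> = pdiff (cst (t ^ card pos) * c) pos_prod" by (simp only: mult.commute)
      also have "\<dots> = cst (t ^ card pos) * h" by (simp only: pdiff_cst pdiff_mult h_def)
      finally show ?thesis .
    qed
    moreover have "pdiff (cst (t ^ n) * c) pos_prod = cst (t ^ n) * h" by (simp add: pdiff_mult pdiff_cst h_def)
    ultimately have "cst (t ^ card pos) * h = pull ((*\<^sub>R) t) (cst (t ^ n) * h)" by simp
    from arg_cong[OF this, of "\<lambda>p. ev p x"] show ?thesis by (simp add: bl)
  qed
  have "hcomp j h = 0" for j
  proof (rule rpoly_eqI)
    fix x
    have "poly (monom 1 n * ray (ev h) x) t = poly (monom (ev h x) (card pos)) t" for t
      using scale[of t x] by (simp add: poly_monom poly_ray mult.commute)
    then have "monom 1 n * ray (ev h) x = monom (ev h x) (card pos)"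
      by (simp add: poly_eq_poly_eq_iff[symmetric] fun_eq_iff)
    from arg_cong[OF this, of "\<lambda>p. coeff p (j + n)"]
    have co: "coeff (ray (ev h) x) j = (if card pos = j + n then ev h x else 0)"
      by (simp add: coeff_monom_mult)
    show "ev (hcomp j h) x = ev 0 x"
    proof (cases "card pos = j + n")
      case True
      then have "hcomp j h = 0" unfolding q using c(3) by (simp add: hcomp_mult_homog[OF homog_pos_prod])
      then show ?thesis by simp
    next
      case False then show ?thesis using co by (simp add: ev_hcomp)
    qed
  qed
  note hc0 = this
  have "h = 0" by (rule hcomp_ext) (simp add: hc0)
  then show ?thesis by (simp add: h_def)
qed

lemma ideal_kills_pos_prod:
  assumes "\<theta> \<in> logder pos"
  shows "pdiff (radial \<theta>) pos_prod = 0"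
proof -
  obtain v d where vd: "free_basis v d pos" "\<forall>e\<in>E. \<forall>w\<in>W. weyl_act w (v e) = v e"
    using invariant_basis by blast
  interpret invariant_basis \<Phi> \<Delta> E v d by standard (use vd in auto)
  obtain r where "\<theta> = (\<Sum>e\<in>E. r e \<odot> v e)" using free_basis_rep[OF vd(1) assms] by blast
  then have "pdiff (radial \<theta>) pos_prod = (\<Sum>e\<in>E. pdiff (r e) (pdiff (fund e) pos_prod))" by (simp add: pdiff_sum_left pdiff_mult fund_def)
  also have "\<dots> = 0" using invariant_kills_pos_prod[OF weyl_invariant_fund homog_fund] by (simp add: pdiff_0_right)
  finally show ?thesis .
qed

text \<open>If \<open>p\<close> were outside of the ideal, \<open>socle_multiple\<close> would provide a multiple of \<open>p\<close> that is congruent to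
  \<open>c * (\<Prod>g\<in>I. lin g)\<close>; times \<open>\<beta>\<close> this becomes \<open>c * P\<close> modulo polynomials that kill \<open>P\<close>, which
  contradicts positivity.\<close>

theorem annihilator:
  assumes I: "lower I"
  shows "pdiff (p * (\<Prod>g\<in>pos - I. lin g)) pos_prod = 0 \<longleftrightarrow> p \<in> radial ` logder I"
proof
  define \<beta> where "\<beta> = (\<Prod>g\<in>pos - I. lin g)"
  have kill: "pdiff (radial a * \<beta>) pos_prod = 0" if a: "a \<in> logder I" for a
  proof -
    have "lin g dvd coord g (\<beta> \<odot> a)" if "g \<in> pos" for g
    proof (cases "g \<in> I")
      case True then show ?thesis using logder_dvd[OF a] by simp
    next
      case False
      then have "lin g dvd \<beta>" unfolding \<beta>_def using that fin_pos by (intro dvd_prodI) auto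
      then show ?thesis by simp
    qed
    then have "\<beta> \<odot> a \<in> logder pos" by (simp add: logder_def)
    from ideal_kills_pos_prod[OF this] show ?thesis by (simp add: mult.commute)
  qed
  show "pdiff (p * (\<Prod>g\<in>pos - I. lin g)) pos_prod = 0" if "p \<in> radial ` logder I"
    using that kill unfolding \<beta>_def by auto
  show "p \<in> radial ` logder I" if p: "pdiff (p * (\<Prod>g\<in>pos - I. lin g)) pos_prod = 0"
  proof (rule ccontr)
    assume "p \<notin> radial ` logder I"
    from socle_multiple[OF I this] obtain q c a where
      qca: "a \<in> logder I" "c \<noteq> 0" "q * p = cst c * (\<Prod>g\<in>I. lin g) + radial a" by blast
    have "pos = I \<union> (pos - I)" using lower_pos[OF I] by auto
    then have PI: "pos_prod = (\<Prod>g\<in>I. lin g) * \<beta>"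
      unfolding pos_prod_def \<beta>_def using prod.union_disjoint[of I "pos - I" lin] lower_fin[OF I] fin_pos by auto
    have "0 = pdiff q (pdiff (p * \<beta>) pos_prod)" using p by (simp add: \<beta>_def pdiff_0_right)
    also have "\<dots> = pdiff (q * p * \<beta>) pos_prod" by (simp only: pdiff_mult mult.assoc)
    also have "q * p * \<beta> = cst c * pos_prod + radial a * \<beta>" unfolding qca(3) PI by (simp add: algebra_simps)
    also have "pdiff \<dots> pos_prod = cst c * pdiff pos_prod pos_prod"
      unfolding pdiff_add_left kill[OF qca(1)] by (simp add: pdiff_mult pdiff_cst)
    finally have "0 = c * ev (pdiff pos_prod pos_prod) 0" by (metis ev_simps(1,6,7))
    then show False using qca(2) pdiff_self_pos[OF homog_pos_prod pos_prod_nonzero] by simp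
  qed
qed

section \<open>Invariant quadratic forms\<close>

lemma log_derivations_vev:
  fixes I :: "'a set"
  shows "log_derivations I = vev ` logder I"
proof -
  have d: "deriv_apply \<theta> (\<lambda>x. a \<bullet> x) = (\<lambda>x. a \<bullet> \<theta> x)" for \<theta> :: "'a \<Rightarrow> 'a" and a
    by (simp add: deriv_apply_def dir_deriv_inner)
  have LD: "log_derivations I = {\<theta>. polynomial_function \<theta> \<and>
      (\<forall>a\<in>I. \<exists>h. real_polynomial_function h \<and> (\<lambda>x. a \<bullet> \<theta> x) = (\<lambda>x. h x * (a \<bullet> x)))}"
    unfolding log_derivations_def d ..
  show ?thesis
  proof (intro antisym subsetI)
    fix \<theta> assume \<theta>: "\<theta> \<in> log_derivations I"
    then have pf: "polynomial_function \<theta>" by (simp add: log_derivations_def)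
    have "lin a dvd coord a (Vf \<theta>)" if a: "a \<in> I" for a
    proof -
      obtain h where h: "real_polynomial_function h" "(\<lambda>x. a \<bullet> \<theta> x) = (\<lambda>x. h x * (a \<bullet> x))"
        using \<theta> a unfolding LD by blast
      have "coord a (Vf \<theta>) = lin a * Rpoly h"
        using fun_cong[OF h(2)] by (intro rpoly_eqI) (simp add: vev_Vf[OF pf] ev_Rpoly[OF h(1)] mult.commute)
      then show ?thesis by simp
    qed
    then have "Vf \<theta> \<in> logder I" by (simp add: logder_def)
    then show "\<theta> \<in> vev ` logder I" using vev_Vf[OF pf] by (metis imageI)
  next
    fix \<theta> assume "\<theta> \<in> vev ` logder I"
    then obtain t where t: "t \<in> logder I" "\<theta> = vev t" by blast
    have "\<exists>h. real_polynomial_function h \<and> (\<lambda>x. a \<bullet> vev t x) = (\<lambda>x. h x * (a \<bullet> x))" if a: "a \<in> I" for a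
    proof -
      obtain h where h: "coord a t = lin a * h" using logder_dvd[OF t(1) a] by (rule dvdE)
      have "a \<bullet> vev t x = ev h x * (a \<bullet> x)" for x
        using arg_cong[OF h, of "\<lambda>p. ev p x"] by (simp add: mult.commute)
      then show ?thesis using rpf_ev by blast
    qed
    then show "\<theta> \<in> log_derivations I" using vev[of t] by (simp add: LD t(2))
  qed
qed

text \<open>The form is \<open>Q x = S x \<bullet> x\<close> with an invertible self-adjoint \<open>S\<close>, and the ideal consists of the polynomials
  \<open>2 x \<bullet> S (\<theta> x) = radial (2 S \<theta>)\<close>.  Invariance under the reflection in \<open>a\<close> makes \<open>a\<close> an eigenvector of \<open>S\<close>, so
  \<open>\<theta> \<mapsto> 2 S \<theta>\<close> preserves tangency to \<open>ker a\<close>, and so does the inverse map.\<close>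

lemma ideal_of_radial:
  assumes Q: "invariant_nondegenerate_quadratic_form \<Phi> Q" and I: "I \<subseteq> \<Phi>"
  shows "ideal_of Q I = ev ` radial ` logder I"
proof -
  note Q' = Q[unfolded invariant_nondegenerate_quadratic_form_def]
  obtain B where B': "bilinear B \<and> (\<forall>x y. B x y = B y x) \<and> (\<forall>x. Q x = B x x) \<and>
          (\<forall>x. (\<forall>y. B x y = 0) \<longrightarrow> x = 0)" using conjunct1[OF Q'] by (rule exE)
  then have B: "bilinear B" "\<And>x y. B x y = B y x" "\<And>x. Q x = B x x" "\<And>x. (\<forall>y. B x y = 0) \<Longrightarrow> x = 0"
    by simp_all
  have inv: "\<And>w x. w \<in> W \<Longrightarrow> Q (w x) = Q x" using conjunct2[OF Q'] by simp
  have Bl: "linear (B x)" "linear (\<lambda>y. B y x)" for x using B(1) by (auto simp: bilinear_def)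
  define S where "S x = (\<Sum>e\<in>E. B x e *\<^sub>R e)" for x
  have BS: "B x y = S x \<bullet> y" for x y
  proof -
    have "B x y = B x (\<Sum>e\<in>E. (e \<bullet> y) *\<^sub>R e)" using expand[of y] by simp
    also have "\<dots> = (\<Sum>e\<in>E. (e \<bullet> y) * B x e)" by (simp add: linear_sum[OF Bl(1)] linear_scale[OF Bl(1)])
    also have "\<dots> = S x \<bullet> y" by (simp add: S_def inner_sum_left mult.commute)
    finally show ?thesis .
  qed
  have "linear S"
    by (rule linearI) (simp_all add: S_def linear_add[OF Bl(2)] linear_scale[OF Bl(2)] scaleR_add_left sum.distrib scaleR_sum_right)
  then have S: "bounded_linear S" by (rule linear_bounded)
  have self: "x \<bullet> S y = S x \<bullet> y" for x y using BS[of x y] BS[of y x] B(2)[of x y] by (simp add: inner_commute)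
  have Binv: "B (w x) (w y) = B x y" if w: "w \<in> W" for w x y
  proof -
    have add: "Q (x + y) = Q x + 2 * B x y + Q y" for x y
      by (simp add: B(3) linear_add[OF Bl(1)] linear_add[OF Bl(2)] B(2)[of y x])
    have "Q (w x + w y) = Q (x + y)" using inv[OF w, of "x + y"] W_linear(1)[OF w] by simp
    then show ?thesis unfolding add inv[OF w] by simp
  qed
  have "\<exists>k. k \<noteq> 0 \<and> S a = k *\<^sub>R a" if a: "a \<in> \<Phi>" for a
  proof -
    have a0: "a \<noteq> 0" using a crystallographicD(2)[OF crystallographic] by blast
    define y where "y = hproj a (S a)"
    have ay: "a \<bullet> y = 0" by (simp add: y_def inner_hproj)
    have "B a y = B (reflection a a) (reflection a y)" using Binv[OF W_reflection[OF a]] by simp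
    also have "\<dots> = B (- a) y" using ay reflection_self[OF a0] by (simp add: reflection_def)
    also have "\<dots> = - B a y" by (rule linear_neg[OF Bl(2)])
    finally have "S a \<bullet> y = 0" by (simp add: BS)
    moreover have "S a = y + ((a \<bullet> S a) / (a \<bullet> a)) *\<^sub>R a" by (simp add: y_def hproj_def)
    then have "S a \<bullet> y = y \<bullet> y" using ay by (metis inner_add_left inner_scaleR_left add.right_neutral mult_zero_right)
    ultimately have "y = 0" by simp
    then have eq: "S a = ((a \<bullet> S a) / (a \<bullet> a)) *\<^sub>R a" by (simp add: y_def hproj_def)
    moreover have "(a \<bullet> S a) / (a \<bullet> a) \<noteq> 0"
    proof
      assume "(a \<bullet> S a) / (a \<bullet> a) = 0"
      then have "S a = 0" using eq by (metis scale_zero_left)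
      then have "\<forall>y. B a y = 0" by (simp add: BS)
      then show False using B(4) a0 by blast
    qed
    ultimately show ?thesis by blast
  qed
  then obtain k where k: "\<And>a. a \<in> \<Phi> \<Longrightarrow> k a \<noteq> 0" "\<And>a. a \<in> \<Phi> \<Longrightarrow> S a = k a *\<^sub>R a" by metis
  have "surj S"
  proof -
    have "a \<in> range S" if "a \<in> \<Phi>" for a
    proof -
      have "S ((1 / k a) *\<^sub>R a) = a" using k[OF that] linear_scale[OF \<open>linear S\<close>] by simp
      then show ?thesis by (metis rangeI)
    qed
    then have "span \<Phi> \<subseteq> range S"
      using linear_subspace_image[OF \<open>linear S\<close> subspace_UNIV] by (intro span_minimal) auto
    then show ?thesis using span_\<Phi> by auto
  qed
  then obtain T where T: "linear T" "S \<circ> T = id"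
    using linear_surjective_right_inverse[OF \<open>linear S\<close>] by blast
  have ST: "S (T x) = x" for x using T(2) by (metis comp_apply id_apply)
  have comp: "polynomial_function (\<lambda>x. c *\<^sub>R L (vev t x))" if L: "linear L" for L :: "'a \<Rightarrow> 'a" and t :: "'a vf" and c
    unfolding polynomial_function_def
  proof (intro allI impI)
    fix g :: "'a \<Rightarrow> real" assume "bounded_linear g"
    then have "bounded_linear (\<lambda>x. g (c *\<^sub>R L x))"
      by (rule bounded_linear_compose) (intro bounded_linear_const_scaleR linear_bounded[OF L])
    moreover have "polynomial_function (vev t)" using vev[of t] by simp
    ultimately show "real_polynomial_function (g \<circ> (\<lambda>x. c *\<^sub>R L (vev t x)))"
      unfolding polynomial_function_def o_def by blast
  qed
  have der: "deriv_apply (vev t) Q x = 2 * (x \<bullet> S (vev t x))" for t x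
  proof -
    have "(Q has_derivative (\<lambda>h. S x \<bullet> h + S h \<bullet> x)) (at x)" for x
      unfolding B(3)[abs_def] BS
      by (rule has_derivative_inner[OF bounded_linear_imp_has_derivative[OF S] has_derivative_ident])
    then have "dir_deriv v Q = (\<lambda>x. S x \<bullet> v + S v \<bullet> x)" for v by (rule dir_deriv_eq)
    then show ?thesis using self[of x "vev t x"] by (simp add: deriv_apply_def inner_commute)
  qed
  show ?thesis
    unfolding ideal_of_def log_derivations_vev
  proof (intro antisym subsetI)
    fix g assume "g \<in> {deriv_apply \<theta> Q |\<theta>. \<theta> \<in> vev ` logder I}"
    then obtain t where t: "t \<in> logder I" "g = deriv_apply (vev t) Q" by blast
    define u where "u = Vf (\<lambda>x. 2 *\<^sub>R S (vev t x))"
    have vu: "vev u x = 2 *\<^sub>R S (vev t x)" for x unfolding u_def by (simp add: vev_Vf[OF comp[OF \<open>linear S\<close>]])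
    have "lin a dvd coord a u" if a: "a \<in> I" for a
    proof (rule lin_dvdI)
      fix x assume "a \<bullet> x = 0"
      then have "a \<bullet> vev t x = 0" using lin_dvdD[OF logder_dvd[OF t(1) a]] by simp
      then show "ev (coord a u) x = 0" using k(2)[of a] a I by (auto simp: vu self)
    qed
    then have "u \<in> logder I" by (simp add: logder_def)
    moreover have "g = ev (radial u)" by (rule ext) (simp add: t(2) der vu)
    ultimately show "g \<in> ev ` radial ` logder I" by blast
  next
    fix g assume "g \<in> ev ` radial ` logder I"
    then obtain u where u: "u \<in> logder I" "g = ev (radial u)" by blast
    define t where "t = Vf (\<lambda>x. (1 / 2) *\<^sub>R T (vev u x))"
    have vt: "vev t x = (1 / 2) *\<^sub>R T (vev u x)" for x unfolding t_def by (simp add: vev_Vf[OF comp[OF T(1)]])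
    have "lin a dvd coord a t" if a: "a \<in> I" for a
    proof (rule lin_dvdI)
      fix x assume "a \<bullet> x = 0"
      then have "a \<bullet> vev u x = 0" using lin_dvdD[OF logder_dvd[OF u(1) a]] by simp
      then have "S a \<bullet> T (vev u x) = 0" by (simp add: self[symmetric] ST)
      then show "ev (coord a t) x = 0" using k[of a] a I by (auto simp: vt)
    qed
    then have "t \<in> logder I" by (simp add: logder_def)
    moreover have "g = deriv_apply (vev t) Q"
      by (rule ext) (simp add: u(2) der vt linear_scale[OF \<open>linear S\<close>] ST)
    ultimately show "g \<in> {deriv_apply \<theta> Q |\<theta>. \<theta> \<in> vev ` logder I}" by blast
  qed
qed

lemma root_product_ev: "root_product A = ev (\<Prod>a\<in>A. lin a)"
  by (rule ext) (simp add: root_product_def)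

lemma Ann_P_of: "Ann (P_of \<Phi> \<Delta> I) = ev ` {p. pdiff (p * (\<Prod>g\<in>pos - I. lin g)) pos_prod = 0}"
proof -
  have P: "P_of \<Phi> \<Delta> I = ev (pdiff (\<Prod>g\<in>pos - I. lin g) pos_prod)"
    by (simp only: P_of_def root_product_ev ev_pdiff pos_prod_def)
  have eq: "diff_op (ev p) (P_of \<Phi> \<Delta> I) = ev (pdiff (p * (\<Prod>g\<in>pos - I. lin g)) pos_prod)" for p
    unfolding P ev_pdiff[symmetric] pdiff_mult ..
  have zero: "ev p = (\<lambda>x. 0) \<longleftrightarrow> p = 0" for p :: "'a rpoly"
    unfolding zero_rpoly.rep_eq[symmetric] ev_inject ..
  show ?thesis
  proof (intro antisym subsetI)
    fix g assume "g \<in> Ann (P_of \<Phi> \<Delta> I)"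
    then have g: "real_polynomial_function g" "diff_op g (P_of \<Phi> \<Delta> I) = (\<lambda>x. 0)" by (auto simp: Ann_def)
    have "g = ev (Rpoly g)" using ev_Rpoly[OF g(1)] by simp
    moreover have "pdiff (Rpoly g * (\<Prod>g\<in>pos - I. lin g)) pos_prod = 0"
      using g(2) eq[of "Rpoly g"] unfolding ev_Rpoly[OF g(1)] zero[symmetric] by simp
    ultimately show "g \<in> ev ` {p. pdiff (p * (\<Prod>g\<in>pos - I. lin g)) pos_prod = 0}" by blast
  next
    fix g assume "g \<in> ev ` {p. pdiff (p * (\<Prod>g\<in>pos - I. lin g)) pos_prod = 0}"
    then obtain p where p: "g = ev p" "pdiff (p * (\<Prod>g\<in>pos - I. lin g)) pos_prod = 0" by blast
    have "diff_op (ev p) (P_of \<Phi> \<Delta> I) = (\<lambda>x. 0)" unfolding eq p(2) by (simp add: zero)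
    then show "g \<in> Ann (P_of \<Phi> \<Delta> I)" by (simp add: Ann_def p(1))
  qed
qed

end

theorem theorem11p3:
  fixes \<Phi> \<Delta> I :: "'a::real_inner set" and Q :: "'a \<Rightarrow> real"
  assumes "root_system \<Phi>"
    and "simple_roots \<Phi> \<Delta>"
    and "lower_ideal \<Phi> \<Delta> I"
    and "invariant_nondegenerate_quadratic_form \<Phi> Q"
  shows "Ann (P_of \<Phi> \<Delta> I) = ideal_of Q I"
proof -
  have "finite \<Phi>" "span \<Phi> = UNIV" using assms(1) by (auto simp: root_system_def)
  then obtain E where E: "finite E" "span E = (UNIV :: 'a set)"
    "\<forall>e\<in>E. \<forall>f\<in>E. e \<bullet> f = (if e = f then 1 else 0)"
    using orthonormal_spanning_set by metis
  interpret roots_frame \<Phi> \<Delta> E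
    by unfold_locales (use assms(1,2) E in auto)
  have "I \<subseteq> \<Phi>" using lower_pos[OF assms(3)] pos_sub by blast
  then show ?thesis
    unfolding ideal_of_radial[OF assms(4) \<open>I \<subseteq> \<Phi>\<close>] Ann_P_of using annihilator[OF assms(3)] by auto
qed

end
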